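(* Consider the problem $\hat\varphi_*=\min_{z\in\mathcal Z}\{\phi(z)=f(z)+h(z):g(z)\preceq_{\mathcal K}0\}$ with nonempty feasible set, under the assumptions listed in the context, and define $$\bar d=\operatorname{dist}(\bar z,\partial Z),\quad \phi_*=\inf_{z\in\mathcal Z}\phi(z),\quad R_\phi=\hat\varphi_*-\phi_*+\tfrac1\lambda D_z^2,$$ $$\kappa_0=2\left[K_h+B_f^{(1)}\right]D_z+\left[\frac{\theta^2}{2(1-\theta)^2}+2\left(\frac{1+\theta}{1-\theta}\right)\right]\frac{D_z^2}\lambda,$$ $$\kappa_1=M+\frac{\kappa_0L_g}{\min\{1,\bar d\}\tau},\quad\kappa_2=B_g^{(0)}L_g+[B_g^{(1)}]^2,\quad \kappa_3=\frac{16(1+2\theta)^2\max\{\|p_0\|,\kappa_0\}^2}{\lambda(1-\theta^2)\min\{1,\bar d^2\}\tau^2},$$ $$\kappa_4=\frac{\theta D_z}{\lambda(1-\theta)B_g^{(1)}}+\frac{2\max\{\|p_0\|,\kappa_0\}^2}{\min\{1,\bar d\}\tau},$$ $$\bar c(\hat\rho,\hat\eta)=\frac{\kappa_3}{\hat\rho^2}+\frac{\kappa_4}{\hat\eta},\qquad \mathcal T_{\hat\eta,\hat\rho}=[\lambda(\kappa_1+c_1\kappa_2)+1]\frac{\max\{c_1,2\bar c(\hat\rho,\hat\eta)\}}{c_1}.$$ Then the AIP.AL method (described in the context) outputs a pair $([\hat z,\hat p],[\hat v,\hat q])\in[Z\times\mathbb R^\ell]\times[\mathcal Z\times\mathbb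 R^\ell]$ satisfying $$\hat v\in\nabla f(\hat z)+\partial h(\hat z)+\nabla g(\hat z)\hat p,\quad\langle g(\hat z)+\hat q,\hat p\rangle=0,\quad g(\hat z)+\hat q\preceq_{\mathcal K}0,\quad\hat p\succeq_{\mathcal K^+}0,\quad \|\hat v\|\le\hat\rho,\quad\|\hat q\|\le\hat\eta$$ in $$\mathcal O\left(\frac{R_\phi}{\lambda\hat\rho^2}\sqrt{\frac{\mathcal T_{\hat\eta,\hat\rho}}{1-\lambda m}}\,\log_1^+\left[\frac{\mathcal T_{\hat\eta,\hat\rho}}\theta\right]\right)$$ inner iterations (i.e. total ACG iterations).
   Context: Notation. $\mathcal Z$ is a finite dimensional inner product space. $\overline{\mathrm{Conv}}(Z)$: proper lower semicontinuous convex functions $\mathcal Z\to(-\infty,\infty]$ real-valued exactly on $Z$. $\ell_F(u;z)=F(z)+\langle\nabla F(z),u-z\rangle$. $\mathcal C_{m,M}(Z)$: functions continuously differentiable on $Z$ (finite on an open set containing $Z$) with $-\frac m2\|u-z\|^2\le f(u)-\ell_f(u;z)\le\frac M2\|u-z\|^2$ for $u,z\in Z$. $\mathcal K\subseteq\mathbb R^\ell$ is a closed convex cone, $\mathcal K^+$ its dual cone, $a\preceq_{\mathcal K}b$ means $b-a\in\mathcal K$, and $p\succeq_{\mathcal K^+}0$ means $p\in\mathcal K^+$; $\nabla g(z)$ is the transpose of the Jacobian of $g$. $\Pi_C$ is the projection onto $C$; $\partial Z$ (for a set $Z$) is its boundary. $\log_1^+(t)=\max\{\log t,1\}$. For a differentiable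 $\Psi$, $B_\Psi^{(0)}=\sup_{z\in Z}\|\Psi(z)\|$, $B_\Psi^{(1)}=\sup_{z\in Z}\|\nabla\Psi(z)\|$. The $\mathcal O(\cdot)$ is with respect to the tolerances: there is a constant, independent of $(\hat\rho,\hat\eta)$, multiplying the displayed quantity, for all sufficiently small $\hat\rho,\hat\eta$. Assumptions. (i) $h\in\overline{\mathrm{Conv}}(Z)$ with $Z$ nonempty, convex and compact of diameter $D_z$, and $h$ is $K_h$-Lipschitz continuous on $Z$, $K_h>0$; (ii) $f\in\mathcal C_{m,M}(Z)$ with $0<m\le M$; (iii) $g:\mathcal Z\to\mathbb R^\ell$ is continuously differentiable, $\mathcal K$-convex (i.e. $g(tu+(1-t)z)\preceq_{\mathcal K}tg(u)+(1-t)g(z)$ for $t\in[0,1]$), and $\|\nabla g(u)-\nabla g(z)\|\le L_g\|u-z\|$ for all $u,z$, with $L_g>0$; (iv) there are $\bar z\in\operatorname{int}Z$ and $\tau\in(0,1]$ with $g(\bar z)\preceq_{\mathcal K}0$ and $\max\{\|\nabla g(z)p\|,|\langle g(\bar z),p\rangle|\}\ge\tau\|p\|$ for all $z\in Z$, $p\in\mathcal K^+$. Inputs: $\hat\rho,\hat\eta>0$, $\lambda\in(0,1/m)$, $\theta\in(0,1/\sqrt2]$, $c_1>0$, $(z_0,p_0)\in Z\times\mathbb R^\ell$. Lagrangian. $\widetilde{\mathcal L}_c(z;p)=f(z)+\frac1{2c}[\operatorname{dist}^2(p+cg(z),-\mathcal K)-\|p\|^2]$, $\mathcal L_c=\widetilde{\mathcal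 L}_c+h$, and $\widetilde L(c,p)=M+L_g\|p\|+c(B_g^{(0)}L_g+[B_g^{(1)}]^2)$. ACG iterations with inputs $(\psi_s,\psi_n,y_0,\mu,L)$: $\psi=\psi_s+\psi_n$, $A_0=0$, $\Gamma_0\equiv0$, $x_0=y_0$, and for $k\ge1$: $\tau_{k-1}=(1+\mu A_{k-1})/L$, $a_{k-1}=\frac12(\tau_{k-1}+\sqrt{\tau_{k-1}^2+4\tau_{k-1}A_{k-1}})$, $A_k=A_{k-1}+a_{k-1}$, $\tilde x_{k-1}=\frac{A_{k-1}}{A_k}y_{k-1}+\frac{a_{k-1}}{A_k}x_{k-1}$, $q_k=\ell_{\psi_s}(\cdot;\tilde x_{k-1})+\psi_n+\frac\mu2\|\cdot-\tilde x_{k-1}\|^2$, $y_k=\operatorname{argmin}_y\{\frac1Lq_k(y)+\frac12\|y-\tilde x_{k-1}\|^2\}$, $x_k=x_{k-1}+\frac{a_{k-1}}{1+\mu A_k}[L(y_k-\tilde x_{k-1})+\mu(y_k-x_{k-1})]$, $\gamma_{k-1}=q_k(y_k)+L\langle\tilde x_{k-1}-y_k,\cdot-y_k\rangle+\frac\mu2\|\cdot-y_k\|^2$, $\Gamma_k=\frac{A_{k-1}}{A_k}\Gamma_{k-1}+\frac{a_{k-1}}{A_k}\gamma_{k-1}$, $r_k=(x_0-x_k)/A_k$, $\eta_k=\psi(y_k)-\Gamma_k(x_k)-\langle r_k,y_k-x_k\rangle$. ACG3, with extra input $\sigma$, returns $(y_k,r_k,\eta_k)$ at the first $k$ with $\|r_k\|^2+2\eta_k\le\sigma\|y_0-y_k+r_k\|^2$.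 AIP.AL method: set $\mu=1-\lambda m$, $\hat k=0$. For $k=1,2,\dots$: (1) $\psi_s^k=\lambda\widetilde{\mathcal L}_{c_k}(\cdot;p_{k-1})+\frac12\|\cdot-z_{k-1}\|^2$, $L_{k-1}^\psi=\lambda\widetilde L(c_k,p_{k-1})+1$, $\sigma_{k-1}=\theta^2/L^\psi_{k-1}$; let $(z_k,\tilde v_k,\tilde\varepsilon_k)$ be the output of ACG3 with inputs $(\psi_s^k,\lambda h,z_{k-1},\mu,L_{k-1}^\psi)$ and $\sigma=\sigma_{k-1}$. (2) With $F=\widetilde{\mathcal L}_{c_k}(\cdot;p_{k-1})$ and $\bar L=L_{k-1}^\psi/\lambda$: $\hat z_k=\operatorname{argmin}_u\{\ell_F(u;z_k)+h(u)+\frac{\bar L}2\|u-z_k\|^2\}$, $\hat v_k=\bar L(z_k-\hat z_k)+\nabla F(\hat z_k)-\nabla F(z_k)$; $p_k=\Pi_{\mathcal K^+}(p_{k-1}+c_kg(z_k))$, $\hat p_k=\Pi_{\mathcal K^+}(p_{k-1}+c_kg(\hat z_k))$, $\hat q_k=(p_{k-1}-\hat p_k)/c_k$. If $\|\hat v_k\|\le\hat\rho$ and $\|\hat q_k\|\le\hat\eta$, stop and output $([\hat z_k,\hat p_k],[\hat v_k,\hat q_k])$. (3) If $k>\hat k+1$ and $\Delta_k:=[\mathcal L_{c_k}(z_{\hat k+1};p_{\hat k+1})-\mathcal L_{c_k}(z_k;p_k)]/(k-\hat k-1)\le\lambda(1-\theta)\hat\rho^2/36$, set $c_{k+1}=2c_k$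 and $\hat k=k$; otherwise $c_{k+1}=c_k$.
   Formalization: Added assumption: at each visited ACG point x̃ outside Z (where ∇f may not exist), ψ_s is differentiable and (μ/2)‖u−x̃‖² ≤ ψ_s(u)−ℓ_{ψ_s}(u;x̃) ≤ (L/2)‖u−x̃‖² for all u in Z, with the μ, L passed to ACG; without it the method can be undefined. *)

theory Defs
  imports "HOL-Analysis.Analysis"
begin

section \<open>Derivatives, convex functions, cones\<close>

definition grad :: "('a::euclidean_space \<Rightarrow> real) \<Rightarrow> 'a \<Rightarrow> 'a" where
  "grad F z = (THE d. GDERIV F z :> d)"

text \<open>The transpose of the Jacobian, as a linear map.\<close>
definition nabla :: "('a::euclidean_space \<Rightarrow> 'b::euclidean_space) \<Rightarrow> 'a \<Rightarrow> 'b \<Rightarrow> 'a" where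
  "nabla g z = adjoint (frechet_derivative g (at z))"

text \<open>\<open>linz F z u\<close> is the linearisation of \<open>F\<close> at \<open>z\<close>, evaluated at \<open>u\<close>.\<close>
definition linz :: "('a::euclidean_space \<Rightarrow> real) \<Rightarrow> 'a \<Rightarrow> 'a \<Rightarrow> real" where
  "linz F z u = F z + grad F z \<bullet> (u - z)"

definition curvature_at ::
  "('a::euclidean_space \<Rightarrow> real) \<Rightarrow> real \<Rightarrow> real \<Rightarrow> 'a set \<Rightarrow> 'a \<Rightarrow> bool" where
  "curvature_at F m M Z z \<longleftrightarrow>
     F differentiable (at z) \<and>
     (\<forall>u\<in>Z. - (m / 2) * (norm (u - z))\<^sup>2 \<le> F u - linz F z u \<and>
            F u - linz F z u \<le> M / 2 * (norm (u - z))\<^sup>2)"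

text \<open>The class \<open>C\<^sub>m\<^sub>,\<^sub>M(Z)\<close>. Differentiability is that of \<open>F\<close> on full neighbourhoods of the points
  of \<open>Z\<close>; the values of \<open>F\<close> away from \<open>Z\<close> are otherwise arbitrary.\<close>
definition curvature_class ::
  "real \<Rightarrow> real \<Rightarrow> 'a::euclidean_space set \<Rightarrow> ('a \<Rightarrow> real) \<Rightarrow> bool" where
  "curvature_class m M Z F \<longleftrightarrow> continuous_on Z (grad F) \<and> (\<forall>z\<in>Z. curvature_at F m M Z z)"

definition closed_conv :: "'a::euclidean_space set \<Rightarrow> ('a \<Rightarrow> ereal) \<Rightarrow> bool" where
  "closed_conv Z h \<longleftrightarrow>
     Z \<noteq> {} \<and> (\<forall>x. h x \<noteq> - \<infinity>) \<and> {x. h x < \<infinity>} = Z \<and>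
     (\<forall>x y. \<forall>t\<in>{0..1}.
        h ((1 - t) *\<^sub>R x + t *\<^sub>R y) \<le> ereal (1 - t) * h x + ereal t * h y) \<and>
     (\<forall>x. h x \<le> Liminf (at x) h)"

definition subdiff :: "('a::euclidean_space \<Rightarrow> ereal) \<Rightarrow> 'a \<Rightarrow> 'a set" where
  "subdiff h z = {v. \<bar>h z\<bar> \<noteq> \<infinity> \<and> (\<forall>u. h z + ereal (v \<bullet> (u - z)) \<le> h u)}"

definition cone_le :: "'b::euclidean_space set \<Rightarrow> 'b \<Rightarrow> 'b \<Rightarrow> bool" where
  "cone_le K a b \<longleftrightarrow> b - a \<in> K"

definition dual_cone :: "'b::euclidean_space set \<Rightarrow> 'b set" where
  "dual_cone K = {p. \<forall>x\<in>K. 0 \<le> x \<bullet> p}"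

definition cone_convex :: "'b set \<Rightarrow> ('a::euclidean_space \<Rightarrow> 'b::euclidean_space) \<Rightarrow> bool" where
  "cone_convex K g \<longleftrightarrow>
     (\<forall>u z. \<forall>t\<in>{0..1}. cone_le K (g (t *\<^sub>R u + (1 - t) *\<^sub>R z)) (t *\<^sub>R g u + (1 - t) *\<^sub>R g z))"

definition cont_diff :: "('a::euclidean_space \<Rightarrow> 'b::euclidean_space) \<Rightarrow> bool" where
  "cont_diff g \<longleftrightarrow>
     (\<exists>g' :: 'a \<Rightarrow> 'a \<Rightarrow>\<^sub>L 'b. (\<forall>z. (g has_derivative blinfun_apply (g' z)) (at z)) \<and>
        continuous_on UNIV g')"

text \<open>The suprema \<open>B\<^sup>(\<^sup>0\<^sup>)\<close>, \<open>B\<^sup>(\<^sup>1\<^sup>)\<close> over \<open>Z\<close>; for vector-valued functions the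
  norm of the transposed Jacobian is the operator norm.\<close>
definition bnd0 :: "'a set \<Rightarrow> ('a::euclidean_space \<Rightarrow> 'b::euclidean_space) \<Rightarrow> real" where
  "bnd0 Z g = (SUP z\<in>Z. norm (g z))"

definition bnd1 :: "'a set \<Rightarrow> ('a::euclidean_space \<Rightarrow> 'b::euclidean_space) \<Rightarrow> real" where
  "bnd1 Z g = (SUP z\<in>Z. onorm (nabla g z))"

definition bnd1_real :: "'a set \<Rightarrow> ('a::euclidean_space \<Rightarrow> real) \<Rightarrow> real" where
  "bnd1_real Z F = (SUP z\<in>Z. norm (grad F z))"

definition argmin :: "('a \<Rightarrow> ereal) \<Rightarrow> 'a" where
  "argmin F = arg_min F (\<lambda>_. True)"

definition log1_plus :: "real \<Rightarrow> real" where
  "log1_plus t = max (ln t) 1"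


section \<open>The accelerated composite gradient iterations\<close>

record 'a acg_state =
  acgA :: real
  acgx :: 'a
  acgy :: 'a
  acgG :: "'a \<Rightarrow> real"

definition acg_a :: "real \<Rightarrow> real \<Rightarrow> real \<Rightarrow> real" where
  "acg_a \<mu> L A = (let \<tau> = (1 + \<mu> * A) / L in (\<tau> + sqrt (\<tau>\<^sup>2 + 4 * \<tau> * A)) / 2)"

definition acg_xtilde :: "real \<Rightarrow> real \<Rightarrow> 'a::euclidean_space acg_state \<Rightarrow> 'a" where
  "acg_xtilde \<mu> L s =
     (let A = acgA s; a = acg_a \<mu> L A
      in (A / (A + a)) *\<^sub>R acgy s + (a / (A + a)) *\<^sub>R acgx s)"

definition acg_q ::
  "('a::euclidean_space \<Rightarrow> real) \<Rightarrow> ('a \<Rightarrow> ereal) \<Rightarrow> real \<Rightarrow> 'a \<Rightarrow> 'a \<Rightarrow> ereal" where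
  "acg_q \<psi>s \<psi>n \<mu> xt u = ereal (linz \<psi>s xt u) + \<psi>n u + ereal (\<mu> / 2 * (norm (u - xt))\<^sup>2)"

text \<open>One iteration. The value \<open>q\<close> at the new iterate \<open>y\<close> is finite, since \<open>y\<close> lies in the domain
  of \<open>\<psi>n\<close>, so reading it as a real number is harmless.\<close>
definition acg_step ::
  "('a::euclidean_space \<Rightarrow> real) \<Rightarrow> ('a \<Rightarrow> ereal) \<Rightarrow> real \<Rightarrow> real \<Rightarrow> 'a acg_state \<Rightarrow> 'a acg_state" where
  "acg_step \<psi>s \<psi>n \<mu> L s =
     (let A = acgA s; a = acg_a \<mu> L A; A' = A + a; x = acgx s;
          xt = acg_xtilde \<mu> L s;
          q = acg_q \<psi>s \<psi>n \<mu> xt;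
          y = argmin (\<lambda>u. ereal (1 / L) * q u + ereal (1 / 2 * (norm (u - xt))\<^sup>2));
          x' = x + (a / (1 + \<mu> * A')) *\<^sub>R (L *\<^sub>R (y - xt) + \<mu> *\<^sub>R (y - x));
          \<gamma> = (\<lambda>u. real_of_ereal (q y) + L * ((xt - y) \<bullet> (u - y)) + \<mu> / 2 * (norm (u - y))\<^sup>2)
      in \<lparr>acgA = A', acgx = x', acgy = y, acgG = (\<lambda>u. A / A' * acgG s u + a / A' * \<gamma> u)\<rparr>)"

primrec acg ::
  "('a::euclidean_space \<Rightarrow> real) \<Rightarrow> ('a \<Rightarrow> ereal) \<Rightarrow> 'a \<Rightarrow> real \<Rightarrow> real \<Rightarrow> nat \<Rightarrow> 'a acg_state" where
  "acg \<psi>s \<psi>n y0 \<mu> L 0 = \<lparr>acgA = 0, acgx = y0, acgy = y0, acgG = (\<lambda>_. 0)\<rparr>"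
| "acg \<psi>s \<psi>n y0 \<mu> L (Suc k) = acg_step \<psi>s \<psi>n \<mu> L (acg \<psi>s \<psi>n y0 \<mu> L k)"

text \<open>The stopping test of ACG3 (with \<open>x\<^sub>0 = y\<^sub>0\<close>) at the \<open>k\<close>-th iterate, \<open>k \<ge> 1\<close>.\<close>
definition acg3_stop ::
  "('a::euclidean_space \<Rightarrow> real) \<Rightarrow> ('a \<Rightarrow> ereal) \<Rightarrow> 'a \<Rightarrow> real \<Rightarrow> real \<Rightarrow> real \<Rightarrow> nat \<Rightarrow> bool" where
  "acg3_stop \<psi>s \<psi>n y0 \<mu> L \<sigma> k \<longleftrightarrow> 1 \<le> k \<and>
     (let s = acg \<psi>s \<psi>n y0 \<mu> L k; x = acgx s; y = acgy s;
          r = (1 / acgA s) *\<^sub>R (y0 - x);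
          \<eta> = real_of_ereal (ereal (\<psi>s y) + \<psi>n y) - acgG s x - r \<bullet> (y - x)
      in (norm r)\<^sup>2 + 2 * \<eta> \<le> \<sigma> * (norm (y0 - y + r))\<^sup>2)"


section \<open>The augmented Lagrangian and the AIP.AL method\<close>

definition auglag ::
  "('a::euclidean_space \<Rightarrow> real) \<Rightarrow> ('a \<Rightarrow> 'b::euclidean_space) \<Rightarrow> 'b set \<Rightarrow> real \<Rightarrow> 'b
     \<Rightarrow> 'a \<Rightarrow> real" where
  "auglag f g K c p z =
     f z + 1 / (2 * c) * ((infdist (p + c *\<^sub>R g z) (uminus ` K))\<^sup>2 - (norm p)\<^sup>2)"

definition auglag_lip ::
  "real \<Rightarrow> real \<Rightarrow> ('a::euclidean_space \<Rightarrow> 'b::euclidean_space) \<Rightarrow> 'a set \<Rightarrow> real \<Rightarrow> 'b \<Rightarrow> real" where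
  "auglag_lip M Lg g Z c p = M + Lg * norm p + c * (bnd0 Z g * Lg + (bnd1 Z g)\<^sup>2)"

text \<open>Problem data and inputs of the method, except for the tolerances.\<close>
record ('a, 'b) al_data =
  al_f :: "'a \<Rightarrow> real"
  al_h :: "'a \<Rightarrow> ereal"
  al_g :: "'a \<Rightarrow> 'b"
  al_K :: "'b set"
  al_Z :: "'a set"
  al_m :: real
  al_M :: real
  al_Lg :: real
  al_lam :: real
  al_th :: real
  al_c1 :: real
  al_z0 :: 'a
  al_p0 :: 'b

text \<open>State after \<open>n = st_n s\<close> outer iterations: the sequences \<open>z\<close> and \<open>p\<close> (meaningful up to index
  \<open>n\<close>), the penalty parameter \<open>c\<^sub>n\<^sub>+\<^sub>1\<close>, and the start index \<open>k-hat\<close> of the current cycle. The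
  definitions below describe outer iteration \<open>n + 1\<close> started from this state.\<close>
record ('a, 'b) al_state =
  st_n :: nat
  st_z :: "nat \<Rightarrow> 'a"
  st_p :: "nat \<Rightarrow> 'b"
  st_c :: real
  st_khat :: nat

context
  fixes D :: "('a::euclidean_space, 'b::euclidean_space) al_data"
begin

definition al_zcur :: "('a, 'b) al_state \<Rightarrow> 'a" where
  "al_zcur s = st_z s (st_n s)"

definition al_pcur :: "('a, 'b) al_state \<Rightarrow> 'b" where
  "al_pcur s = st_p s (st_n s)"

definition al_F :: "('a, 'b) al_state \<Rightarrow> 'a \<Rightarrow> real" where
  "al_F s = auglag (al_f D) (al_g D) (al_K D) (st_c s) (al_pcur s)"

definition al_mu :: real where
  "al_mu = 1 - al_lam D * al_m D"

definition al_psis :: "('a, 'b) al_state \<Rightarrow> 'a \<Rightarrow> real" where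
  "al_psis s u = al_lam D * al_F s u + 1 / 2 * (norm (u - al_zcur s))\<^sup>2"

definition al_psin :: "'a \<Rightarrow> ereal" where
  "al_psin u = ereal (al_lam D) * al_h D u"

definition al_Lpsi :: "('a, 'b) al_state \<Rightarrow> real" where
  "al_Lpsi s =
     al_lam D * auglag_lip (al_M D) (al_Lg D) (al_g D) (al_Z D) (st_c s) (al_pcur s) + 1"

definition al_acg :: "('a, 'b) al_state \<Rightarrow> nat \<Rightarrow> 'a acg_state" where
  "al_acg s = acg (al_psis s) al_psin (al_zcur s) al_mu (al_Lpsi s)"

definition al_acg_stop :: "('a, 'b) al_state \<Rightarrow> nat \<Rightarrow> bool" where
  "al_acg_stop s =
     acg3_stop (al_psis s) al_psin (al_zcur s) al_mu (al_Lpsi s) ((al_th D)\<^sup>2 / al_Lpsi s)"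

text \<open>Number of ACG iterations of the call; meaningful only if the call terminates.\<close>
definition al_inner :: "('a, 'b) al_state \<Rightarrow> nat" where
  "al_inner s = (LEAST j. al_acg_stop s j)"

definition al_z :: "('a, 'b) al_state \<Rightarrow> 'a" where
  "al_z s = acgy (al_acg s (al_inner s))"

definition al_Lbar :: "('a, 'b) al_state \<Rightarrow> real" where
  "al_Lbar s = al_Lpsi s / al_lam D"

definition al_zhat :: "('a, 'b) al_state \<Rightarrow> 'a" where
  "al_zhat s = argmin (\<lambda>u. ereal (linz (al_F s) (al_z s) u) + al_h D u
     + ereal (al_Lbar s / 2 * (norm (u - al_z s))\<^sup>2))"

definition al_vhat :: "('a, 'b) al_state \<Rightarrow> 'a" where
  "al_vhat s =
     al_Lbar s *\<^sub>R (al_z s - al_zhat s) + grad (al_F s) (al_zhat s) - grad (al_F s) (al_z s)"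

definition al_p :: "('a, 'b) al_state \<Rightarrow> 'b" where
  "al_p s = closest_point (dual_cone (al_K D)) (al_pcur s + st_c s *\<^sub>R al_g D (al_z s))"

definition al_phat :: "('a, 'b) al_state \<Rightarrow> 'b" where
  "al_phat s = closest_point (dual_cone (al_K D)) (al_pcur s + st_c s *\<^sub>R al_g D (al_zhat s))"

definition al_qhat :: "('a, 'b) al_state \<Rightarrow> 'b" where
  "al_qhat s = (1 / st_c s) *\<^sub>R (al_pcur s - al_phat s)"

definition al_stop :: "real \<Rightarrow> real \<Rightarrow> ('a, 'b) al_state \<Rightarrow> bool" where
  "al_stop \<rho> \<eta> s \<longleftrightarrow> norm (al_vhat s) \<le> \<rho> \<and> norm (al_qhat s) \<le> \<eta>"

definition al_lagr :: "real \<Rightarrow> 'a \<Rightarrow> 'b \<Rightarrow> real" where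
  "al_lagr c z p = real_of_ereal (ereal (auglag (al_f D) (al_g D) (al_K D) c p z) + al_h D z)"

definition al_step :: "real \<Rightarrow> ('a, 'b) al_state \<Rightarrow> ('a, 'b) al_state" where
  "al_step \<rho> s =
     (let k = Suc (st_n s); c = st_c s; kh = st_khat s;
          z = (st_z s)(k := al_z s);
          p = (st_p s)(k := al_p s);
          \<Delta> = (al_lagr c (z (kh + 1)) (p (kh + 1)) - al_lagr c (z k) (p k))
               / (real k - real kh - 1);
          dbl = (k > kh + 1 \<and> \<Delta> \<le> al_lam D * (1 - al_th D) * \<rho>\<^sup>2 / 36)
      in \<lparr>st_n = k, st_z = z, st_p = p,
          st_c = (if dbl then 2 * c else c), st_khat = (if dbl then k else kh)\<rparr>)"

text \<open>\<open>al_run \<rho> n\<close> is the state after \<open>n\<close> outer iterations, disregarding the stopping test.\<close>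
primrec al_run :: "real \<Rightarrow> nat \<Rightarrow> ('a, 'b) al_state" where
  "al_run \<rho> 0 = \<lparr>st_n = 0, st_z = (\<lambda>_. al_z0 D), st_p = (\<lambda>_. al_p0 D), st_c = al_c1 D, st_khat = 0\<rparr>"
| "al_run \<rho> (Suc n) = al_step \<rho> (al_run \<rho> n)"

text \<open>Outer iteration \<open>n + 1\<close> is actually entered: no earlier one stopped the method, and all
  earlier ACG calls terminated.\<close>
definition al_reached :: "real \<Rightarrow> real \<Rightarrow> nat \<Rightarrow> bool" where
  "al_reached \<rho> \<eta> n \<longleftrightarrow>
     (\<forall>i<n. (\<exists>j. al_acg_stop (al_run \<rho> i) j) \<and> \<not> al_stop \<rho> \<eta> (al_run \<rho> i))"

text \<open>The method stops in outer iteration \<open>n + 1\<close>, its output being computed from the state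
  \<open>al_run \<rho> n\<close>.\<close>
definition al_halts :: "real \<Rightarrow> real \<Rightarrow> nat \<Rightarrow> bool" where
  "al_halts \<rho> \<eta> n \<longleftrightarrow>
     al_reached \<rho> \<eta> n \<and> (\<exists>j. al_acg_stop (al_run \<rho> n) j) \<and> al_stop \<rho> \<eta> (al_run \<rho> n)"

definition al_total_inner :: "real \<Rightarrow> nat \<Rightarrow> nat" where
  "al_total_inner \<rho> n = (\<Sum>i\<le>n. al_inner (al_run \<rho> i))"

text \<open>The extrapolation points of ACG are not projected onto \<open>Z\<close> and may leave it, where neither
  differentiability of \<open>f\<close> nor any curvature bound for \<open>\<psi>s\<close> is assumed. This predicate says that
  at every extrapolation point outside \<open>Z\<close> which the method actually visits, \<open>\<psi>s\<close> is
  differentiable and obeys, against points of \<open>Z\<close>, the curvature bounds with the parameters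
  \<open>\<mu>\<close> and \<open>L\<close> that are passed to ACG. It requires nothing of extrapolation points in \<open>Z\<close>.\<close>
definition al_extrapolation_ok :: "real \<Rightarrow> real \<Rightarrow> bool" where
  "al_extrapolation_ok \<rho> \<eta> \<longleftrightarrow>
     (\<forall>n j. al_reached \<rho> \<eta> n \<longrightarrow> (\<forall>i\<le>j. \<not> al_acg_stop (al_run \<rho> n) i) \<longrightarrow>
        (let s = al_run \<rho> n; xt = acg_xtilde al_mu (al_Lpsi s) (al_acg s j)
         in xt \<notin> al_Z D \<longrightarrow> curvature_at (al_psis s) (- al_mu) (al_Lpsi s) (al_Z D) xt))"

end

end

theory Submission
  imports Defs
begin

text \<open>
Each ACG call returns a point \<open>z\<close> with residual \<open>r\<close> and an error \<open>\<epsilon>\<close> of order \<open>1/L\<close>, where \<open>L\<close> is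
the curvature passed to ACG. Because \<open>\<epsilon>\<close> shrinks like \<open>1/L\<close>, testing the approximate optimality at
points a fraction \<open>1/L\<close> away from \<open>z\<close> gives a first-order inequality that is uniform in the penalty
\<open>c\<close>; with the Slater point it bounds all multipliers independently of \<open>c\<close>. Hence the
\<open>q\<close>-residual is \<open>O(1/c)\<close>, and within a cycle of constant penalty the augmented Lagrangian decreases by a
multiple of \<open>\<parallel>r\<parallel>\<^sup>2\<close> up to \<open>O(1/c)\<close> while its total decrease is bounded. So a cycle has \<open>O(1/\<rho>\<^sup>2)\<close>
iterations, and a doubling can only happen while \<open>c\<close> is below a multiple of
\<open>1/\<rho>\<^sup>2 + 1/\<eta>\<close>. An ACG call costs \<open>O(sqrt c)\<close> iterations up to a logarithm, and since \<open>c\<close> doubles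
from cycle to cycle, the costs of the cycles form a geometric series dominated by the last one.
\<close>

section \<open>Gradients and proximal points\<close>

text \<open>The O-constant may depend on everything except the tolerances. The argument therefore
  works with its own constants \<open>P\<close>, \<open>\<Phi>\<close>, \<open>R\<close>,
  \<open>E\<close>, all fixed before \<open>\<rho>\<close> and \<open>\<eta>\<close>, and finally
  compares: \<open>T \<rho> \<eta>\<close> dominates a fixed positive multiple of
  \<open>1 / \<rho>\<^sup>2 + 1 / \<eta>\<close>. Extrapolation points may leave \<open>Z\<close>,
  where \<open>f\<close> is uncontrolled. The ACG analysis uses curvature only with an extrapolation
  point as base and a point of \<open>Z\<close> as argument, and only until the call stops; the
  other auxiliary points enter only quadratic models, which are defined everywhere. The refined
  residual needs gradients that are Lipschitz on \<open>Z\<close> with the sharp constant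
  \<open>M\<close>, although \<open>f\<close> is nonconvex and only two-sided bounds on its values
  are given; \<open>m \<le> M\<close> and an interior point of \<open>Z\<close> make this possible.
  The length of a cycle is limited by the doubling test itself: until it fires, the average decrease
  exceeds the threshold, while the augmented Lagrangian stays in a range that does not depend on the
  penalty.\<close>

lemma GDERIV_unique:
  fixes F :: "'a::euclidean_space \<Rightarrow> real"
  assumes "GDERIV F z :> d" "GDERIV F z :> e"
  shows "d = e"
proof -
  have "(\<lambda>h. h \<bullet> d) = (\<lambda>h. h \<bullet> e)"
    using assms unfolding gderiv_def by (rule has_derivative_unique)
  then have "h \<bullet> d = h \<bullet> e" for h by metis
  then show ?thesis by (metis vector_eq_ldot)
qed

lemma grad_eqI:
  fixes F :: "'a::euclidean_space \<Rightarrow> real"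
  assumes "GDERIV F z :> d"
  shows "grad F z = d"
  unfolding grad_def using assms by (blast intro: GDERIV_unique)

lemma GDERIV_grad:
  fixes F :: "'a::euclidean_space \<Rightarrow> real"
  assumes "F differentiable (at z)"
  shows "GDERIV F z :> grad F z"
proof -
  obtain F' where F': "(F has_derivative F') (at z)"
    using assms unfolding differentiable_def by blast
  have "h \<bullet> adjoint F' 1 = F' h" for h
    using adjoint_works[OF has_derivative_linear[OF F'], of h 1] by simp
  then have "GDERIV F z :> adjoint F' 1"
    using F' unfolding gderiv_def by (simp add: fun_eq_iff)
  then show ?thesis using grad_eqI by metis
qed

lemma differentiable_of_GDERIV: "GDERIV F z :> d \<Longrightarrow> F differentiable (at z)"
  unfolding gderiv_def differentiable_def by blast

text \<open>First-order optimality without subdifferential calculus: moving from \<open>y\<close>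
  towards \<open>u\<close> by a fraction \<open>t\<close> changes the objective by at most
  \<open>t * (X + t * Y)\<close>; dividing by \<open>t\<close> and letting \<open>t\<close> tend to
  0 leaves \<open>0 \<le> X\<close>.\<close>

lemma prox_optimality:
  fixes n :: "'a::euclidean_space \<Rightarrow> real"
  assumes Z: "convex Z" and n: "convex_on Z n" and y: "y \<in> Z" and u: "u \<in> Z"
    and min: "\<And>w. w \<in> Z \<Longrightarrow>
      n y + b \<bullet> (y - x) + \<kappa> / 2 * (norm (y - x))\<^sup>2 \<le> n w + b \<bullet> (w - x) + \<kappa> / 2 * (norm (w - x))\<^sup>2"
  shows "n y + (\<kappa> *\<^sub>R (x - y) - b) \<bullet> (u - y) \<le> n u"
proof -
  define X where "X = n u - n y + b \<bullet> (u - y) + \<kappa> * ((y - x) \<bullet> (u - y))"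
  define Y where "Y = \<kappa> / 2 * (norm (u - y))\<^sup>2"
  have ineq: "0 \<le> X + t * Y" if t: "0 < t" "t \<le> 1" for t
  proof -
    let ?w = "(1 - t) *\<^sub>R y + t *\<^sub>R u"
    have w: "?w \<in> Z" using convexD_alt[OF Z y u] t by simp
    have nw: "n ?w \<le> (1 - t) * n y + t * n u"
      using convex_onD[OF n, of t y u] t y u by simp
    have wx: "?w - x = (y - x) + t *\<^sub>R (u - y)" by (simp add: algebra_simps)
    have sq: "(norm (?w - x))\<^sup>2 = (norm (y - x))\<^sup>2 + 2 * t * ((y - x) \<bullet> (u - y)) + t\<^sup>2 * (norm (u - y))\<^sup>2"
      unfolding wx power2_norm_eq_inner
      by (simp add: inner_add_left inner_add_right inner_commute power2_eq_square algebra_simps)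
    have bw: "b \<bullet> (?w - x) = b \<bullet> (y - x) + t * (b \<bullet> (u - y))"
      unfolding wx by (simp add: inner_add_right)
    have "0 \<le> t * (n u - n y) + t * (b \<bullet> (u - y)) + \<kappa> / 2 * (2 * t * ((y - x) \<bullet> (u - y)) + t\<^sup>2 * (norm (u - y))\<^sup>2)"
      using min[OF w] nw unfolding sq bw by (simp add: algebra_simps)
    also have "\<dots> = t * (X + t * Y)"
      by (simp add: X_def Y_def algebra_simps power2_eq_square)
    finally show ?thesis using t by (simp add: zero_le_mult_iff)
  qed
  have "((\<lambda>t. X + t * Y) \<longlongrightarrow> X + 0 * Y) (at_right 0)"
    by (intro tendsto_intros)
  moreover have "\<forall>\<^sub>F t in at_right (0::real). 0 \<le> X + t * Y"
    using ineq by (auto simp: eventually_at_right_field intro!: exI[of _ 1])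
  ultimately have "0 \<le> X + 0 * Y"
    by (rule tendsto_lowerbound) simp
  moreover have "(\<kappa> *\<^sub>R (x - y) - b) \<bullet> (u - y) = - \<kappa> * ((y - x) \<bullet> (u - y)) - b \<bullet> (u - y)"
    by (simp add: inner_diff_left inner_diff_right algebra_simps)
  ultimately show ?thesis unfolding X_def by linarith
qed

text \<open>\<open>argmin\<close> is a choice operator and carries information only once a minimiser
  exists. Compactness supplies one on \<open>Z\<close>, and infinite values elsewhere keep it
  global.\<close>

lemma argmin_extended:
  fixes Z :: "'a::euclidean_space set"
  assumes "compact Z" "Z \<noteq> {}" "continuous_on Z Q"
    and in_Z: "\<And>u. u \<in> Z \<Longrightarrow> F u = ereal (Q u)" and off_Z: "\<And>u. u \<notin> Z \<Longrightarrow> F u = \<infinity>"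
  shows "argmin F \<in> Z" and "\<And>u. u \<in> Z \<Longrightarrow> Q (argmin F) \<le> Q u"
proof -
  obtain y where y: "y \<in> Z" "\<And>u. u \<in> Z \<Longrightarrow> Q y \<le> Q u"
    using continuous_attains_inf[OF assms(1-3)] by blast
  have "is_arg_min F (\<lambda>_. True) y"
    unfolding is_arg_min_linorder using y in_Z off_Z
    by (metis ereal_less_eq(1,3))
  then have "is_arg_min F (\<lambda>_. True) (argmin F)"
    unfolding argmin_def arg_min_def by (rule someI)
  then have min: "F (argmin F) \<le> F u" for u
    unfolding is_arg_min_linorder by blast
  then have "F (argmin F) \<le> ereal (Q y)" using in_Z y by metis
  then show Z: "argmin F \<in> Z" using off_Z by fastforce
  show "Q (argmin F) \<le> Q u" if "u \<in> Z" for u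
    using min[of u] in_Z[OF that] in_Z[OF Z] by simp
qed

lemma norm_add_sq: "(norm (a + b))\<^sup>2 = (norm a)\<^sup>2 + 2 * (a \<bullet> b) + (norm b)\<^sup>2" for a b :: "'a::real_inner"
  by (simp add: power2_norm_eq_inner inner_add_left inner_add_right inner_commute)

lemma norm_diff_sq: "(norm (a - b))\<^sup>2 = (norm a)\<^sup>2 - 2 * (a \<bullet> b) + (norm b)\<^sup>2" for a b :: "'a::real_inner"
  by (simp add: power2_norm_eq_inner inner_diff_left inner_diff_right inner_commute)

section \<open>Projection onto the dual cone\<close>

locale dual_projection =
  fixes K :: "'b::euclidean_space set"
  assumes closed_K: "closed K" and cone_K: "convex_cone K"
begin

abbreviation proj :: "'b \<Rightarrow> 'b" where "proj \<equiv> closest_point (dual_cone K)"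

lemma zero_in_K: "0 \<in> K"
  using convex_cone_contains_0[OF cone_K] .

lemma closed_dual_cone: "closed (dual_cone K)"
proof -
  have "dual_cone K = (\<Inter>x\<in>K. {p. 0 \<le> x \<bullet> p})" unfolding dual_cone_def by auto
  then show ?thesis by (auto intro!: closed_INT closed_halfspace_ge)
qed

lemma convex_dual_cone: "convex (dual_cone K)"
  unfolding dual_cone_def convex_def by (auto simp: inner_add_right)

lemma zero_in_dual_cone: "0 \<in> dual_cone K"
  unfolding dual_cone_def by simp

lemma proj_in: "proj x \<in> dual_cone K"
  using closest_point_in_set[OF closed_dual_cone] zero_in_dual_cone by blast

lemma moreau:
  defines "P \<equiv> \<lambda>x. x - closest_point (uminus ` K) x"
  shows "P x \<in> dual_cone K" and "P x - x \<in> K" and "(x - P x) \<bullet> P x = 0"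
    and "infdist x (uminus ` K) = norm (P x)"
proof -
  let ?C = "uminus ` K"
  have C: "closed ?C" "convex ?C" "?C \<noteq> {}"
    using closed_K cone_K zero_in_K by (auto simp: closed_negations convex_negations convex_cone_def)
  define y where "y = closest_point ?C x"
  have Py: "P x = x - y" unfolding P_def y_def ..
  have yC: "y \<in> ?C" unfolding y_def using closest_point_in_set C by blast
  have dot: "(x - y) \<bullet> (c - y) \<le> 0" if "c \<in> ?C" for c
    unfolding y_def using closest_point_dot[OF C(2,1) that] .
  obtain w where w: "w \<in> K" "y = - w" using yC by blast
  \<comment> \<open>Both 0 and \<open>2 *\<^sub>R y\<close> lie in the cone, so the variational
    inequality can be tested along the ray through \<open>y\<close> in both directions.\<close>
  have "(x - y) \<bullet> y \<le> 0"
  proof -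
    have "2 *\<^sub>R w \<in> K" using cone_K w(1) convex_cone_scaleR[of K 2 w] by simp
    then have "2 *\<^sub>R y \<in> ?C" using w(2) by force
    from dot[OF this] show ?thesis by (simp add: scaleR_2)
  qed
  moreover have "0 \<le> (x - y) \<bullet> y"
    using dot[of 0] zero_in_K by force
  ultimately have z: "(x - y) \<bullet> y = 0" by simp
  show "P x - x \<in> K" using w unfolding Py by simp
  show "(x - P x) \<bullet> P x = 0" using z unfolding Py by (simp add: inner_commute)
  show "P x \<in> dual_cone K"
    unfolding dual_cone_def Py
  proof safe
    fix k assume "k \<in> K"
    then have "- k \<in> ?C" by blast
    from dot[OF this] z show "0 \<le> k \<bullet> (x - y)"
      by (simp add: inner_diff_right inner_commute)
  qed
  show "infdist x ?C = norm (P x)"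
    unfolding Py y_def using setdist_closest_point[OF C(1,3), of x]
    by (simp add: infdist_eq_setdist dist_norm)
qed

text \<open>Turns the distance to \<open>- K\<close> in the augmented Lagrangian into the norm of
  the updated multiplier.\<close>

lemma proj_moreau: "proj x = x - closest_point (uminus ` K) x"
proof -
  define p where "p = x - closest_point (uminus ` K) x"
  note m = moreau[of x, folded p_def]
  have "p = proj x"
  proof (rule closest_point_unique[OF convex_dual_cone closed_dual_cone m(1)], intro ballI)
    fix q assume q: "q \<in> dual_cone K"
    have "(p - x) \<bullet> q \<ge> 0" using q m(2) unfolding dual_cone_def by blast
    moreover have "(p - x) \<bullet> p = 0"
      using m(3) by (metis inner_minus_left minus_diff_eq neg_equal_0_iff_equal)
    ultimately have "0 \<le> (p - x) \<bullet> (q - p)" by (simp add: inner_diff_right)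
    moreover have "(norm (q - x))\<^sup>2 = (norm (p - x))\<^sup>2 + 2 * ((p - x) \<bullet> (q - p)) + (norm (q - p))\<^sup>2"
      using norm_add_sq[of "p - x" "q - p"] by (simp add: algebra_simps)
    ultimately have "(norm (p - x))\<^sup>2 \<le> (norm (q - x))\<^sup>2"
      using zero_le_power2[of "norm (q - p)"] by linarith
    then show "dist x p \<le> dist x q"
      by (metis dist_commute dist_norm norm_ge_zero power2_le_imp_le)
  qed
  then show ?thesis unfolding p_def by simp
qed

lemma proj_residual_in: "proj x - x \<in> K"
  and proj_orthogonal: "(x - proj x) \<bullet> proj x = 0"
  and infdist_proj: "infdist x (uminus ` K) = norm (proj x)"
  using moreau(2-4)[of x] unfolding proj_moreau by blast+

lemma proj_inner: "x \<bullet> proj x = (norm (proj x))\<^sup>2"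
  using proj_orthogonal[of x] by (simp add: inner_diff_left power2_norm_eq_inner)

lemma proj_residual_inner: "q \<in> dual_cone K \<Longrightarrow> (x - proj x) \<bullet> q \<le> 0"
  using proj_residual_in[of x] unfolding dual_cone_def
  by (smt (verit, best) inner_minus_left mem_Collect_eq minus_diff_eq)

lemma proj_nonexpansive: "norm (proj x - proj y) \<le> norm (x - y)"
  using closest_point_lipschitz[OF convex_dual_cone closed_dual_cone, of x y] zero_in_dual_cone
  by (auto simp: dist_norm)

lemma proj_zero: "proj 0 = 0"
  using closest_point_self[OF zero_in_dual_cone] .

lemma norm_proj_le: "norm (proj x) \<le> norm x"
  using proj_nonexpansive[of x 0] proj_zero by simp

text \<open>With \<open>proj_maximum\<close> this says that the squared norm of the projection is
  the maximum over the dual cone of functions affine in \<open>x\<close>. All inequalities for the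
  penalty term come from choosing \<open>q\<close> here.\<close>

lemma proj_maximal:
  assumes q: "q \<in> dual_cone K"
  shows "2 * (q \<bullet> x) - (norm q)\<^sup>2 \<le> (norm (proj x))\<^sup>2"
proof -
  have "q \<bullet> x \<le> q \<bullet> proj x"
    using proj_residual_inner[OF q, of x] by (simp add: inner_diff_left inner_diff_right inner_commute)
  moreover have "0 \<le> (norm (q - proj x))\<^sup>2" by simp
  ultimately show ?thesis unfolding norm_diff_sq by linarith
qed

lemma proj_maximum: "2 * (proj x \<bullet> x) - (norm (proj x))\<^sup>2 = (norm (proj x))\<^sup>2"
  using proj_inner[of x] by (simp add: inner_commute)

text \<open>Testing the maximum at each of the two maximisers sandwiches the increment, and
  nonexpansiveness makes the error quadratic. The squared norm is thus differentiable although the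
  projection itself need not be.\<close>

lemma norm_proj_sq_expansion:
  "\<bar>(norm (proj (x + h)))\<^sup>2 - (norm (proj x))\<^sup>2 - 2 * (proj x \<bullet> h)\<bar> \<le> 2 * (norm h)\<^sup>2"
proof -
  have 1: "2 * (proj x \<bullet> (x + h)) - (norm (proj x))\<^sup>2 \<le> (norm (proj (x + h)))\<^sup>2"
    by (rule proj_maximal[OF proj_in])
  have 2: "2 * (proj (x + h) \<bullet> x) - (norm (proj (x + h)))\<^sup>2 \<le> (norm (proj x))\<^sup>2"
    by (rule proj_maximal[OF proj_in])
  have 3: "(proj (x + h) - proj x) \<bullet> h \<le> norm h * norm h"
    using norm_cauchy_schwarz[of "proj (x + h) - proj x" h] proj_nonexpansive[of "x + h" x]
    by (metis add_diff_cancel_left' mult_right_mono norm_ge_zero order.trans)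
  show ?thesis
    using 1 2 3 proj_maximum[of x] proj_maximum[of "x + h"]
    by (simp add: inner_add_right inner_diff_left power2_eq_square)
qed

lemma GDERIV_norm_proj_sq: "GDERIV (\<lambda>x. (norm (proj x))\<^sup>2) x :> 2 *\<^sub>R proj x"
  unfolding gderiv_def
proof (rule has_derivativeI_sandwich[where e = 1 and H = "\<lambda>y. 2 * norm (y - x)"])
  show "bounded_linear (\<lambda>h. h \<bullet> 2 *\<^sub>R proj x)" by (rule bounded_linear_inner_left)
  show "((\<lambda>y. 2 * norm (y - x)) \<longlongrightarrow> 0) (at x)"
    by (auto intro!: tendsto_eq_intros)
  fix y assume y: "y \<noteq> x"
  have "\<bar>(norm (proj y))\<^sup>2 - (norm (proj x))\<^sup>2 - (y - x) \<bullet> (2 *\<^sub>R proj x)\<bar> \<le> 2 * norm (y - x) * norm (y - x)"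
    using norm_proj_sq_expansion[of x "y - x"] by (simp add: power2_eq_square inner_commute)
  then show "norm ((norm (proj y))\<^sup>2 - (norm (proj x))\<^sup>2 - (y - x) \<bullet> (2 *\<^sub>R proj x)) / norm (y - x)
    \<le> 2 * norm (y - x)"
    using y by (simp add: divide_le_eq)
qed simp

end

section \<open>The accelerated composite gradient method\<close>

text \<open>\<open>a\<close> is the positive root of the quadratic equation in the second claim. The
  third claim makes \<open>A\<close> grow by the factor \<open>1 + sqrt (\<mu> / L)\<close> per
  step; the fourth starts the growth from \<open>A = 0\<close>.\<close>

lemma acg_a_properties:
  assumes pos: "0 \<le> A" "0 < \<mu>" "0 < L"
  defines "a \<equiv> acg_a \<mu> L A"
  shows "0 < a" and "L * a\<^sup>2 = (1 + \<mu> * A) * (A + a)" and "A * sqrt (\<mu> / L) \<le> a" and "1 / L \<le> a"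
proof -
  define \<tau> where "\<tau> = (1 + \<mu> * A) / L"
  define r where "r = sqrt (\<tau>\<^sup>2 + 4 * \<tau> * A)"
  have a: "a = (\<tau> + r) / 2" unfolding a_def acg_a_def \<tau>_def r_def by (simp add: Let_def)
  have \<tau>: "0 < \<tau>" "1 / L \<le> \<tau>" "\<mu> / L * A \<le> \<tau>"
    unfolding \<tau>_def using pos by (auto simp: divide_simps add_pos_nonneg)
  have "\<tau>\<^sup>2 \<le> \<tau>\<^sup>2 + 4 * \<tau> * A" using \<tau> pos by simp
  then have r\<tau>: "\<tau> \<le> r" unfolding r_def using \<tau>(1) by (simp add: real_le_rsqrt)
  have r2: "r\<^sup>2 = \<tau>\<^sup>2 + 4 * \<tau> * A" unfolding r_def using \<tau> pos by simp
  have "\<tau> \<le> a" unfolding a using r\<tau> by simp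
  show "0 < a" using \<open>\<tau> \<le> a\<close> \<tau>(1) by (rule less_le_trans[rotated])
  show "1 / L \<le> a" using \<tau>(2) \<open>\<tau> \<le> a\<close> by (rule order_trans)
  have "4 * a\<^sup>2 = \<tau>\<^sup>2 + 2 * \<tau> * r + r\<^sup>2" unfolding a by (simp add: power2_eq_square algebra_simps)
  also have "\<dots> = 4 * (\<tau> * (A + a))" unfolding r2 a by (simp add: power2_eq_square algebra_simps)
  finally have a2: "a\<^sup>2 = \<tau> * (A + a)" by simp
  show "L * a\<^sup>2 = (1 + \<mu> * A) * (A + a)" unfolding a2 using pos by (simp add: \<tau>_def)
  have "(A * sqrt (\<mu> / L))\<^sup>2 = A\<^sup>2 * (\<mu> / L)"
    using pos by (simp only: power_mult_distrib real_sqrt_pow2 divide_nonneg_pos less_imp_le)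
  also have "\<dots> = \<mu> / L * A * A" by (simp add: power2_eq_square)
  also have "\<dots> \<le> \<tau> * A" by (rule mult_right_mono[OF \<tau>(3) pos(1)])
  also have "\<dots> \<le> \<tau> * (A + a)"
    by (rule mult_left_mono) (use \<tau>(1) \<open>0 < a\<close> in auto)
  finally have "(A * sqrt (\<mu> / L))\<^sup>2 \<le> a\<^sup>2" unfolding a2 .
  then show "A * sqrt (\<mu> / L) \<le> a"
    by (rule power2_le_imp_le) (rule less_imp_le[OF \<open>0 < a\<close>])
qed

text \<open>Curvature of \<open>\<psi>s\<close> is left to the individual steps, since it is
  available only at the extrapolation points actually visited. \<open>N\<close> is the finite part
  of \<open>\<psi>n\<close>.\<close>

locale acg_problem =
  fixes Z :: "'a::euclidean_space set" and \<psi>s :: "'a \<Rightarrow> real" and \<psi>n :: "'a \<Rightarrow> ereal"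
    and N :: "'a \<Rightarrow> real" and x0 :: 'a and \<mu> L :: real
  assumes convex_Z: "convex Z" and compact_Z: "compact Z" and x0_in: "x0 \<in> Z"
    and psin_in: "\<And>u. u \<in> Z \<Longrightarrow> \<psi>n u = ereal (N u)"
    and psin_off: "\<And>u. u \<notin> Z \<Longrightarrow> \<psi>n u = \<infinity>"
    and convex_N: "convex_on Z N" and continuous_N: "continuous_on Z N"
    and mu_pos: "0 < \<mu>" and mu_le: "\<mu> \<le> L"
begin

abbreviation "st \<equiv> acg \<psi>s \<psi>n x0 \<mu> L"
abbreviation "xt k \<equiv> acg_xtilde \<mu> L (st k)"
abbreviation "\<psi> u \<equiv> \<psi>s u + N u"

lemma L_pos: "0 < L" using mu_pos mu_le by simp

text \<open>An estimate sequence: \<open>v\<close> is the minimum, attained at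
  \<open>acgx s\<close>, of the accumulated model plus the prox term. The model bounds
  \<open>\<psi>\<close> from below on \<open>Z\<close> only. Multiplying by \<open>acgA s\<close>
  makes the start \<open>A = 0\<close> a legitimate case.\<close>

definition acg_inv :: "'a acg_state \<Rightarrow> bool" where
  "acg_inv s \<longleftrightarrow> 0 \<le> acgA s \<and> acgy s \<in> Z \<and>
     (\<exists>v. (\<forall>u. acgA s * acgG s u + (norm (u - x0))\<^sup>2 / 2
             = v + (1 + \<mu> * acgA s) / 2 * (norm (u - acgx s))\<^sup>2) \<and>
          acgA s * \<psi> (acgy s) \<le> v) \<and>
     (\<forall>u\<in>Z. acgA s * acgG s u \<le> acgA s * \<psi> u)"

lemma acg_inv_step:
  assumes inv: "acg_inv s" and good: "curvature_at \<psi>s (- \<mu>) L Z (acg_xtilde \<mu> L s)"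
  shows "acg_inv (acg_step \<psi>s \<psi>n \<mu> L s)"
    and "acgA (acg_step \<psi>s \<psi>n \<mu> L s) = acgA s + acg_a \<mu> L (acgA s)"
proof -
  define A where "A = acgA s"
  define a where "a = acg_a \<mu> L A"
  define B where "B = A + a"
  define x where "x = acgx s"
  define w where "w = acg_xtilde \<mu> L s"
  define q where "q = acg_q \<psi>s \<psi>n \<mu> w"
  define y where "y = argmin (\<lambda>u. ereal (1 / L) * q u + ereal (1 / 2 * (norm (u - w))\<^sup>2))"
  define x' where "x' = x + (a / (1 + \<mu> * B)) *\<^sub>R (L *\<^sub>R (y - w) + \<mu> *\<^sub>R (y - x))"
  define Q where "Q u = linz \<psi>s w u + N u + \<mu> / 2 * (norm (u - w))\<^sup>2" for u
  define \<gamma> where "\<gamma> u = Q y + L * ((w - y) \<bullet> (u - y)) + \<mu> / 2 * (norm (u - y))\<^sup>2" for u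
  define G where "G = acgG s"
  have A0: "0 \<le> A" and yZ0: "acgy s \<in> Z" and GZ: "\<And>u. u \<in> Z \<Longrightarrow> A * G u \<le> A * \<psi> u"
    using inv unfolding acg_inv_def A_def G_def by auto
  obtain v where v: "\<And>u. A * G u + (norm (u - x0))\<^sup>2 / 2 = v + (1 + \<mu> * A) / 2 * (norm (u - x))\<^sup>2"
    and v_ge: "A * \<psi> (acgy s) \<le> v"
    using inv unfolding acg_inv_def A_def G_def x_def by blast
  note a = acg_a_properties[OF A0 mu_pos L_pos, folded a_def B_def]
  have Bpos: "0 < B" unfolding B_def using A0 a(1) by simp
  have Zne: "Z \<noteq> {}" using x0_in by blast
  have qZ: "q u = ereal (Q u)" if "u \<in> Z" for u
    unfolding q_def acg_q_def Q_def using psin_in[OF that] by simp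
  let ?F = "\<lambda>u. ereal (1 / L) * q u + ereal (1 / 2 * (norm (u - w))\<^sup>2)"
  let ?Q = "\<lambda>u. 1 / L * Q u + 1 / 2 * (norm (u - w))\<^sup>2"
  have cont: "continuous_on Z ?Q"
    unfolding Q_def linz_def by (intro continuous_intros continuous_N)
  have FZ: "?F u = ereal (?Q u)" if "u \<in> Z" for u
    using qZ[OF that] by simp
  have Foff: "?F u = \<infinity>" if "u \<notin> Z" for u
    unfolding q_def acg_q_def using psin_off[OF that] L_pos by simp
  have yZ: "y \<in> Z" and ymin: "\<And>u. u \<in> Z \<Longrightarrow> ?Q y \<le> ?Q u"
    unfolding y_def using argmin_extended[OF compact_Z Zne cont FZ Foff] by blast+
  \<comment> \<open>\<open>Q\<close> and \<open>\<gamma>\<close> have quadratic parts of equal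
    curvature \<open>\<mu>\<close>, so \<open>Q u - \<gamma> u\<close> collapses to the slack in the
    optimality condition of \<open>y\<close>.\<close>
  have gq: "\<gamma> u \<le> Q u" if u: "u \<in> Z" for u
  proof -
    have min: "N y + grad \<psi>s w \<bullet> (y - w) + (\<mu> + L) / 2 * (norm (y - w))\<^sup>2
        \<le> N u + grad \<psi>s w \<bullet> (u - w) + (\<mu> + L) / 2 * (norm (u - w))\<^sup>2" if "u \<in> Z" for u
    proof -
      have "L * (1 / L * Q y + 1 / 2 * (norm (y - w))\<^sup>2) \<le> L * (1 / L * Q u + 1 / 2 * (norm (u - w))\<^sup>2)"
        using ymin[OF that] L_pos by (intro mult_left_mono) auto
      then show ?thesis using L_pos unfolding Q_def linz_def by (simp add: algebra_simps) (simp add: field_simps)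
    qed
    have opt: "N y + ((\<mu> + L) *\<^sub>R (w - y) - grad \<psi>s w) \<bullet> (u - y) \<le> N u"
      by (rule prox_optimality[OF convex_Z convex_N yZ u min])
    have "(u - y) \<bullet> (y - w) = - ((w - y) \<bullet> (u - y))"
      by (simp add: inner_diff_left inner_diff_right inner_commute)
    then have sq: "(norm (u - w))\<^sup>2 = (norm (u - y))\<^sup>2 - 2 * ((w - y) \<bullet> (u - y)) + (norm (y - w))\<^sup>2"
      using norm_add_sq[of "u - y" "y - w"] by simp
    have lin: "grad \<psi>s w \<bullet> (u - w) = grad \<psi>s w \<bullet> (u - y) + grad \<psi>s w \<bullet> (y - w)"
      by (simp add: inner_diff_right)
    have sl: "((\<mu> + L) *\<^sub>R (w - y) - grad \<psi>s w) \<bullet> (u - y)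
        = (\<mu> + L) * ((w - y) \<bullet> (u - y)) - grad \<psi>s w \<bullet> (u - y)"
      by (metis inner_diff_left inner_scaleR_left)
    have "Q u - \<gamma> u = N u - N y - ((\<mu> + L) *\<^sub>R (w - y) - grad \<psi>s w) \<bullet> (u - y)"
      unfolding Q_def \<gamma>_def linz_def sq lin sl by (simp add: algebra_simps)
    then show ?thesis using opt by linarith
  qed
  have diff: "- (- \<mu> / 2) * (norm (u - w))\<^sup>2 \<le> \<psi>s u - linz \<psi>s w u"
     "\<psi>s u - linz \<psi>s w u \<le> L / 2 * (norm (u - w))\<^sup>2" if "u \<in> Z" for u
    using good that unfolding curvature_at_def w_def by auto
  have g\<psi>: "\<gamma> u \<le> \<psi> u" if "u \<in> Z" for u
    using gq[OF that] diff(1)[OF that] unfolding Q_def by simp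
  have wconv: "w = (A / B) *\<^sub>R acgy s + (a / B) *\<^sub>R x"
    unfolding w_def acg_xtilde_def B_def a_def A_def x_def by (simp add: Let_def)
  have step: "acg_step \<psi>s \<psi>n \<mu> L s =
     \<lparr>acgA = B, acgx = x', acgy = y, acgG = (\<lambda>u. A / B * G u + a / B * \<gamma> u)\<rparr>"
    unfolding acg_step_def Let_def
    using qZ[OF yZ]
    by (simp add: \<gamma>_def[abs_def] G_def B_def x'_def x_def y_def q_def w_def a_def A_def)
  have mB: "0 < 1 + \<mu> * B" using mu_pos Bpos by (simp add: add_pos_pos)
  have mA: "0 < 1 + \<mu> * A" using mu_pos A0 by (simp add: add_pos_nonneg)
  have BG: "B * (A / B * G u + a / B * \<gamma> u) = A * G u + a * \<gamma> u" for u
    using Bpos by (simp add: field_simps)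
  text \<open>Completing the square: \<open>x'\<close> minimises the updated quadratic model.\<close>
  define v' where "v' = v + (1 + \<mu> * A) / 2 * (norm (x' - x))\<^sup>2 + a * \<gamma> x'"
  have center: "(1 + \<mu> * A) *\<^sub>R (x' - x) + (a * L) *\<^sub>R (w - y) + (a * \<mu>) *\<^sub>R (x' - y) = 0"
  proof -
    have "(1 + \<mu> * B) *\<^sub>R (x' - x) = (a * L) *\<^sub>R (y - w) + (a * \<mu>) *\<^sub>R (y - x)"
    proof -
      have "(1 + \<mu> * B) *\<^sub>R (x' - x) = ((1 + \<mu> * B) * (a / (1 + \<mu> * B))) *\<^sub>R (L *\<^sub>R (y - w) + \<mu> *\<^sub>R (y - x))"
        unfolding x'_def by simp
      also have "(1 + \<mu> * B) * (a / (1 + \<mu> * B)) = a" using mB by simp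
      finally show ?thesis by (simp add: scaleR_add_right)
    qed
    then show ?thesis unfolding B_def by (simp add: algebra_simps)
  qed
  have quad: "A * G u + a * \<gamma> u + (norm (u - x0))\<^sup>2 / 2 = v' + (1 + \<mu> * B) / 2 * (norm (u - x'))\<^sup>2" for u
  proof -
    have e1: "(norm (u - x))\<^sup>2 = (norm (u - x'))\<^sup>2 + 2 * ((u - x') \<bullet> (x' - x)) + (norm (x' - x))\<^sup>2"
      using norm_add_sq[of "u - x'" "x' - x"] by simp
    have e2: "(norm (u - y))\<^sup>2 = (norm (u - x'))\<^sup>2 + 2 * ((u - x') \<bullet> (x' - y)) + (norm (x' - y))\<^sup>2"
      using norm_add_sq[of "u - x'" "x' - y"] by simp
    have e3: "(w - y) \<bullet> (u - y) = (w - y) \<bullet> (x' - y) + (u - x') \<bullet> (w - y)"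
      by (simp add: inner_diff_left inner_diff_right inner_commute)
    have "(u - x') \<bullet> ((1 + \<mu> * A) *\<^sub>R (x' - x) + (a * L) *\<^sub>R (w - y) + (a * \<mu>) *\<^sub>R (x' - y)) = 0"
      unfolding center by simp
    then have e4: "(1 + \<mu> * A) * ((u - x') \<bullet> (x' - x)) + a * L * ((u - x') \<bullet> (w - y))
        + a * \<mu> * ((u - x') \<bullet> (x' - y)) = 0"
      by (simp add: inner_add_right)
    have "A * G u + a * \<gamma> u + (norm (u - x0))\<^sup>2 / 2 = v + (1 + \<mu> * A) / 2 * (norm (u - x))\<^sup>2 + a * \<gamma> u"
      using v[of u] by simp
    also have "\<dots> = v' + (1 + \<mu> * B) / 2 * (norm (u - x'))\<^sup>2
      + ((1 + \<mu> * A) * ((u - x') \<bullet> (x' - x)) + a * L * ((u - x') \<bullet> (w - y)) + a * \<mu> * ((u - x') \<bullet> (x' - y)))"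
      unfolding v'_def \<gamma>_def e1 e2 e3 B_def by (simp add: algebra_simps) (simp add: field_simps)
    finally show ?thesis unfolding e4 by simp
  qed
  text \<open>The convex combination \<open>xh\<close> differs from the extrapolation point by \<open>(a/B)(x' - x)\<close>, and
    the recursion for \<open>a\<close> turns the coefficient of the square into \<open>L/2\<close>.\<close>
  have "B * \<psi> y \<le> v'"
  proof -
    define xh where "xh = (A / B) *\<^sub>R acgy s + (a / B) *\<^sub>R x'"
    have AB: "A / B + a / B = 1" "0 \<le> A / B" "0 \<le> a / B"
      using Bpos A0 a(1) by (simp_all add: B_def flip: add_divide_distrib)
    have xhw: "xh - w = (a / B) *\<^sub>R (x' - x)" unfolding xh_def wconv by (simp add: algebra_simps)
    \<comment> \<open>Convexity of the quadratic \<open>\<gamma>\<close>, which holds on the whole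
      space: \<open>x'\<close> and hence \<open>xh\<close> may lie outside \<open>Z\<close>.\<close>
    have aff: "\<gamma> xh \<le> A / B * \<gamma> (acgy s) + a / B * \<gamma> x'"
    proof -
      have d: "xh - y = (A / B) *\<^sub>R (acgy s - y) + (a / B) *\<^sub>R (x' - y)"
      proof -
        have "y = (A / B + a / B) *\<^sub>R y" using AB by simp
        then have "xh - y = xh - (A / B + a / B) *\<^sub>R y" by metis
        then show ?thesis unfolding xh_def by (simp add: algebra_simps)
      qed
      have sq: "(norm (xh - y))\<^sup>2 \<le> A / B * (norm (acgy s - y))\<^sup>2 + a / B * (norm (x' - y))\<^sup>2"
      proof -
        define s1 where "s1 = A / B"
        have s: "a / B = 1 - s1" "0 \<le> s1" "s1 \<le> 1" using AB unfolding s1_def by linarith+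
        have "s1 * (norm (acgy s - y))\<^sup>2 + (1 - s1) * (norm (x' - y))\<^sup>2
            - (norm (s1 *\<^sub>R (acgy s - y) + (1 - s1) *\<^sub>R (x' - y)))\<^sup>2
          = s1 * (1 - s1) * (norm ((acgy s - y) - (x' - y)))\<^sup>2"
          unfolding power2_norm_eq_inner
          by (simp only: inner_add_left inner_add_right inner_diff_left inner_diff_right inner_scaleR_left inner_scaleR_right inner_commute) (simp add: algebra_simps inner_commute)
        moreover have "0 \<le> s1 * (1 - s1) * (norm ((acgy s - y) - (x' - y)))\<^sup>2" using s by simp
        ultimately show ?thesis unfolding d using s unfolding s1_def by simp
      qed
      have lin: "(w - y) \<bullet> (xh - y) = A / B * ((w - y) \<bullet> (acgy s - y)) + a / B * ((w - y) \<bullet> (x' - y))"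
        unfolding d by (simp add: inner_add_right)
      have "A / B * \<gamma> (acgy s) + a / B * \<gamma> x' - \<gamma> xh = (A / B + a / B - 1) * Q y
         + \<mu> / 2 * (A / B * (norm (acgy s - y))\<^sup>2 + a / B * (norm (x' - y))\<^sup>2 - (norm (xh - y))\<^sup>2)"
        unfolding \<gamma>_def lin by (simp add: algebra_simps)
      moreover have "0 \<le> \<mu> / 2 * (A / B * (norm (acgy s - y))\<^sup>2 + a / B * (norm (x' - y))\<^sup>2 - (norm (xh - y))\<^sup>2)"
        using sq mu_pos by simp
      ultimately have "0 \<le> A / B * \<gamma> (acgy s) + a / B * \<gamma> x' - \<gamma> xh"
        by (simp only: AB(1) diff_self mult_zero_left add_0_left)
      then show ?thesis by (simp only: diff_ge_0_iff_ge)
    qed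
    have sqx: "(1 + \<mu> * A) / 2 * (norm (x' - x))\<^sup>2 = B * (L / 2 * (norm (xh - w))\<^sup>2)"
    proof -
      have "B * (L / 2 * (norm (xh - w))\<^sup>2) = (L * a\<^sup>2) / (2 * B) * (norm (x' - x))\<^sup>2"
        unfolding xhw using Bpos
        by (simp add: power_mult_distrib power_divide) (simp add: power2_eq_square field_simps)
      also have "\<dots> = (1 + \<mu> * A) / 2 * (norm (x' - x))\<^sup>2"
        unfolding a(2) using Bpos by simp
      finally show ?thesis ..
    qed
    \<comment> \<open>The gradient of \<open>\<gamma>\<close> at \<open>y\<close> is
      \<open>L *\<^sub>R (w - y)\<close> and cancels that of the prox term. So \<open>y\<close>
      minimises the sum over the whole space, and the difference is an explicit square.\<close>
    have low: "Q y + L / 2 * (norm (y - w))\<^sup>2 \<le> \<gamma> xh + L / 2 * (norm (xh - w))\<^sup>2"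
    proof -
      have "(norm (xh - w))\<^sup>2 = (norm (xh - y))\<^sup>2 + 2 * ((xh - y) \<bullet> (y - w)) + (norm (y - w))\<^sup>2"
        using norm_add_sq[of "xh - y" "y - w"] by simp
      moreover have "(xh - y) \<bullet> (y - w) = - ((w - y) \<bullet> (xh - y))"
        by (metis inner_commute inner_minus_left minus_diff_eq)
      ultimately have sq: "(norm (xh - w))\<^sup>2 = (norm (xh - y))\<^sup>2 - 2 * ((w - y) \<bullet> (xh - y)) + (norm (y - w))\<^sup>2"
        by simp
      have "\<gamma> xh + L / 2 * (norm (xh - w))\<^sup>2 - (Q y + L / 2 * (norm (y - w))\<^sup>2)
          = (\<mu> + L) / 2 * (norm (xh - y))\<^sup>2"
        unfolding \<gamma>_def sq by (simp add: field_simps)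
      moreover have "0 \<le> (\<mu> + L) / 2 * (norm (xh - y))\<^sup>2" using mu_pos L_pos by simp
      ultimately show ?thesis by linarith
    qed
    have "0 \<le> \<mu> / 2 * (norm (y - w))\<^sup>2" using mu_pos by simp
    then have "\<psi> y \<le> Q y + L / 2 * (norm (y - w))\<^sup>2"
      using diff(2)[OF yZ] unfolding Q_def by linarith
    then have "B * \<psi> y \<le> B * (\<gamma> xh + L / 2 * (norm (xh - w))\<^sup>2)"
      using low Bpos by (intro mult_left_mono) auto
    also have "\<dots> = B * \<gamma> xh + (1 + \<mu> * A) / 2 * (norm (x' - x))\<^sup>2"
      unfolding sqx by (simp add: algebra_simps)
    also have "B * \<gamma> xh \<le> B * (A / B * \<gamma> (acgy s) + a / B * \<gamma> x')"
      using aff Bpos by (intro mult_left_mono) auto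
    also have "\<dots> = A * \<gamma> (acgy s) + a * \<gamma> x'" using Bpos by (simp add: field_simps)
    also have "A * \<gamma> (acgy s) \<le> A * \<psi> (acgy s)" using g\<psi>[OF yZ0] A0 by (intro mult_left_mono) auto
    also note v_ge
    finally show ?thesis unfolding v'_def by simp
  qed
  moreover have "A * G u + a * \<gamma> u \<le> B * \<psi> u" if "u \<in> Z" for u
  proof -
    have "a * \<gamma> u \<le> a * \<psi> u" using g\<psi>[OF that] a(1) by simp
    then have "A * G u + a * \<gamma> u \<le> A * \<psi> u + a * \<psi> u" using GZ[OF that] by linarith
    then show ?thesis by (simp add: B_def algebra_simps)
  qed
  ultimately show "acg_inv (acg_step \<psi>s \<psi>n \<mu> L s)"
    unfolding acg_inv_def step acg_state.select_convs BG
    using Bpos yZ quad by (intro conjI exI[of _ v']) auto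
  show "acgA (acg_step \<psi>s \<psi>n \<mu> L s) = acgA s + acg_a \<mu> L (acgA s)"
    unfolding step by (simp add: B_def a_def A_def)
qed

text \<open>The exponent is \<open>k - 1\<close> because \<open>A\<close> starts at 0: the first
  step yields \<open>1 / L\<close>, and only later steps multiply.\<close>

lemma acg_inv_run:
  assumes "\<And>i. i < k \<Longrightarrow> curvature_at \<psi>s (- \<mu>) L Z (xt i)"
  shows "acg_inv (st k) \<and> (1 \<le> k \<longrightarrow> 1 / L * (1 + sqrt (\<mu> / L)) ^ (k - 1) \<le> acgA (st k))"
  using assms
proof (induction k)
  case 0
  show ?case unfolding acg_inv_def using x0_in by (auto intro!: exI[of _ 0])
next
  case (Suc k)
  have inv: "acg_inv (st k)" and gr: "1 \<le> k \<Longrightarrow> 1 / L * (1 + sqrt (\<mu> / L)) ^ (k - 1) \<le> acgA (st k)"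
    using Suc by auto
  note S = acg_inv_step[OF inv Suc.prems[of k, simplified]]
  have A0: "0 \<le> acgA (st k)" using inv unfolding acg_inv_def by blast
  note a = acg_a_properties[OF A0 mu_pos L_pos]
  have "1 / L * (1 + sqrt (\<mu> / L)) ^ k \<le> acgA (st (Suc k))"
  proof (cases "k = 0")
    case True
    then show ?thesis using S(2) a(4) by simp
  next
    case False
    then obtain j where j: "k = Suc j" by (cases k) auto
    have "1 / L * (1 + sqrt (\<mu> / L)) ^ k = (1 / L * (1 + sqrt (\<mu> / L)) ^ (k - 1)) * (1 + sqrt (\<mu> / L))"
      unfolding j by simp
    also have "\<dots> \<le> acgA (st k) * (1 + sqrt (\<mu> / L))"
      using gr False mu_pos L_pos by (intro mult_right_mono) auto
    also have "\<dots> \<le> acgA (st (Suc k))"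
      using S(2) a(3) by (simp add: algebra_simps)
    finally show ?thesis .
  qed
  then show ?case using S(1) by simp
qed

section \<open>Residuals and termination of an ACG call\<close>

definition resid :: "nat \<Rightarrow> 'a" where
  "resid k = (1 / acgA (st k)) *\<^sub>R (x0 - acgx (st k))"

definition gap :: "nat \<Rightarrow> real" where
  "gap k = \<psi> (acgy (st k)) - acgG (st k) (acgx (st k)) - resid k \<bullet> (acgy (st k) - acgx (st k))"

text \<open>The model minimiser \<open>x\<close> satisfies \<open>A *\<^sub>R r = x0 - x\<close>, so
  \<open>r\<close> is the gradient of the model at \<open>x\<close>. As the model lies below
  \<open>\<psi>\<close>, \<open>r\<close> becomes an approximate subgradient at \<open>y\<close>
  with error \<open>gap k\<close>. The third claim is \<open>A * \<psi> y \<le> v\<close> rewritten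
  by completing the square.\<close>

lemma acg_certificate:
  assumes inv: "acg_inv (st k)" and pos: "0 < acgA (st k)"
  defines "y \<equiv> acgy (st k)"
  shows "y \<in> Z"
    and "\<And>u. u \<in> Z \<Longrightarrow> \<psi> y + resid k \<bullet> (u - y) - gap k \<le> \<psi> u"
    and "(norm (acgA (st k) *\<^sub>R resid k + y - x0))\<^sup>2 + 2 * acgA (st k) * gap k \<le> (norm (y - x0))\<^sup>2"
    and "acg3_stop \<psi>s \<psi>n x0 \<mu> L \<sigma> k \<longleftrightarrow>
      1 \<le> k \<and> (norm (resid k))\<^sup>2 + 2 * gap k \<le> \<sigma> * (norm (x0 - y + resid k))\<^sup>2"
proof -
  define A where "A = acgA (st k)"
  define x where "x = acgx (st k)"
  define G where "G = acgG (st k)"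
  define r where "r = resid k"
  have A: "0 < A" using pos unfolding A_def .
  show yZ: "y \<in> Z" using inv unfolding acg_inv_def y_def by blast
  have GZ: "A * G u \<le> A * \<psi> u" if "u \<in> Z" for u
    using inv that unfolding acg_inv_def A_def G_def by auto
  obtain v where v: "\<And>u. A * G u + (norm (u - x0))\<^sup>2 / 2 = v + (1 + \<mu> * A) / 2 * (norm (u - x))\<^sup>2"
    and v_ge: "A * \<psi> y \<le> v"
    using inv unfolding acg_inv_def A_def G_def x_def y_def by blast
  have Ar: "A *\<^sub>R r = x0 - x" unfolding r_def resid_def A_def x_def using A A_def by simp
  have gp: "gap k = \<psi> y - G x - r \<bullet> (y - x)"
    unfolding gap_def y_def G_def x_def r_def ..
  show "\<psi> y + resid k \<bullet> (u - y) - gap k \<le> \<psi> u" if u: "u \<in> Z" for u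
  proof -
    have "(norm (u - x0))\<^sup>2 = (norm (u - x))\<^sup>2 + 2 * ((u - x) \<bullet> (x - x0)) + (norm (x - x0))\<^sup>2"
      using norm_add_sq[of "u - x" "x - x0"] by simp
    moreover have "(u - x) \<bullet> (x - x0) = - (A * (r \<bullet> (u - x)))"
      using Ar by (metis inner_commute inner_minus_left inner_scaleR_left minus_diff_eq)
    ultimately have "A * G u = A * G x + A * (r \<bullet> (u - x)) + \<mu> * A / 2 * (norm (u - x))\<^sup>2"
      using v[of u] v[of x] by (simp add: algebra_simps) (simp add: field_simps)
    moreover have "0 \<le> \<mu> * A / 2 * (norm (u - x))\<^sup>2" using mu_pos A by simp
    ultimately have "A * (G x + r \<bullet> (u - x)) \<le> A * \<psi> u"
      using GZ[OF u] by (simp add: algebra_simps)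
    then have "G x + r \<bullet> (u - x) \<le> \<psi> u" using A by simp
    then show ?thesis unfolding gp r_def[symmetric] by (simp add: inner_diff_right)
  qed
  show "(norm (acgA (st k) *\<^sub>R resid k + y - x0))\<^sup>2 + 2 * acgA (st k) * gap k \<le> (norm (y - x0))\<^sup>2"
  proof -
    have xr: "x = x0 - A *\<^sub>R r" using Ar by (simp add: algebra_simps)
    have "2 * A * gap k = 2 * (A * \<psi> y) - 2 * (A * G x) - 2 * ((A *\<^sub>R r) \<bullet> (y - x))"
      unfolding gp by (simp add: algebra_simps)
    also have "\<dots> \<le> (norm (x - x0))\<^sup>2 - 2 * ((A *\<^sub>R r) \<bullet> (y - x))"
      using v[of x] v_ge by (simp add: algebra_simps)
    also have "x - x0 = - (A *\<^sub>R r)" using xr by simp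
    also have "(A *\<^sub>R r) \<bullet> (y - x) = (A *\<^sub>R r) \<bullet> (y - x0) + (norm (A *\<^sub>R r))\<^sup>2"
      unfolding xr power2_norm_eq_inner by (simp add: inner_diff_right inner_add_right)
    finally have "2 * A * gap k \<le> - (norm (A *\<^sub>R r))\<^sup>2 - 2 * ((A *\<^sub>R r) \<bullet> (y - x0))" by simp
    then show ?thesis
      using norm_add_sq[of "A *\<^sub>R r" "y - x0"] unfolding A_def r_def by (simp add: algebra_simps)
  qed
  show "acg3_stop \<psi>s \<psi>n x0 \<mu> L \<sigma> k \<longleftrightarrow>
      1 \<le> k \<and> (norm (resid k))\<^sup>2 + 2 * gap k \<le> \<sigma> * (norm (x0 - y + resid k))\<^sup>2"
    unfolding acg3_stop_def Let_def gap_def resid_def y_def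
    using psin_in[OF yZ] by (simp add: y_def)
qed

text \<open>Origin of the 8: the certificate gives \<open>A * norm r \<le> 2 * d\<close> and
  \<open>2 * A * gap k \<le> d\<^sup>2\<close>, so the left side of the test is at most
  \<open>2 * d\<^sup>2 / A\<close>. For \<open>A \<ge> 8\<close> the residual is at most
  \<open>d / 4\<close>, whence \<open>d \<le> 2 * e\<close> and the bound
  \<open>8 * e\<^sup>2 / A\<close>.\<close>

lemma acg_stop_if_large:
  assumes inv: "acg_inv (st k)" and k: "1 \<le> k" and \<sigma>: "0 < \<sigma>" "\<sigma> \<le> 1"
    and large: "8 / \<sigma> \<le> acgA (st k)"
  shows "acg3_stop \<psi>s \<psi>n x0 \<mu> L \<sigma> k"
proof -
  define A where "A = acgA (st k)"
  define y where "y = acgy (st k)"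
  define r where "r = resid k"
  define d where "d = norm (y - x0)"
  define e where "e = norm (x0 - y + r)"
  have "8 \<le> 8 / \<sigma>" using \<sigma> by (simp add: field_simps)
  then have A8: "8 \<le> A" using large unfolding A_def by linarith
  then have pos: "0 < acgA (st k)" unfolding A_def by simp
  note C = acg_certificate[OF inv pos, folded A_def y_def r_def]
  have gap0: "0 \<le> gap k" using C(2)[OF C(1)] by simp
  have main: "(norm (A *\<^sub>R r + y - x0))\<^sup>2 + 2 * A * gap k \<le> d\<^sup>2" using C(3) unfolding d_def .
  have "0 \<le> 2 * A * gap k" using A8 gap0 by simp
  then have "(norm (A *\<^sub>R r + y - x0))\<^sup>2 \<le> d\<^sup>2" using main by linarith
  then have n1: "norm (A *\<^sub>R r + y - x0) \<le> d" by (simp add: d_def)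
  have "A * norm r = norm (A *\<^sub>R r)" using A8 by simp
  also have "\<dots> \<le> norm (A *\<^sub>R r + y - x0) + norm (y - x0)"
    using norm_triangle_ineq4[of "A *\<^sub>R r + y - x0" "y - x0"] by simp
  finally have rA: "A * norm r \<le> 2 * d" using n1 unfolding d_def by simp
  have gA: "2 * A * gap k \<le> d\<^sup>2"
    using main by (smt (verit) zero_le_power2)
  have "d \<le> e + norm r"
    unfolding d_def e_def using norm_triangle_ineq4[of "x0 - y + r" r] by (simp add: norm_minus_commute)
  moreover have "4 * norm r \<le> d"
  proof -
    have "8 * norm r \<le> A * norm r" using A8 by (intro mult_right_mono) auto
    then show ?thesis using rA by linarith
  qed
  ultimately have de: "3 * d \<le> 4 * e" by linarith
  have d0: "0 \<le> d" "0 \<le> e" unfolding d_def e_def by auto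
  have "A * (norm r)\<^sup>2 \<le> d\<^sup>2"
  proof -
    have "A * (norm r)\<^sup>2 = (A * norm r) * norm r" by (simp add: power2_eq_square)
    also have "\<dots> \<le> (2 * d) * (d / 4)"
      using rA \<open>4 * norm r \<le> d\<close> d0 A8 by (intro mult_mono[of "A * norm r"]) auto
    also have "\<dots> \<le> d\<^sup>2" by (simp add: power2_eq_square)
    finally show ?thesis .
  qed
  then have "A * ((norm r)\<^sup>2 + 2 * gap k) \<le> 2 * d\<^sup>2" using gA by (simp add: algebra_simps)
  also have "\<dots> \<le> 8 * e\<^sup>2"
  proof -
    have "d\<^sup>2 \<le> (2 * e)\<^sup>2" using de d0 by (intro power_mono) auto
    then show ?thesis by (simp add: power_mult_distrib)
  qed
  finally have "(norm r)\<^sup>2 + 2 * gap k \<le> 8 / A * e\<^sup>2" using A8 by (simp add: field_simps)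
  also have "\<dots> \<le> \<sigma> * e\<^sup>2"
  proof -
    have "8 / A \<le> \<sigma>" using large \<sigma> A8 unfolding A_def[symmetric] by (simp add: field_simps)
    then show ?thesis by (intro mult_right_mono) auto
  qed
  finally show ?thesis using C(4) k unfolding e_def by blast
qed

text \<open>Curvature is granted only while the test has not succeeded, so success within
  \<open>J\<close> steps is shown by contradiction: a run of \<open>J\<close> failures would have
  the curvature it needs to stop at \<open>J\<close>.\<close>

lemma acg_terminates:
  assumes \<sigma>: "0 < \<sigma>" "\<sigma> \<le> 1" and L1: "1 \<le> L"
    and good: "\<And>j. (\<And>i. i \<le> j \<Longrightarrow> \<not> acg3_stop \<psi>s \<psi>n x0 \<mu> L \<sigma> i) \<Longrightarrow> curvature_at \<psi>s (- \<mu>) L Z (xt j)"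
  defines "j \<equiv> (LEAST j. acg3_stop \<psi>s \<psi>n x0 \<mu> L \<sigma> j)"
  shows "acg3_stop \<psi>s \<psi>n x0 \<mu> L \<sigma> j" and "acg_inv (st j)" and "0 < acgA (st j)"
    and "real j \<le> 2 + 2 * sqrt (L / \<mu>) * ln (8 * L / \<sigma>)"
proof -
  let ?S = "acg3_stop \<psi>s \<psi>n x0 \<mu> L \<sigma>"
  define x where "x = sqrt (\<mu> / L)"
  \<comment> \<open>Chosen so that \<open>(1 + x) ^ (J - 1)\<close> reaches
    \<open>8 * L / \<sigma>\<close>. The rounding and the successor produce the summand 2 in the
    final count.\<close>
  define J where "J = Suc (nat \<lceil>ln (8 * L / \<sigma>) / ln (1 + x)\<rceil>)"
  have "\<mu> / L \<le> 1" using mu_le L_pos by simp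
  then have x: "0 < x" "x \<le> 1" unfolding x_def using mu_pos L_pos by auto
  have lnx: "0 < ln (1 + x)" using x by simp
  \<comment> \<open>Turns the logarithm in the denominator into \<open>sqrt (\<mu> / L)\<close>. The
    bound \<open>x - x\<^sup>2\<close> serves \<open>x \<le> 1 / 2\<close>; for larger
    \<open>x\<close> the bound \<open>x / (1 + x)\<close> does.\<close>
  have half: "x / 2 \<le> ln (1 + x)"
  proof -
    have "x - x\<^sup>2 \<le> ln (1 + x)" using ln_one_plus_pos_lower_bound[of x] x by simp
    moreover have "x\<^sup>2 \<le> x / 2 \<or> 1/2 < x"
      using x by (auto simp: power2_eq_square)
    moreover have "x / 2 \<le> ln (1 + x)" if "1 / 2 < x"
    proof -
      have "x / 2 \<le> x / (1 + x)" using x by (simp add: field_simps)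
      also have "\<dots> \<le> ln (1 + x)"
        using ln_ge_iff[of "1 + x"] x ln_le_minus_one[of "1 / (1 + x)"]
        by (simp add: ln_div field_simps)
      finally show ?thesis .
    qed
    ultimately show ?thesis by linarith
  qed
  have "1 \<le> 8 * L / \<sigma>" using \<sigma> L1 by (simp add: field_simps)
  then have ln0: "0 \<le> ln (8 * L / \<sigma>)" by simp
  have good': "curvature_at \<psi>s (- \<mu>) L Z (xt i)" if "\<forall>l<k. \<not> ?S l" "i < k" for i k
    using good[of i] that by auto
  have "\<exists>i\<le>J. ?S i"
  proof (rule ccontr)
    assume no: "\<not> (\<exists>i\<le>J. ?S i)"
    then have inv: "acg_inv (st J)" "1 / L * (1 + x) ^ (J - 1) \<le> acgA (st J)"
      using acg_inv_run[of J] good'[of J] unfolding x_def J_def by auto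
    have "ln (8 * L / \<sigma>) \<le> real (J - 1) * ln (1 + x)"
    proof -
      have "ln (8 * L / \<sigma>) / ln (1 + x) \<le> real (J - 1)" unfolding J_def by simp linarith
      then show ?thesis using lnx by (simp add: field_simps)
    qed
    also have "\<dots> = ln ((1 + x) ^ (J - 1))" using x by (simp add: ln_realpow)
    finally have "8 * L / \<sigma> \<le> (1 + x) ^ (J - 1)"
      using \<open>1 \<le> 8 * L / \<sigma>\<close> x by (subst (asm) ln_le_cancel_iff) auto
    then have "8 / \<sigma> \<le> 1 / L * (1 + x) ^ (J - 1)" using L_pos \<sigma> by (simp add: field_simps)
    then have "?S J" using acg_stop_if_large[OF inv(1) _ \<sigma>] inv(2) unfolding J_def by simp
    then show False using no by blast
  qed
  then obtain i where i: "i \<le> J" "?S i" by blast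
  show S: "?S j" unfolding j_def using i(2) by (rule LeastI)
  have "j \<le> J" using i Least_le[of ?S i] unfolding j_def by linarith
  have "\<forall>l<j. \<not> ?S l" unfolding j_def using not_less_Least by blast
  moreover have j1: "1 \<le> j" using S unfolding acg3_stop_def by blast
  ultimately have *: "acg_inv (st j) \<and> 1 / L * (1 + sqrt (\<mu> / L)) ^ (j - 1) \<le> acgA (st j)"
    using acg_inv_run[of j] good'[of j] by blast
  then show "acg_inv (st j)" ..
  have "0 < 1 / L * (1 + sqrt (\<mu> / L)) ^ (j - 1)"
    using L_pos mu_pos by (intro mult_pos_pos zero_less_power) (auto simp: add_pos_pos)
  then show "0 < acgA (st j)" using * by linarith
  have "real j \<le> 2 + ln (8 * L / \<sigma>) / ln (1 + x)"
  proof -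
    have "0 \<le> ln (8 * L / \<sigma>) / ln (1 + x)" using ln0 lnx by simp
    then have "real J \<le> 2 + ln (8 * L / \<sigma>) / ln (1 + x)" unfolding J_def by simp linarith
    then show ?thesis using \<open>j \<le> J\<close> by linarith
  qed
  also have "ln (8 * L / \<sigma>) / ln (1 + x) \<le> ln (8 * L / \<sigma>) / (x / 2)"
    using ln0 half x by (intro divide_left_mono) auto
  also have "\<dots> = 2 * sqrt (L / \<mu>) * ln (8 * L / \<sigma>)"
    unfolding x_def using mu_pos L_pos by (simp add: real_sqrt_divide)
  finally show "real j \<le> 2 + 2 * sqrt (L / \<mu>) * ln (8 * L / \<sigma>)" by simp
qed

end

section \<open>Smoothness of the augmented Lagrangian\<close>

text \<open>Testing the two-sided quadratic bound at the four points \<open>a \<plusminus> h\<close>, seen from both \<open>u\<close> and \<open>z\<close>,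
  gives the sharp constant; it needs a ball around the midpoint \<open>a\<close> inside \<open>Z\<close>.\<close>
lemma grad_lipschitz_local:
  fixes f :: "'a::euclidean_space \<Rightarrow> real"
  assumes bd: "\<And>u z. u \<in> Z \<Longrightarrow> z \<in> Z \<Longrightarrow> \<bar>f u - linz f z u\<bar> \<le> M / 2 * (norm (u - z))\<^sup>2"
    and ball: "cball ((1/2) *\<^sub>R (u + z)) (norm (u - z) / 2) \<subseteq> Z"
  shows "norm (grad f u - grad f z) \<le> M * norm (u - z)"
proof -
  define d where "d = (1/2) *\<^sub>R (u - z)"
  define a where "a = (1/2) *\<^sub>R (u + z)"
  define G where "G = grad f u - grad f z"
  \<comment> \<open>Parallel to \<open>G\<close>, so that \<open>G \<bullet> h\<close> reads off the
    norm of \<open>G\<close>, and as long as \<open>d\<close>, so that \<open>a + h\<close> and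
    \<open>a - h\<close> stay in the ball.\<close>
  define h where "h = (norm d / norm G) *\<^sub>R G"
  have nd: "norm d = norm (u - z) / 2" unfolding d_def by simp
  have in_Z: "a + w \<in> Z" if "norm w \<le> norm d" for w
    using ball that nd unfolding a_def[symmetric] by (auto simp: subset_iff dist_norm)
  have u: "u = a + d" and z: "z = a - d"
    unfolding a_def d_def scaleR_add_right scaleR_diff_right
    by (simp_all add: algebra_simps flip: scaleR_add_left)
  have uZ: "u \<in> Z" and zZ: "z \<in> Z" using in_Z[of d] in_Z[of "- d"] u z by simp_all
  show ?thesis
  proof (cases "G = 0 \<or> u = z")
    case True
    have "0 \<le> M / 2 * (norm (u - z))\<^sup>2" using bd[OF uZ zZ] by linarith
    then have "0 \<le> M * norm (u - z)" by (auto simp: zero_le_mult_iff)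
    then show ?thesis using True unfolding G_def by auto
  next
    case False
    have G0: "norm G \<noteq> 0" and d0: "norm d > 0" using False unfolding d_def by auto
    have nh: "norm h = norm d" unfolding h_def using G0 by simp
    have p: "a + h \<in> Z" and q: "a - h \<in> Z" using in_Z[of h] in_Z[of "- h"] nh by simp_all
    have du: "a + h - u = h - d" "a - h - u = - (h + d)" "a + h - z = h + d" "a - h - z = - (h - d)"
      unfolding u z by simp_all
    note b = bd[OF p uZ] bd[OF p zZ] bd[OF q uZ] bd[OF q zZ]
    define X where "X = M / 2 * (norm (h - d))\<^sup>2"
    define Y where "Y = M / 2 * (norm (h + d))\<^sup>2"
    \<comment> \<open>In this signed sum of the four bounds all values of \<open>f\<close> cancel,
      as do the gradients paired with \<open>d\<close>. The parallelogram law then evaluates the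
      right side.\<close>
    have "2 * (G \<bullet> h) \<le> 2 * X + 2 * Y"
      using b[THEN abs_le_D1] b[THEN abs_le_D2]
      unfolding linz_def du norm_minus_cancel G_def inner_diff_left inner_minus_right inner_diff_right
        inner_add_right X_def[symmetric] Y_def[symmetric]
      by argo
    also have "\<dots> = M * ((norm (h - d))\<^sup>2 + (norm (h + d))\<^sup>2)"
      unfolding X_def Y_def by (simp add: distrib_left)
    also have "(norm (h - d))\<^sup>2 + (norm (h + d))\<^sup>2 = 4 * (norm d)\<^sup>2"
      unfolding norm_diff_sq norm_add_sq nh by simp
    finally have "G \<bullet> h \<le> 2 * M * (norm d)\<^sup>2" by simp
    moreover have "G \<bullet> h = norm d * norm G"
      unfolding h_def using G0 by (simp add: flip: power2_norm_eq_inner) (simp add: power2_eq_square)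
    ultimately have "norm d * norm G \<le> norm d * (2 * M * norm d)" by (simp add: power2_eq_square algebra_simps)
    then have "norm G \<le> 2 * M * norm d" using d0 by (simp only: mult_le_cancel_left_pos)
    then show ?thesis unfolding G_def nd by simp
  qed
qed

text \<open>The segment has a tube of uniform radius inside \<open>Z\<close>. Cutting it into pieces
  shorter than that radius makes the local estimate applicable, and the pieces add up without loss
  in the constant.\<close>

lemma grad_lipschitz_interior:
  fixes f :: "'a::euclidean_space \<Rightarrow> real"
  assumes bd: "\<And>u z. u \<in> Z \<Longrightarrow> z \<in> Z \<Longrightarrow> \<bar>f u - linz f z u\<bar> \<le> M / 2 * (norm (u - z))\<^sup>2"
    and Z: "convex Z" and u: "u \<in> interior Z" and z: "z \<in> interior Z"
  shows "norm (grad f u - grad f z) \<le> M * norm (u - z)"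
proof -
  obtain e1 where e1: "e1 > 0" "ball u e1 \<subseteq> Z" using u unfolding mem_interior by blast
  obtain e2 where e2: "e2 > 0" "ball z e2 \<subseteq> Z" using z unfolding mem_interior by blast
  define e where "e = min e1 e2"
  have e: "e > 0" "ball u e \<subseteq> Z" "ball z e \<subseteq> Z" using e1 e2 unfolding e_def by auto
  define w where "w t = z + t *\<^sub>R (u - z)" for t :: real
  have ball_w: "ball (w t) e \<subseteq> Z" if t: "0 \<le> t" "t \<le> 1" for t
  proof
    fix v assume v: "v \<in> ball (w t) e"
    define x where "x = v - w t"
    have "norm x < e" using v unfolding x_def by (simp add: dist_norm norm_minus_commute)
    then have "z + x \<in> Z" "u + x \<in> Z" using e by (auto simp: subset_iff dist_norm)
    from convexD_alt[OF Z this t] have "(1 - t) *\<^sub>R (z + x) + t *\<^sub>R (u + x) \<in> Z" .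
    moreover have "(1 - t) *\<^sub>R (z + x) + t *\<^sub>R (u + x) = v"
      unfolding x_def w_def by (simp add: algebra_simps)
    ultimately show "v \<in> Z" by simp
  qed
  obtain n :: nat where n: "norm (u - z) / e < real n" using reals_Archimedean2 by blast
  have n0: "0 < real n" using n e by (smt (verit) divide_nonneg_pos norm_ge_zero)
  have small: "norm (u - z) / real n < e" using n n0 e by (simp add: field_simps)
  define x where "x i = w (real i / real n)" for i :: nat
  have step: "norm (grad f (x (Suc i)) - grad f (x i)) \<le> M * (norm (u - z) / real n)" if i: "i < n" for i
  proof -
    have diff: "x (Suc i) - x i = (1 / real n) *\<^sub>R (u - z)"
      unfolding x_def w_def by (simp add: algebra_simps add_divide_distrib)
    then have nrm: "norm (x (Suc i) - x i) = norm (u - z) / real n" using n0 by simp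
    have midw: "(1/2) *\<^sub>R (w s + w t) = w ((s + t) / 2)" for s t
    proof -
      have "w s + w t = 2 *\<^sub>R w ((s + t) / 2)"
        unfolding w_def by (simp add: scaleR_add_right scaleR_2 flip: scaleR_add_left)
      then show ?thesis by simp
    qed
    have mid: "(1/2) *\<^sub>R (x (Suc i) + x i) = w ((real i + 1/2) / real n)"
    proof -
      have "(real (Suc i) / real n + real i / real n) / 2 = (real i + 1/2) / real n"
        using n0 by (simp add: field_simps)
      then show ?thesis unfolding x_def midw by (rule arg_cong)
    qed
    have "real i + 1/2 \<le> real n" using i by linarith
    then have "ball (w ((real i + 1/2) / real n)) e \<subseteq> Z" using n0 by (intro ball_w) auto
    moreover have "norm (u - z) / real n / 2 < e"
    proof -
      have "t / 2 < e" if "0 \<le> t" "t < e" for t :: real using that by linarith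
      from this[OF _ small] show ?thesis by simp
    qed
    ultimately have "cball ((1/2) *\<^sub>R (x (Suc i) + x i)) (norm (x (Suc i) - x i) / 2) \<subseteq> Z"
      unfolding mid nrm by (auto simp: subset_iff)
    from grad_lipschitz_local[OF bd this] show ?thesis unfolding nrm by simp
  qed
  have "grad f u - grad f z = (\<Sum>i<n. grad f (x (Suc i)) - grad f (x i))"
    using sum_lessThan_telescope[of "\<lambda>i. grad f (x i)" n] n0 unfolding x_def w_def by simp
  then have "norm (grad f u - grad f z) \<le> (\<Sum>i<n. norm (grad f (x (Suc i)) - grad f (x i)))"
    using norm_sum by metis
  also have "\<dots> \<le> (\<Sum>i<n. M * (norm (u - z) / real n))" using step by (intro sum_mono) auto
  also have "\<dots> = M * norm (u - z)" using n0 by simp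
  finally show ?thesis .
qed

text \<open>Iterates may lie on the boundary of \<open>Z\<close>: both points are shrunk towards the
  interior point \<open>c\<close>, and continuity of the gradient passes to the limit.\<close>

lemma grad_lipschitz:
  fixes f :: "'a::euclidean_space \<Rightarrow> real"
  assumes bd: "\<And>u z. u \<in> Z \<Longrightarrow> z \<in> Z \<Longrightarrow> \<bar>f u - linz f z u\<bar> \<le> M / 2 * (norm (u - z))\<^sup>2"
    and Z: "convex Z" and c: "c \<in> interior Z" and cont: "continuous_on Z (grad f)"
    and u: "u \<in> Z" and z: "z \<in> Z"
  shows "norm (grad f u - grad f z) \<le> M * norm (u - z)"
proof -
  define s where "s v t = v - t *\<^sub>R (v - c)" for v and t :: real
  have int: "s v t \<in> interior Z" if "v \<in> Z" "0 < t" "t < 1" for v t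
    unfolding s_def using mem_interior_convex_shrink[OF Z c that(1,2)] that(3) by simp
  have ev: "\<forall>\<^sub>F t in at_right (0::real). 0 < t \<and> t < 1"
    by (auto simp: eventually_at_right_field intro!: exI[of _ 1])
  have lims: "((\<lambda>t. s v t) \<longlongrightarrow> v) (at_right 0)" for v
    unfolding s_def by (auto intro!: tendsto_eq_intros)
  have lim: "((\<lambda>t. grad f (s v t)) \<longlongrightarrow> grad f v) (at_right 0)" if v: "v \<in> Z" for v
    by (rule continuous_on_tendsto_compose[OF cont lims v])
      (use ev in \<open>eventually_elim, use int[OF v] interior_subset in blast\<close>)
  have 1: "((\<lambda>t. norm (grad f (s u t) - grad f (s z t))) \<longlongrightarrow> norm (grad f u - grad f z)) (at_right 0)"
    by (intro tendsto_intros lim u z)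
  have 2: "((\<lambda>t. M * norm (s u t - s z t)) \<longlongrightarrow> M * norm (u - z)) (at_right 0)"
    by (intro tendsto_intros lims)
  have "\<forall>\<^sub>F t in at_right 0. norm (grad f (s u t) - grad f (s z t)) \<le> M * norm (s u t - s z t)"
    using ev by eventually_elim (use grad_lipschitz_interior[OF bd Z] int u z in blast)
  then show ?thesis by (rule tendsto_le[OF trivial_limit_at_right_real 2 1])
qed

text \<open>The error along the segment, corrected by the quadratic, has nonpositive derivative.
  This is used for the penalty term; the upper curvature of \<open>f\<close> is part of its
  class.\<close>

lemma quadratic_upper_bound:
  fixes G :: "'a::euclidean_space \<Rightarrow> real"
  assumes Z: "convex Z" and der: "\<And>z. z \<in> Z \<Longrightarrow> GDERIV G z :> G' z"
    and lip: "\<And>u z. u \<in> Z \<Longrightarrow> z \<in> Z \<Longrightarrow> norm (G' u - G' z) \<le> L * norm (u - z)"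
    and u: "u \<in> Z" and z: "z \<in> Z"
  shows "G u - G z - G' z \<bullet> (u - z) \<le> L / 2 * (norm (u - z))\<^sup>2"
proof -
  define d where "d = u - z"
  define w where "w t = z + t *\<^sub>R d" for t :: real
  define \<phi> where "\<phi> t = G (w t) - t * (G' z \<bullet> d) - L / 2 * t\<^sup>2 * (norm d)\<^sup>2" for t
  have wZ: "w t \<in> Z" if "0 \<le> t" "t \<le> 1" for t
    using convexD_alt[OF Z z u that] unfolding w_def d_def by (simp add: algebra_simps)
  have "\<phi> 1 \<le> \<phi> 0"
  proof (rule DERIV_nonpos_imp_nonincreasing[of 0 1 \<phi>])
    fix t :: real assume t: "0 \<le> t" "t \<le> 1"
    have "((\<lambda>t. G (w t)) has_derivative (\<lambda>h. (h *\<^sub>R d) \<bullet> G' (w t))) (at t)"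
    proof (rule has_derivative_compose[of w "\<lambda>h. h *\<^sub>R d" t UNIV G "\<lambda>h. h \<bullet> G' (w t)"])
      show "(w has_derivative (\<lambda>h. h *\<^sub>R d)) (at t)" unfolding w_def by (auto intro!: derivative_eq_intros)
      show "(G has_derivative (\<lambda>h. h \<bullet> G' (w t))) (at (w t))" using der[OF wZ[OF t]] unfolding gderiv_def .
    qed
    then have dG: "((\<lambda>t. G (w t)) has_real_derivative (G' (w t) \<bullet> d)) (at t)"
      unfolding has_field_derivative_def
      by (rule has_derivative_eq_rhs) (simp add: fun_eq_iff inner_commute)
    have "(\<phi> has_real_derivative (G' (w t) \<bullet> d - G' z \<bullet> d - L * t * (norm d)\<^sup>2)) (at t)"
      unfolding \<phi>_def by (rule derivative_eq_intros dG refl | simp)+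
    moreover have "(G' (w t) - G' z) \<bullet> d \<le> L * norm (w t - z) * norm d"
      using norm_cauchy_schwarz[of "G' (w t) - G' z" d] lip[OF wZ[OF t] z]
      by (meson mult_right_mono norm_ge_zero order.trans)
    moreover have "L * norm (w t - z) * norm d = L * t * (norm d)\<^sup>2"
      unfolding w_def using t by (simp add: power2_eq_square)
    ultimately show "\<exists>y. (\<phi> has_real_derivative y) (at t) \<and> y \<le> 0"
      by (intro exI[of _ "G' (w t) \<bullet> d - G' z \<bullet> d - L * t * (norm d)\<^sup>2"]) (simp add: inner_diff_left)
  qed simp
  then show ?thesis unfolding \<phi>_def w_def d_def by simp
qed

section \<open>Problem data and bounds for the objective and the constraint map\<close>

locale al_problem =
  fixes D :: "('a::euclidean_space, 'b::euclidean_space) al_data"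
    and Kh \<tau> :: real and zbar :: 'a
  assumes closed_cone: "closed (al_K D)" and cone: "convex_cone (al_K D)"
    and h_conv: "closed_conv (al_Z D) (al_h D)" and convex_Z: "convex (al_Z D)" and compact_Z: "compact (al_Z D)"
    and h_lip: "Kh-lipschitz_on (al_Z D) (\<lambda>z. real_of_ereal (al_h D z))"
    and m_pos: "0 < al_m D" and m_le: "al_m D \<le> al_M D" and f_class: "curvature_class (al_m D) (al_M D) (al_Z D) (al_f D)"
    and g_diff: "cont_diff (al_g D)" and g_conv: "cone_convex (al_K D) (al_g D)" and Lg_pos: "0 < al_Lg D"
    and g_lip: "\<And>u z. onorm (\<lambda>p. nabla (al_g D) u p - nabla (al_g D) z p) \<le> al_Lg D * norm (u - z)"
    and zbar_int: "zbar \<in> interior (al_Z D)" and tau_pos: "0 < \<tau>"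
    and zbar_feas: "cone_le (al_K D) (al_g D zbar) 0"
    and slater: "\<And>z p. z \<in> al_Z D \<Longrightarrow> p \<in> dual_cone (al_K D) \<Longrightarrow>
         \<tau> * norm p \<le> max (norm (nabla (al_g D) z p)) \<bar>al_g D zbar \<bullet> p\<bar>"
    and lam_pos: "0 < al_lam D" and lam_less: "al_lam D < 1 / al_m D"
    and th_pos: "0 < al_th D" and th_le: "al_th D \<le> 1 / sqrt 2" and c1_pos: "0 < al_c1 D" and z0_in: "al_z0 D \<in> al_Z D"

sublocale al_problem \<subseteq> dual_projection "al_K D"
  by unfold_locales (rule closed_cone cone)+

context al_problem
begin

abbreviation "f \<equiv> al_f D"
abbreviation "h \<equiv> al_h D"
abbreviation "g \<equiv> al_g D"
abbreviation "Z \<equiv> al_Z D"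
abbreviation "m \<equiv> al_m D"
abbreviation "M \<equiv> al_M D"
abbreviation "Lg \<equiv> al_Lg D"
abbreviation "lam \<equiv> al_lam D"
abbreviation "\<theta> \<equiv> al_th D"
abbreviation "c1 \<equiv> al_c1 D"
abbreviation "H z \<equiv> real_of_ereal (h z)"
abbreviation "B0 \<equiv> bnd0 Z g"
abbreviation "B1 \<equiv> bnd1 Z g"
abbreviation "F c p \<equiv> auglag f g (al_K D) c p"
abbreviation "Lt c p \<equiv> auglag_lip M Lg g Z c p"

lemma M_pos: "0 < M" using m_pos m_le by linarith

lemma Z_nonempty: "Z \<noteq> {}" using zbar_int interior_subset by blast

lemma zbar_in: "zbar \<in> Z" using zbar_int interior_subset by blast

lemma h_in:
  assumes "z \<in> Z"
  shows "h z = ereal (H z)"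
proof -
  have "h z < \<infinity>" "h z \<noteq> - \<infinity>" using h_conv assms unfolding closed_conv_def by auto
  then show ?thesis by (cases "h z") auto
qed

lemma h_off: "z \<notin> Z \<Longrightarrow> h z = \<infinity>"
  using h_conv unfolding closed_conv_def by fastforce

lemma convex_H: "convex_on Z H"
proof (rule convex_onI[OF _ convex_Z])
  fix t :: real and x y assume t: "0 < t" "t < 1" and x: "x \<in> Z" and y: "y \<in> Z"
  let ?w = "(1 - t) *\<^sub>R x + t *\<^sub>R y"
  have w: "?w \<in> Z" using convexD_alt[OF convex_Z x y] t by simp
  have "h ?w \<le> ereal (1 - t) * h x + ereal t * h y"
    using h_conv t unfolding closed_conv_def by simp
  then show "H ?w \<le> (1 - t) * H x + t * H y"
    using h_in[OF x] h_in[OF y] h_in[OF w] by (metis ereal_less_eq(3) plus_ereal.simps(1) times_ereal.simps(1))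
qed

lemma continuous_H: "continuous_on Z H"
  using h_lip by (rule lipschitz_on_continuous_on)

lemma f_diff: "z \<in> Z \<Longrightarrow> GDERIV f z :> grad f z"
  using f_class unfolding curvature_class_def curvature_at_def by (auto intro: GDERIV_grad)

lemma f_lower: "u \<in> Z \<Longrightarrow> z \<in> Z \<Longrightarrow> linz f z u - m / 2 * (norm (u - z))\<^sup>2 \<le> f u"
  and f_upper: "u \<in> Z \<Longrightarrow> z \<in> Z \<Longrightarrow> f u \<le> linz f z u + M / 2 * (norm (u - z))\<^sup>2"
  using f_class unfolding curvature_class_def curvature_at_def by force+

lemma grad_f_continuous: "continuous_on Z (grad f)"
  using f_class unfolding curvature_class_def by blast

lemma grad_f_lipschitz:
  assumes "u \<in> Z" "z \<in> Z"
  shows "norm (grad f u - grad f z) \<le> M * norm (u - z)"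
proof (rule grad_lipschitz[OF _ convex_Z zbar_int grad_f_continuous assms])
  fix u z assume uz: "u \<in> Z" "z \<in> Z"
  have "m / 2 * (norm (u - z))\<^sup>2 \<le> M / 2 * (norm (u - z))\<^sup>2"
    using m_le by (intro mult_right_mono) auto
  then show "\<bar>f u - linz f z u\<bar> \<le> M / 2 * (norm (u - z))\<^sup>2"
    using f_lower[OF uz] f_upper[OF uz] by linarith
qed

lemma g_has_derivative: "(g has_derivative frechet_derivative g (at z)) (at z)"
  using g_diff unfolding cont_diff_def by (metis differentiableI frechet_derivative_works)

lemma nabla_inner: "x \<bullet> nabla g z p = frechet_derivative g (at z) x \<bullet> p"
  unfolding nabla_def by (rule adjoint_works[OF has_derivative_linear[OF g_has_derivative]])

lemma nabla_linear: "bounded_linear (nabla g z)"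
  unfolding nabla_def linear_conv_bounded_linear[symmetric]
  by (rule adjoint_linear[OF has_derivative_linear[OF g_has_derivative]])

lemma nabla_lipschitz: "norm (nabla g u p - nabla g z p) \<le> Lg * norm (u - z) * norm p"
proof -
  have "norm (nabla g u p - nabla g z p) \<le> onorm (\<lambda>p. nabla g u p - nabla g z p) * norm p"
    using onorm[OF bounded_linear_sub[OF nabla_linear nabla_linear]] .
  also have "\<dots> \<le> Lg * norm (u - z) * norm p" using g_lip by (intro mult_right_mono) auto
  finally show ?thesis .
qed

text \<open>A real supremum bounds its members only if they are bounded above; this follows from the
  Lipschitz condition and boundedness of \<open>Z\<close>.\<close>

lemma nabla_onorm_le: "z \<in> Z \<Longrightarrow> onorm (nabla g z) \<le> B1"
  unfolding bnd1_def
proof (rule cSUP_upper)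
  obtain R where R: "\<And>z. z \<in> Z \<Longrightarrow> norm (z - zbar) \<le> R"
    using compact_imp_bounded[OF compact_Z] by (metis bounded_any_center dist_commute dist_norm)
  show "bdd_above ((\<lambda>z. onorm (nabla g z)) ` Z)"
  proof (rule bdd_aboveI2)
    fix z assume z: "z \<in> Z"
    have R0: "0 \<le> R" using R[OF zbar_in] by simp
    show "onorm (nabla g z) \<le> onorm (nabla g zbar) + Lg * R"
    proof (rule onorm_bound)
      show "0 \<le> onorm (nabla g zbar) + Lg * R"
        using onorm_pos_le[OF nabla_linear] Lg_pos R0 by (simp add: add_nonneg_nonneg)
      fix p
      have "norm (nabla g z p) \<le> norm (nabla g zbar p) + norm (nabla g z p - nabla g zbar p)"
        by (metis norm_triangle_sub)
      also have "\<dots> \<le> onorm (nabla g zbar) * norm p + Lg * norm (z - zbar) * norm p"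
        by (intro add_mono onorm[OF nabla_linear] nabla_lipschitz)
      also have "\<dots> \<le> onorm (nabla g zbar) * norm p + Lg * R * norm p"
        using R[OF z] Lg_pos by (intro add_left_mono mult_right_mono mult_left_mono) auto
      finally show "norm (nabla g z p) \<le> (onorm (nabla g zbar) + Lg * R) * norm p"
        by (simp add: distrib_right)
    qed
  qed
qed

lemma B1_nonneg: "0 \<le> B1"
  using nabla_onorm_le[OF zbar_in] onorm_pos_le[OF nabla_linear] order_trans by blast

lemma nabla_norm_le: "z \<in> Z \<Longrightarrow> norm (nabla g z p) \<le> B1 * norm p"
  using onorm[OF nabla_linear] nabla_onorm_le by (meson mult_right_mono norm_ge_zero order.trans)

lemma continuous_g: "continuous_on A g"
  by (meson continuous_at_imp_continuous_on g_has_derivative has_derivative_continuous)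

lemma g_norm_le: "z \<in> Z \<Longrightarrow> norm (g z) \<le> B0"
  unfolding bnd0_def
proof (rule cSUP_upper)
  show "bdd_above ((\<lambda>z. norm (g z)) ` Z)"
    by (intro bounded_imp_bdd_above compact_imp_bounded compact_continuous_image continuous_intros
        continuous_g compact_Z)
qed

lemma B0_nonneg: "0 \<le> B0"
  using g_norm_le[OF zbar_in] norm_ge_zero order_trans by blast

lemma g_lipschitz:
  assumes u: "u \<in> Z" and z: "z \<in> Z"
  shows "norm (g u - g z) \<le> B1 * norm (u - z)"
proof (rule differentiable_bound[OF convex_Z _ _ u z])
  fix x assume x: "x \<in> Z"
  show "(g has_derivative frechet_derivative g (at x)) (at x within Z)"
    using g_has_derivative has_derivative_at_withinI by blast
  show "onorm (frechet_derivative g (at x)) \<le> B1"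
  proof (rule onorm_bound[OF B1_nonneg])
    fix v
    let ?y = "frechet_derivative g (at x) v"
    \<comment> \<open>\<open>B1\<close> controls the transposed Jacobian; pairing the image with
      itself carries the bound over to the Jacobian.\<close>
    have "norm ?y * norm ?y = v \<bullet> nabla g x ?y"
      unfolding nabla_inner by (simp flip: power2_norm_eq_inner power2_eq_square)
    also have "\<dots> \<le> norm v * norm (nabla g x ?y)" by (rule norm_cauchy_schwarz)
    also have "\<dots> \<le> norm v * (B1 * norm ?y)" using nabla_norm_le[OF x] by (intro mult_left_mono) auto
    finally have "norm ?y * norm ?y \<le> (B1 * norm v) * norm ?y" by (simp add: mult_ac)
    then show "norm ?y \<le> B1 * norm v"
      using B1_nonneg by (cases "norm ?y = 0") (auto simp: mult_le_cancel_right)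
  qed
qed

text \<open>Pairing with a dual vector makes \<open>g\<close> a scalar convex function; the gradient
  inequality is the limit of its difference quotients.\<close>

lemma cone_convex_gradient:
  assumes p: "p \<in> dual_cone (al_K D)"
  shows "nabla g z p \<bullet> (u - z) \<le> (g u - g z) \<bullet> p"
proof -
  define d where "d = u - z"
  have der: "((\<lambda>t. g (z + t *\<^sub>R d)) has_derivative (\<lambda>s. frechet_derivative g (at z) (s *\<^sub>R d))) (at 0)"
  proof (rule has_derivative_compose[of "\<lambda>t. z + t *\<^sub>R d" "\<lambda>s. s *\<^sub>R d" 0 UNIV g])
    show "((\<lambda>t. z + t *\<^sub>R d) has_derivative (\<lambda>s. s *\<^sub>R d)) (at 0)" by (auto intro!: derivative_eq_intros)
    show "(g has_derivative frechet_derivative g (at z)) (at (z + 0 *\<^sub>R d))" using g_has_derivative by simp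
  qed
  have "((\<lambda>t. g (z + t *\<^sub>R d) \<bullet> p) has_real_derivative (nabla g z p \<bullet> d)) (at 0)"
    unfolding has_field_derivative_def
    by (rule has_derivative_eq_rhs[OF has_derivative_inner_left[OF der]])
      (auto simp: fun_eq_iff simp flip: nabla_inner, simp add: inner_commute mult.commute)
  then have "((\<lambda>t. (g (z + t *\<^sub>R d) \<bullet> p - g z \<bullet> p) / t) \<longlongrightarrow> nabla g z p \<bullet> d) (at 0)"
    unfolding DERIV_def by simp
  then have lim: "((\<lambda>t. (g (z + t *\<^sub>R d) \<bullet> p - g z \<bullet> p) / t) \<longlongrightarrow> nabla g z p \<bullet> d) (at_right 0)"
    using filterlim_at_split by blast
  have ev: "\<forall>\<^sub>F t in at_right (0::real). 0 < t \<and> t < 1"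
    by (auto simp: eventually_at_right_field intro!: exI[of _ 1])
  have "\<forall>\<^sub>F t in at_right (0::real). (g (z + t *\<^sub>R d) \<bullet> p - g z \<bullet> p) / t \<le> (g u - g z) \<bullet> p"
    using ev
  proof eventually_elim
    case (elim t)
    have "t *\<^sub>R g u + (1 - t) *\<^sub>R g z - g (t *\<^sub>R u + (1 - t) *\<^sub>R z) \<in> al_K D"
      using g_conv elim unfolding cone_convex_def cone_le_def by auto
    moreover have "t *\<^sub>R u + (1 - t) *\<^sub>R z = z + t *\<^sub>R d" unfolding d_def by (simp add: algebra_simps)
    ultimately have "0 \<le> (t *\<^sub>R g u + (1 - t) *\<^sub>R g z - g (z + t *\<^sub>R d)) \<bullet> p"
      using p unfolding dual_cone_def by auto
    then have "g (z + t *\<^sub>R d) \<bullet> p - g z \<bullet> p \<le> ((g u - g z) \<bullet> p) * t"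
      by (simp add: inner_diff_left inner_add_left algebra_simps)
    then show ?case using elim by (simp add: pos_divide_le_eq)
  qed
  from tendsto_upperbound[OF lim this] show ?thesis unfolding d_def by simp
qed

section \<open>Gradient and curvature of the augmented Lagrangian\<close>

lemma auglag_eq: "F c p z = f z + 1 / (2 * c) * ((norm (proj (p + c *\<^sub>R g z)))\<^sup>2 - (norm p)\<^sup>2)"
  unfolding auglag_def infdist_proj ..

text \<open>The gradient of the penalty is that of the linear Lagrangian term at the updated
  multiplier. This is why the refined residual satisfies its inclusion exactly, with
  \<open>al_phat\<close> as multiplier.\<close>

lemma GDERIV_penalty:
  assumes c: "0 < c"
  shows "GDERIV (\<lambda>z. 1 / (2 * c) * ((norm (proj (p + c *\<^sub>R g z)))\<^sup>2 - (norm p)\<^sup>2)) z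
    :> nabla g z (proj (p + c *\<^sub>R g z))"
proof -
  let ?q = "proj (p + c *\<^sub>R g z)"
  let ?g' = "frechet_derivative g (at z)"
  have "((\<lambda>z. (norm (proj (p + c *\<^sub>R g z)))\<^sup>2) has_derivative (\<lambda>v. (c *\<^sub>R ?g' v) \<bullet> (2 *\<^sub>R ?q))) (at z)"
  proof (rule has_derivative_compose[of "\<lambda>z. p + c *\<^sub>R g z" "\<lambda>v. c *\<^sub>R ?g' v" z UNIV
        "\<lambda>x. (norm (proj x))\<^sup>2" "\<lambda>v. v \<bullet> (2 *\<^sub>R ?q)"])
    show "((\<lambda>z. p + c *\<^sub>R g z) has_derivative (\<lambda>v. c *\<^sub>R ?g' v)) (at z)"
      by (auto intro!: derivative_eq_intros g_has_derivative)
    show "((\<lambda>x. (norm (proj x))\<^sup>2) has_derivative (\<lambda>v. v \<bullet> (2 *\<^sub>R ?q))) (at (p + c *\<^sub>R g z))"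
      using GDERIV_norm_proj_sq unfolding gderiv_def .
  qed
  then have "((\<lambda>z. 1 / (2 * c) * ((norm (proj (p + c *\<^sub>R g z)))\<^sup>2 - (norm p)\<^sup>2)) has_derivative
     (\<lambda>v. 1 / (2 * c) * ((c *\<^sub>R ?g' v) \<bullet> (2 *\<^sub>R ?q) - 0))) (at z)"
    by (intro has_derivative_mult_right has_derivative_diff has_derivative_const)
  moreover have "1 / (2 * c) * ((c *\<^sub>R ?g' v) \<bullet> (2 *\<^sub>R ?q) - 0) = v \<bullet> nabla g z ?q" for v
    unfolding nabla_inner using c by simp
  ultimately show ?thesis unfolding gderiv_def by simp
qed

lemma GDERIV_auglag:
  assumes "0 < c" "z \<in> Z"
  shows "GDERIV (F c p) z :> grad f z + nabla g z (proj (p + c *\<^sub>R g z))"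
  unfolding auglag_eq[abs_def] using assms by (intro GDERIV_add f_diff GDERIV_penalty)

lemma grad_auglag:
  assumes "0 < c" "z \<in> Z"
  shows "grad (F c p) z = grad f z + nabla g z (proj (p + c *\<^sub>R g z))"
  by (rule grad_eqI[OF GDERIV_auglag[OF assms]])

lemma penalty_grad_lipschitz:
  assumes c: "0 < c" and u: "u \<in> Z" and z: "z \<in> Z"
  shows "norm (nabla g u (proj (p + c *\<^sub>R g u)) - nabla g z (proj (p + c *\<^sub>R g z)))
    \<le> (Lg * norm p + c * (B0 * Lg + B1\<^sup>2)) * norm (u - z)"
proof -
  let ?P = "\<lambda>u. proj (p + c *\<^sub>R g u)"
  have "norm (?P u) \<le> norm (p + c *\<^sub>R g u)" by (rule norm_proj_le)
  also have "\<dots> \<le> norm p + c * norm (g u)" using norm_triangle_ineq[of p "c *\<^sub>R g u"] c by simp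
  also have "\<dots> \<le> norm p + c * B0" using g_norm_le[OF u] c by simp
  finally have Pu: "norm (?P u) \<le> norm p + c * B0" .
  have "norm (?P u - ?P z) \<le> norm ((p + c *\<^sub>R g u) - (p + c *\<^sub>R g z))" by (rule proj_nonexpansive)
  also have "\<dots> = c * norm (g u - g z)" using c by (simp flip: scaleR_diff_right)
  also have "\<dots> \<le> c * (B1 * norm (u - z))" using g_lipschitz[OF u z] c by simp
  finally have Pd: "norm (?P u - ?P z) \<le> c * (B1 * norm (u - z))" .
  have "nabla g u (?P u) - nabla g z (?P z) = (nabla g u (?P u) - nabla g z (?P u)) + nabla g z (?P u - ?P z)"
    using linear_diff[OF bounded_linear.linear[OF nabla_linear]] by simp
  then have "norm (nabla g u (?P u) - nabla g z (?P z))
      \<le> norm (nabla g u (?P u) - nabla g z (?P u)) + norm (nabla g z (?P u - ?P z))"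
    by (metis norm_triangle_ineq)
  also have "\<dots> \<le> Lg * norm (u - z) * norm (?P u) + B1 * norm (?P u - ?P z)"
    by (intro add_mono nabla_lipschitz nabla_norm_le z)
  also have "\<dots> \<le> Lg * norm (u - z) * (norm p + c * B0) + B1 * (c * (B1 * norm (u - z)))"
    using Lg_pos B1_nonneg Pu Pd by (intro add_mono mult_left_mono) auto
  also have "\<dots> = (Lg * norm p + c * (B0 * Lg + B1\<^sup>2)) * norm (u - z)"
    by (simp add: power2_eq_square algebra_simps)
  finally show ?thesis .
qed

text \<open>The penalty is convex: the maximiser at \<open>z\<close> competes in the maximum at
  \<open>u\<close>, and \<open>cone_convex_gradient\<close> linearises \<open>g\<close>. So only
  \<open>f\<close> contributes to the constant \<open>m\<close>, whatever the penalty.\<close>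

lemma auglag_lower:
  assumes c: "0 < c" and u: "u \<in> Z" and z: "z \<in> Z"
  shows "linz (F c p) z u - m / 2 * (norm (u - z))\<^sup>2 \<le> F c p u"
proof -
  let ?q = "proj (p + c *\<^sub>R g z)"
  have "2 * (?q \<bullet> (p + c *\<^sub>R g u)) - (norm ?q)\<^sup>2 \<le> (norm (proj (p + c *\<^sub>R g u)))\<^sup>2"
    by (rule proj_maximal[OF proj_in])
  moreover have "2 * (?q \<bullet> (p + c *\<^sub>R g z)) - (norm ?q)\<^sup>2 = (norm ?q)\<^sup>2" by (rule proj_maximum)
  moreover have "nabla g z ?q \<bullet> (u - z) \<le> (g u - g z) \<bullet> ?q"
    by (rule cone_convex_gradient[OF proj_in])
  then have "2 * c * (nabla g z ?q \<bullet> (u - z)) \<le> 2 * c * ((g u - g z) \<bullet> ?q)" using c by simp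
  ultimately have "2 * c * (nabla g z ?q \<bullet> (u - z)) \<le> (norm (proj (p + c *\<^sub>R g u)))\<^sup>2 - (norm ?q)\<^sup>2"
    by (simp add: inner_add_right inner_diff_left inner_diff_right inner_commute algebra_simps)
  then have "nabla g z ?q \<bullet> (u - z) \<le> 1 / (2 * c) * ((norm (proj (p + c *\<^sub>R g u)))\<^sup>2 - (norm ?q)\<^sup>2)"
    using c by (simp add: field_simps)
  then show ?thesis
    using f_lower[OF u z]
    unfolding linz_def grad_auglag[OF c z] auglag_eq inner_add_left right_diff_distrib by linarith
qed

lemma auglag_upper:
  assumes c: "0 < c" and u: "u \<in> Z" and z: "z \<in> Z"
  shows "F c p u \<le> linz (F c p) z u + Lt c p / 2 * (norm (u - z))\<^sup>2"
proof -
  have "1 / (2 * c) * ((norm (proj (p + c *\<^sub>R g u)))\<^sup>2 - (norm p)\<^sup>2)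
      - 1 / (2 * c) * ((norm (proj (p + c *\<^sub>R g z)))\<^sup>2 - (norm p)\<^sup>2)
      - nabla g z (proj (p + c *\<^sub>R g z)) \<bullet> (u - z)
      \<le> (Lg * norm p + c * (B0 * Lg + B1\<^sup>2)) / 2 * (norm (u - z))\<^sup>2"
    by (rule quadratic_upper_bound[OF convex_Z GDERIV_penalty penalty_grad_lipschitz]) (use c u z in auto)
  moreover have "Lt c p / 2 * (norm (u - z))\<^sup>2
     = M / 2 * (norm (u - z))\<^sup>2 + (Lg * norm p + c * (B0 * Lg + B1\<^sup>2)) / 2 * (norm (u - z))\<^sup>2"
    unfolding auglag_lip_def by (simp add: field_simps)
  ultimately show ?thesis
    using f_upper[OF u z] unfolding linz_def grad_auglag[OF c z] auglag_eq inner_add_left by linarith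
qed

lemma grad_auglag_lipschitz:
  assumes c: "0 < c" and u: "u \<in> Z" and z: "z \<in> Z"
  shows "norm (grad (F c p) u - grad (F c p) z) \<le> Lt c p * norm (u - z)"
proof -
  let ?N = "\<lambda>z. nabla g z (proj (p + c *\<^sub>R g z))"
  have "grad (F c p) u - grad (F c p) z = (grad f u - grad f z) + (?N u - ?N z)"
    unfolding grad_auglag[OF c u] grad_auglag[OF c z] by simp
  then have "norm (grad (F c p) u - grad (F c p) z) \<le> norm (grad f u - grad f z) + norm (?N u - ?N z)"
    by (metis norm_triangle_ineq)
  also have "\<dots> \<le> M * norm (u - z) + (Lg * norm p + c * (B0 * Lg + B1\<^sup>2)) * norm (u - z)"
    by (intro add_mono grad_f_lipschitz penalty_grad_lipschitz c u z)
  also have "\<dots> = Lt c p * norm (u - z)" unfolding auglag_lip_def by (simp add: algebra_simps)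
  finally show ?thesis .
qed

end

section \<open>One outer iteration\<close>

context al_problem
begin

text \<open>Freezes the extrapolation hypothesis at a single state, detached from the run, so that
  estimates for one iteration can be quantified over arbitrary states.\<close>

definition valid_state :: "('a, 'b) al_state \<Rightarrow> bool" where
  "valid_state s \<longleftrightarrow> 0 < st_c s \<and> al_zcur s \<in> Z \<and>
    (\<forall>j. (\<forall>i\<le>j. \<not> al_acg_stop D s i) \<longrightarrow>
      acg_xtilde (al_mu D) (al_Lpsi D s) (al_acg D s j) \<notin> Z \<longrightarrow>
      curvature_at (al_psis D s) (- al_mu D) (al_Lpsi D s) Z
        (acg_xtilde (al_mu D) (al_Lpsi D s) (al_acg D s j)))"

lemma mu_bounds: "0 < al_mu D" "al_mu D < 1"
  using lam_pos lam_less m_pos unfolding al_mu_def by (auto simp: field_simps)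

lemma th_less: "\<theta> < 1" and th_sq: "\<theta>\<^sup>2 \<le> 1 / 2" and th_sq_le: "\<theta>\<^sup>2 \<le> \<theta>"
proof -
  have "\<theta>\<^sup>2 \<le> (1 / sqrt 2)\<^sup>2" using th_pos th_le by (intro power_mono) auto
  then show sq: "\<theta>\<^sup>2 \<le> 1 / 2" by (simp add: power_divide)
  show l: "\<theta> < 1"
  proof (rule ccontr)
    assume "\<not> \<theta> < 1"
    then have "1 \<le> \<theta>\<^sup>2" by (simp add: one_le_power)
    then show False using sq by simp
  qed
  show "\<theta>\<^sup>2 \<le> \<theta>" using l th_pos by (simp add: power2_eq_square mult_left_le)
qed

lemma Lt_pos: "0 < c \<Longrightarrow> 0 < Lt c p"
  unfolding auglag_lip_def using M_pos Lg_pos B0_nonneg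
  by (intro add_pos_nonneg mult_nonneg_nonneg add_nonneg_nonneg) auto

lemma diam_bound: "u \<in> Z \<Longrightarrow> z \<in> Z \<Longrightarrow> norm (u - z) \<le> diameter Z"
  using diameter_bounded_bound[OF compact_imp_bounded[OF compact_Z]] by (simp add: dist_norm)

lemma al_lagr_eq: "z \<in> Z \<Longrightarrow> al_lagr D c z p = F c p z + H z"
  unfolding al_lagr_def using h_in by (metis plus_ereal.simps(1) real_of_ereal.simps(1))

text \<open>With \<open>q2\<close> the next update, the change is a multiple of
  \<open>(norm q2)\<^sup>2 - 2 * (norm q)\<^sup>2 + (norm p)\<^sup>2\<close>. The cone inequality
  \<open>r1\<close> makes \<open>q2\<close> no longer than the reflected point
  \<open>2 *\<^sub>R q - p\<close>, which leaves exactly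
  \<open>2 * (norm (q - p))\<^sup>2\<close>.\<close>

lemma auglag_multiplier_update:
  fixes p :: 'b and z :: 'a
  assumes c: "0 < c"
  defines "q \<equiv> proj (p + c *\<^sub>R g z)"
  shows "F c q z \<le> F c p z + (norm (q - p))\<^sup>2 / c"
proof -
  define G where "G = c *\<^sub>R g z"
  define q2 where "q2 = proj (q + G)"
  have q: "q = proj (p + G)" unfolding q_def G_def ..
  have r1: "((p + G) - q) \<bullet> q2 \<le> 0" unfolding q q2_def by (rule proj_residual_inner[OF proj_in])
  have e2: "2 * (q2 \<bullet> (q + G)) - (norm q2)\<^sup>2 = (norm q2)\<^sup>2" unfolding q2_def by (rule proj_maximum)
  have "0 \<le> (norm (q2 - (2 *\<^sub>R q - p)))\<^sup>2" by simp
  then have "(norm q2)\<^sup>2 - 2 * (norm q)\<^sup>2 + (norm p)\<^sup>2 \<le> 2 * (norm (q - p))\<^sup>2"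
    using r1 e2 unfolding power2_norm_eq_inner
    by (simp add: inner_add_left inner_add_right inner_diff_left inner_diff_right inner_commute algebra_simps)
  then have "1 / (2 * c) * ((norm q2)\<^sup>2 - 2 * (norm q)\<^sup>2 + (norm p)\<^sup>2) \<le> 1 / (2 * c) * (2 * (norm (q - p))\<^sup>2)"
    using c by (intro mult_left_mono) auto
  moreover have "F c q z - F c p z = 1 / (2 * c) * ((norm q2)\<^sup>2 - 2 * (norm q)\<^sup>2 + (norm p)\<^sup>2)"
    unfolding auglag_eq G_def[symmetric] q2_def[symmetric] q[symmetric] by (simp add: algebra_simps)
  moreover have "1 / (2 * c) * (2 * (norm (q - p))\<^sup>2) = (norm (q - p))\<^sup>2 / c" by simp
  ultimately show ?thesis by linarith
qed

text \<open>The slack is \<open>(norm (q - p))\<^sup>2 / (2 * c)\<close> for the updated multiplier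
  \<open>q\<close>. With bounded multipliers, this and \<open>auglag_ge\<close> confine the
  augmented Lagrangian to a range uniform in large \<open>c\<close>.\<close>

lemma auglag_le:
  assumes c: "0 < c"
  shows "F c p z \<le> f z + proj (p + c *\<^sub>R g z) \<bullet> g z"
proof -
  let ?q = "proj (p + c *\<^sub>R g z)"
  have "2 * (?q \<bullet> (p + c *\<^sub>R g z)) - (norm ?q)\<^sup>2 = (norm ?q)\<^sup>2" by (rule proj_maximum)
  moreover have "0 \<le> (norm (?q - p))\<^sup>2" by simp
  ultimately have "(norm ?q)\<^sup>2 - (norm p)\<^sup>2 \<le> 2 * c * (?q \<bullet> g z)"
    unfolding norm_diff_sq by (simp add: inner_add_right)
  then have "1 / (2 * c) * ((norm ?q)\<^sup>2 - (norm p)\<^sup>2) \<le> 1 / (2 * c) * (2 * c * (?q \<bullet> g z))"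
    using c by (intro mult_left_mono) auto
  then show ?thesis unfolding auglag_eq using c by simp
qed

lemma auglag_ge:
  assumes c: "0 < c"
  shows "f z - (norm p)\<^sup>2 / (2 * c) \<le> F c p z"
proof -
  have "1 / (2 * c) * (0 - (norm p)\<^sup>2) \<le> 1 / (2 * c) * ((norm (proj (p + c *\<^sub>R g z)))\<^sup>2 - (norm p)\<^sup>2)"
    using c by (intro mult_left_mono) auto
  then show ?thesis unfolding auglag_eq by simp
qed

end

locale al_iteration = al_problem +
  fixes s :: "('a, 'b) al_state"
  assumes valid: "valid_state s"
begin

abbreviation "c \<equiv> st_c s"
abbreviation "p \<equiv> al_pcur s"
abbreviation "zc \<equiv> al_zcur s"
abbreviation "z \<equiv> al_z D s"
abbreviation "zh \<equiv> al_zhat D s"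
abbreviation "L \<equiv> al_Lpsi D s"
abbreviation "\<mu> \<equiv> al_mu D"

lemma c_pos: "0 < c" and zc_in: "zc \<in> Z"
  using valid unfolding valid_state_def by auto

lemma F_eq: "al_F D s = F c p"
  unfolding al_F_def ..

lemma L_eq: "L = lam * Lt c p + 1"
  unfolding al_Lpsi_def ..

lemma L_ge: "1 \<le> L"
  unfolding L_eq using lam_pos Lt_pos[OF c_pos] by (simp add: less_imp_le)

lemma psis_eq: "al_psis D s u = lam * F c p u + 1 / 2 * (norm (u - zc))\<^sup>2"
  unfolding al_psis_def F_eq ..

lemma GDERIV_psis:
  assumes w: "w \<in> Z"
  shows "GDERIV (al_psis D s) w :> lam *\<^sub>R grad (F c p) w + (w - zc)"
proof -
  have F: "(F c p has_derivative (\<lambda>h. h \<bullet> grad (F c p) w)) (at w)"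
    using GDERIV_auglag[OF c_pos w] grad_auglag[OF c_pos w] unfolding gderiv_def by simp
  have sq: "((\<lambda>u. 1 / 2 * ((u - zc) \<bullet> (u - zc))) has_derivative (\<lambda>h. h \<bullet> (w - zc))) (at w)"
    by (auto intro!: derivative_eq_intros simp: inner_commute)
  have "al_psis D s = (\<lambda>u. lam * F c p u + 1 / 2 * ((u - zc) \<bullet> (u - zc)))"
    by (rule ext) (simp add: psis_eq power2_norm_eq_inner)
  moreover have "((\<lambda>u. lam * F c p u + 1 / 2 * ((u - zc) \<bullet> (u - zc))) has_derivative
      (\<lambda>h. h \<bullet> (lam *\<^sub>R grad (F c p) w + (w - zc)))) (at w)"
    by (rule has_derivative_eq_rhs[OF has_derivative_add[OF has_derivative_mult_right[OF F] sq]])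
      (simp add: inner_add_right)
  ultimately show ?thesis unfolding gderiv_def by simp
qed

text \<open>The prox term is exactly quadratic and adds 1 to both curvatures:
  \<open>- lam * m\<close> becomes \<open>\<mu>\<close>, and \<open>lam * Lt c p\<close> becomes
  \<open>L\<close>. Base points in \<open>Z\<close> thus satisfy what ACG demands.\<close>

lemma curvature_psis:
  assumes w: "w \<in> Z"
  shows "curvature_at (al_psis D s) (- \<mu>) L Z w"
  unfolding curvature_at_def
proof (intro conjI ballI)
  show "al_psis D s differentiable at w"
    using GDERIV_psis[OF w] by (rule differentiable_of_GDERIV)
  fix u assume u: "u \<in> Z"
  have g: "grad (al_psis D s) w = lam *\<^sub>R grad (F c p) w + (w - zc)"
    by (rule grad_eqI[OF GDERIV_psis[OF w]])
  have "(norm (u - zc))\<^sup>2 = (norm (u - w))\<^sup>2 + 2 * ((u - w) \<bullet> (w - zc)) + (norm (w - zc))\<^sup>2"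
    using norm_add_sq[of "u - w" "w - zc"] by simp
  then have eq: "al_psis D s u - linz (al_psis D s) w u
      = lam * (F c p u - linz (F c p) w u) + (norm (u - w))\<^sup>2 / 2"
    unfolding linz_def g psis_eq inner_add_left inner_commute[of "w - zc"]
    by (simp add: algebra_simps)
  have "lam * (- (m / 2) * (norm (u - w))\<^sup>2) \<le> lam * (F c p u - linz (F c p) w u)"
    using auglag_lower[OF c_pos u w, of p] lam_pos by (intro mult_left_mono) auto
  then show "- (- \<mu> / 2) * (norm (u - w))\<^sup>2 \<le> al_psis D s u - linz (al_psis D s) w u"
    unfolding eq al_mu_def by (simp add: field_simps)
  have "lam * (F c p u - linz (F c p) w u) \<le> lam * (Lt c p / 2 * (norm (u - w))\<^sup>2)"
    using auglag_upper[OF c_pos u w, of p] lam_pos by (intro mult_left_mono) auto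
  then show "al_psis D s u - linz (al_psis D s) w u \<le> L / 2 * (norm (u - w))\<^sup>2"
    unfolding eq L_eq by (simp add: field_simps)
qed

sublocale acg: acg_problem Z "al_psis D s" "al_psin D" "\<lambda>u. lam * H u" zc \<mu> L
proof unfold_locales
  show "u \<in> Z \<Longrightarrow> al_psin D u = ereal (lam * H u)" for u
    unfolding al_psin_def using h_in by (metis times_ereal.simps(1))
  show "u \<notin> Z \<Longrightarrow> al_psin D u = \<infinity>" for u
    unfolding al_psin_def using h_off lam_pos by simp
  show "convex_on Z (\<lambda>u. lam * H u)" using convex_on_cmul[OF _ convex_H] lam_pos by simp
  show "continuous_on Z (\<lambda>u. lam * H u)" by (intro continuous_intros continuous_H)
  show "\<mu> \<le> L" using mu_bounds L_ge by linarith
qed (rule convex_Z compact_Z zc_in mu_bounds)+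

lemma sigma_bounds: "0 < \<theta>\<^sup>2 / L" "\<theta>\<^sup>2 / L \<le> 1"
proof -
  show "0 < \<theta>\<^sup>2 / L" using th_pos L_ge by simp
  have "\<theta>\<^sup>2 \<le> L" using th_sq L_ge by linarith
  then show "\<theta>\<^sup>2 / L \<le> 1" using L_ge by simp
qed

lemma extrapolation_curvature:
  assumes "\<And>i. i \<le> j \<Longrightarrow> \<not> al_acg_stop D s i"
  shows "curvature_at (al_psis D s) (- \<mu>) L Z (acg.xt j)"
  using assms curvature_psis valid unfolding valid_state_def al_acg_def by blast

lemma inner_terminates:
  shows "al_acg_stop D s (al_inner D s)" and "acg.acg_inv (acg.st (al_inner D s))"
    and "0 < acgA (acg.st (al_inner D s))"
    and "real (al_inner D s) \<le> 2 + 2 * sqrt (L / \<mu>) * ln (8 * L\<^sup>2 / \<theta>\<^sup>2)"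
proof -
  have S: "al_acg_stop D s = acg3_stop (al_psis D s) (al_psin D) zc \<mu> L (\<theta>\<^sup>2 / L)"
    unfolding al_acg_stop_def ..
  note * = acg.acg_terminates[OF sigma_bounds L_ge extrapolation_curvature[unfolded S], folded S al_inner_def]
  show "al_acg_stop D s (al_inner D s)" "acg.acg_inv (acg.st (al_inner D s))"
    "0 < acgA (acg.st (al_inner D s))"
    by (rule *; assumption)+
  have "8 * L / (\<theta>\<^sup>2 / L) = 8 * L\<^sup>2 / \<theta>\<^sup>2" by (simp add: power2_eq_square)
  moreover have "real (al_inner D s) \<le> 2 + 2 * sqrt (L / \<mu>) * ln (8 * L / (\<theta>\<^sup>2 / L))"
    by (rule *(4))
  ultimately show "real (al_inner D s) \<le> 2 + 2 * sqrt (L / \<mu>) * ln (8 * L\<^sup>2 / \<theta>\<^sup>2)" by (simp only:)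
qed

lemma z_in: "z \<in> Z"
  using acg.acg_certificate(1)[OF inner_terminates(2,3)] unfolding al_z_def al_acg_def .

text \<open>The ACG residual \<open>v\<close> refers to a prox term centred at \<open>zc\<close>.
  Recentring that term at \<open>z\<close> moves \<open>zc - z\<close> into the residual, so
  \<open>r = zc - z + v\<close> and the second condition is the stopping test.\<close>

definition approx_solution :: "'a \<Rightarrow> real \<Rightarrow> bool" where
  "approx_solution r \<epsilon> \<longleftrightarrow> 0 \<le> \<epsilon> \<and> (norm (r - (zc - z)))\<^sup>2 + 2 * \<epsilon> \<le> \<theta>\<^sup>2 / L * (norm r)\<^sup>2 \<and>
     (\<forall>u\<in>Z. lam * (F c p z + H z) + r \<bullet> (u - z) - \<epsilon> \<le> lam * (F c p u + H u) + (norm (u - z))\<^sup>2 / 2)"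

lemma approx_solution_exists: "\<exists>r \<epsilon>. approx_solution r \<epsilon>"
proof -
  let ?k = "al_inner D s"
  define v where "v = acg.resid ?k"
  define \<epsilon> where "\<epsilon> = acg.gap ?k"
  note C = acg.acg_certificate[OF inner_terminates(2,3), folded v_def \<epsilon>_def]
  have zk: "acgy (acg.st ?k) = z" unfolding al_z_def al_acg_def ..
  have cert: "lam * F c p z + 1 / 2 * (norm (z - zc))\<^sup>2 + lam * H z + v \<bullet> (u - z) - \<epsilon>
     \<le> lam * F c p u + 1 / 2 * (norm (u - zc))\<^sup>2 + lam * H u" if "u \<in> Z" for u
  proof -
    have "al_psis D s z + lam * H z + v \<bullet> (u - z) - \<epsilon> \<le> al_psis D s u + lam * H u"
      using C(2)[OF that] by (simp only: zk)
    then show ?thesis by (simp only: psis_eq)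
  qed
  have stop: "(norm v)\<^sup>2 + 2 * \<epsilon> \<le> \<theta>\<^sup>2 / L * (norm (zc - z + v))\<^sup>2"
    using inner_terminates(1) C(4)[of "\<theta>\<^sup>2 / L"] unfolding al_acg_stop_def zk by blast
  have "approx_solution (zc - z + v) \<epsilon>"
    unfolding approx_solution_def
  proof (intro conjI ballI)
    show "0 \<le> \<epsilon>" using cert[OF z_in] by simp
    show "(norm (zc - z + v - (zc - z)))\<^sup>2 + 2 * \<epsilon> \<le> \<theta>\<^sup>2 / L * (norm (zc - z + v))\<^sup>2"
      using stop by simp
    fix u assume u: "u \<in> Z"
    have sq: "(norm (u - zc))\<^sup>2 = (norm (u - z))\<^sup>2 - 2 * ((zc - z) \<bullet> (u - z)) + (norm (z - zc))\<^sup>2"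
      using norm_diff_sq[of "u - z" "zc - z"] by (simp add: inner_commute norm_minus_commute)
    show "lam * (F c p z + H z) + (zc - z + v) \<bullet> (u - z) - \<epsilon> \<le> lam * (F c p u + H u) + (norm (u - z))\<^sup>2 / 2"
      using cert[OF u] unfolding sq inner_add_left[of "zc - z"] by (simp add: algebra_simps)
  qed
  then show ?thesis by blast
qed

context
  fixes r \<epsilon>
  assumes sol: "approx_solution r \<epsilon>"
begin

lemma eps_nonneg: "0 \<le> \<epsilon>"
  and resid_bound: "(norm (r - (zc - z)))\<^sup>2 + 2 * \<epsilon> \<le> \<theta>\<^sup>2 / L * (norm r)\<^sup>2"
  and approx_min: "\<And>u. u \<in> Z \<Longrightarrow>
    lam * (F c p z + H z) + r \<bullet> (u - z) - \<epsilon> \<le> lam * (F c p u + H u) + (norm (u - z))\<^sup>2 / 2"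
  using sol unfolding approx_solution_def by blast+

lemma eps_le: "2 * L * \<epsilon> \<le> \<theta>\<^sup>2 * (norm r)\<^sup>2"
proof -
  have "2 * \<epsilon> \<le> \<theta>\<^sup>2 / L * (norm r)\<^sup>2"
    using resid_bound zero_le_power2[of "norm (r - (zc - z))"] by linarith
  then have "L * (2 * \<epsilon>) \<le> L * (\<theta>\<^sup>2 / L * (norm r)\<^sup>2)" using L_ge by (intro mult_left_mono) auto
  moreover have "L * (\<theta>\<^sup>2 / L * (norm r)\<^sup>2) = \<theta>\<^sup>2 * (norm r)\<^sup>2" using L_ge by simp
  ultimately show ?thesis by (simp only: mult.assoc mult.left_commute[of 2 L])
qed

lemma sigma_resid_le: "\<theta>\<^sup>2 / L * (norm r)\<^sup>2 \<le> \<theta>\<^sup>2 * (norm r)\<^sup>2"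
proof -
  have "\<theta>\<^sup>2 / L \<le> \<theta>\<^sup>2 / 1" using L_ge by (intro divide_left_mono) auto
  then show ?thesis by (intro mult_right_mono) auto
qed

lemma resid_norm_le: "norm r \<le> diameter Z / (1 - \<theta>)"
proof -
  have "(norm (r - (zc - z)))\<^sup>2 \<le> (\<theta> * norm r)\<^sup>2"
    using resid_bound sigma_resid_le eps_nonneg by (simp add: power_mult_distrib)
  then have "norm (r - (zc - z)) \<le> \<theta> * norm r"
    by (rule power2_le_imp_le) (use th_pos in simp)
  moreover have "norm r \<le> norm (r - (zc - z)) + norm (zc - z)" 
    using norm_triangle_sub[of r "zc - z"] by linarith
  moreover have "norm (zc - z) \<le> diameter Z" by (rule diam_bound[OF zc_in z_in])
  ultimately have "norm r - \<theta> * norm r \<le> diameter Z" by linarith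
  then have "norm r * (1 - \<theta>) \<le> diameter Z" by (simp only: right_diff_distrib mult_1_right mult.commute)
  then show ?thesis using th_less by (simp only: pos_le_divide_eq diff_gt_0_iff_gt)
qed

text \<open>Testing approximate minimality at the previous iterate \<open>zc\<close> and completing
  the square leaves \<open>(norm r)\<^sup>2\<close> minus the relative error, which the stopping
  test bounds by \<open>\<theta>\<^sup>2 * (norm r)\<^sup>2\<close>.\<close>

lemma descent: "(1 - \<theta>\<^sup>2) / (2 * lam) * (norm r)\<^sup>2 \<le> (F c p zc + H zc) - (F c p z + H z)"
proof -
  have "(norm (r - (zc - z)))\<^sup>2 = (norm r)\<^sup>2 - 2 * (r \<bullet> (zc - z)) + (norm (zc - z))\<^sup>2"
    by (rule norm_diff_sq)
  then have "(norm r)\<^sup>2 - \<theta>\<^sup>2 * (norm r)\<^sup>2 \<le> 2 * (lam * ((F c p zc + H zc) - (F c p z + H z)))"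
    using approx_min[OF zc_in] resid_bound sigma_resid_le by (simp add: algebra_simps)
  then show ?thesis using lam_pos by (simp add: field_simps)
qed

end

section \<open>The refined point, its residuals and the output conditions\<close>

lemma zh_in: "zh \<in> Z"
  and zh_subgradient: "\<And>u. u \<in> Z \<Longrightarrow>
    H zh + (al_Lbar D s *\<^sub>R (z - zh) - grad (F c p) z) \<bullet> (u - zh) \<le> H u"
proof -
  let ?Q = "\<lambda>u. linz (F c p) z u + H u + al_Lbar D s / 2 * (norm (u - z))\<^sup>2"
  let ?F = "\<lambda>u. ereal (linz (F c p) z u) + h u + ereal (al_Lbar D s / 2 * (norm (u - z))\<^sup>2)"
  have cont: "continuous_on Z ?Q" unfolding linz_def by (intro continuous_intros continuous_H)
  have zh: "zh = argmin ?F" unfolding al_zhat_def F_eq ..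
  have in_Z: "?F u = ereal (?Q u)" if "u \<in> Z" for u using h_in[OF that] by (metis plus_ereal.simps(1))
  have off: "?F u = \<infinity>" if "u \<notin> Z" for u using h_off[OF that] by simp
  have A: "zh \<in> Z" "\<And>u. u \<in> Z \<Longrightarrow> ?Q zh \<le> ?Q u"
    unfolding zh by (rule argmin_extended[OF compact_Z Z_nonempty cont in_Z off]; assumption)+
  show zhZ: "zh \<in> Z" by (rule A(1))
  show "H zh + (al_Lbar D s *\<^sub>R (z - zh) - grad (F c p) z) \<bullet> (u - zh) \<le> H u" if u: "u \<in> Z" for u
  proof (rule prox_optimality[OF convex_Z convex_H zhZ u])
    fix w assume "w \<in> Z"
    from A(2)[OF this] show "H zh + grad (F c p) z \<bullet> (zh - z) + al_Lbar D s / 2 * (norm (zh - z))\<^sup>2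
      \<le> H w + grad (F c p) z \<bullet> (w - z) + al_Lbar D s / 2 * (norm (w - z))\<^sup>2"
      unfolding linz_def by linarith
  qed
qed

lemma lam_Lbar: "lam * al_Lbar D s = L"
  unfolding al_Lbar_def using lam_pos by simp

lemma Lbar_pos: "0 < al_Lbar D s"
  unfolding al_Lbar_def using lam_pos L_ge by simp

text \<open>A gradient step from \<open>z\<close> lowers the objective in proportion to its squared
  length, while approximate minimality of \<open>z\<close> limits any decrease. For
  \<open>x = L * norm d\<close> this reads \<open>x\<^sup>2 \<le> 2 * norm r * x + \<theta>\<^sup>2
  * (norm r)\<^sup>2\<close>, and absorbing half of \<open>x\<^sup>2\<close> gives
  \<open>4 + 2 * \<theta>\<^sup>2\<close>.\<close>

lemma refinement_step:
  assumes sol: "approx_solution r \<epsilon>"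
  shows "(L * norm (z - zh))\<^sup>2 \<le> (4 + 2 * \<theta>\<^sup>2) * (norm r)\<^sup>2"
proof -
  define d where "d = z - zh"
  define b where "b = grad (F c p) z"
  have "H zh + al_Lbar D s * (norm d)\<^sup>2 - b \<bullet> d \<le> H z"
    using zh_subgradient[OF z_in] unfolding d_def[symmetric] b_def[symmetric]
    by (simp add: inner_diff_left power2_norm_eq_inner)
  moreover have "F c p zh \<le> F c p z - b \<bullet> d + Lt c p / 2 * (norm d)\<^sup>2"
    using auglag_upper[OF c_pos zh_in z_in, of p] unfolding linz_def b_def[symmetric] d_def
    by (simp add: norm_minus_commute inner_diff_right)
  ultimately have "F c p zh + H zh + al_Lbar D s * (norm d)\<^sup>2 \<le> F c p z + H z + Lt c p / 2 * (norm d)\<^sup>2"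
    by linarith
  then have "lam * (F c p zh + H zh + al_Lbar D s * (norm d)\<^sup>2) \<le> lam * (F c p z + H z + Lt c p / 2 * (norm d)\<^sup>2)"
    using lam_pos by simp
  moreover have "lam * (F c p zh + H zh + al_Lbar D s * (norm d)\<^sup>2)
      = lam * (F c p zh + H zh) + L * (norm d)\<^sup>2"
    unfolding lam_Lbar[symmetric] by (simp add: algebra_simps)
  moreover have "lam * (F c p z + H z + Lt c p / 2 * (norm d)\<^sup>2)
      = lam * (F c p z + H z) + (L * (norm d)\<^sup>2 - (norm d)\<^sup>2) / 2"
    unfolding L_eq by (simp add: algebra_simps)
  moreover have "lam * (F c p z + H z) + r \<bullet> (zh - z) - \<epsilon> \<le> lam * (F c p zh + H zh) + (norm (zh - z))\<^sup>2 / 2"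
    by (rule approx_min[OF sol zh_in])
  moreover have "norm (zh - z) = norm d" "r \<bullet> (zh - z) = - (r \<bullet> d)"
    unfolding d_def by (auto simp: norm_minus_commute inner_diff_right)
  ultimately have "L * (norm d)\<^sup>2 \<le> 2 * (r \<bullet> d) + 2 * \<epsilon>" by (simp only:) argo
  moreover have "r \<bullet> d \<le> norm r * norm d" by (rule norm_cauchy_schwarz)
  ultimately have "L * (norm d)\<^sup>2 \<le> 2 * (norm r * norm d) + 2 * \<epsilon>" by linarith
  then have "L * (L * (norm d)\<^sup>2) \<le> L * (2 * (norm r * norm d) + 2 * \<epsilon>)"
    using L_ge by (intro mult_left_mono) auto
  then have "(L * norm d)\<^sup>2 \<le> 2 * (norm r * (L * norm d)) + \<theta>\<^sup>2 * (norm r)\<^sup>2"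
    using eps_le[OF sol] by (simp add: power2_eq_square algebra_simps)
  moreover have "0 \<le> (L * norm d - 2 * norm r)\<^sup>2" by simp
  then have "4 * (norm r * (L * norm d)) \<le> (L * norm d)\<^sup>2 + 4 * (norm r)\<^sup>2"
    by (simp add: power2_eq_square algebra_simps)
  ultimately have "(L * norm d)\<^sup>2 \<le> 4 * (norm r)\<^sup>2 + 2 * (\<theta>\<^sup>2 * (norm r)\<^sup>2)" by linarith
  then show ?thesis unfolding d_def by (simp add: algebra_simps)
qed

lemma refinement_step_le:
  assumes sol: "approx_solution r \<epsilon>"
  shows "L * norm (z - zh) \<le> 3 * norm r"
proof (rule power2_le_imp_le)
  have "(L * norm (z - zh))\<^sup>2 \<le> (4 + 2 * \<theta>\<^sup>2) * (norm r)\<^sup>2" by (rule refinement_step[OF sol])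
  also have "\<dots> \<le> 9 * (norm r)\<^sup>2" using th_sq by (intro mult_right_mono) auto
  finally show "(L * norm (z - zh))\<^sup>2 \<le> (3 * norm r)\<^sup>2" by (simp add: power_mult_distrib)
qed simp

text \<open>After scaling by \<open>lam\<close>, the step and the gradient difference each cost at
  most \<open>L * norm (z - zh)\<close>; squaring their sum multiplies the constant of
  \<open>refinement_step\<close> by 4.\<close>

lemma vhat_bound:
  assumes sol: "approx_solution r \<epsilon>"
  shows "(lam * norm (al_vhat D s))\<^sup>2 \<le> (16 + 8 * \<theta>) * (norm r)\<^sup>2"
proof -
  have "norm (al_vhat D s) \<le> norm (al_Lbar D s *\<^sub>R (z - zh)) + norm (grad (F c p) zh - grad (F c p) z)"
    unfolding al_vhat_def F_eq
    using norm_triangle_ineq[of "al_Lbar D s *\<^sub>R (z - zh)" "grad (F c p) zh - grad (F c p) z"]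
    by (simp add: algebra_simps)
  also have "\<dots> \<le> al_Lbar D s * norm (z - zh) + Lt c p * norm (z - zh)"
    using grad_auglag_lipschitz[OF c_pos zh_in z_in, of p] Lbar_pos by (simp add: norm_minus_commute)
  finally have "lam * norm (al_vhat D s) \<le> lam * (al_Lbar D s * norm (z - zh) + Lt c p * norm (z - zh))"
    using lam_pos by simp
  also have "\<dots> = L * norm (z - zh) + (L - 1) * norm (z - zh)"
    unfolding L_eq lam_Lbar[symmetric, unfolded L_eq] distrib_left
    by (simp add: lam_Lbar[unfolded L_eq] flip: mult.assoc)
  also have "\<dots> \<le> 2 * (L * norm (z - zh))" by (simp add: algebra_simps)
  finally have "(lam * norm (al_vhat D s))\<^sup>2 \<le> (2 * (L * norm (z - zh)))\<^sup>2"
    using lam_pos by (intro power_mono) auto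
  also have "\<dots> = 4 * (L * norm (z - zh))\<^sup>2" by (simp add: power_mult_distrib)
  also have "\<dots> \<le> 4 * ((4 + 2 * \<theta>\<^sup>2) * (norm r)\<^sup>2)" using refinement_step[OF sol] by simp
  also have "\<dots> = (16 + 8 * \<theta>\<^sup>2) * (norm r)\<^sup>2" by (simp add: algebra_simps)
  also have "\<dots> \<le> (16 + 8 * \<theta>) * (norm r)\<^sup>2" using th_sq_le by (intro mult_right_mono) auto
  finally show ?thesis .
qed

text \<open>The two multipliers differ by at most \<open>c * B1 * norm (z - zh)\<close>. Since
  \<open>L\<close> dominates \<open>lam * c * B1\<^sup>2\<close>, the factor \<open>c\<close> is
  compensated by the shortness of the step.\<close>

lemma qhat_bound:
  assumes P: "norm p \<le> P" "norm (al_p D s) \<le> P"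
  shows "norm (al_qhat D s) \<le> (2 * P + 3 * (diameter Z / (1 - \<theta>)) / (lam * B1)) / c"
proof -
  obtain r \<epsilon> where sol: "approx_solution r \<epsilon>" using approx_solution_exists by blast
  have "norm (al_phat D s - al_p D s) \<le> norm ((p + c *\<^sub>R g zh) - (p + c *\<^sub>R g z))"
    unfolding al_phat_def al_p_def by (rule proj_nonexpansive)
  also have "\<dots> = c * norm (g z - g zh)"
    using c_pos by (simp add: norm_minus_commute flip: scaleR_diff_right)
  also have "\<dots> \<le> c * (B1 * norm (z - zh))" using g_lipschitz[OF z_in zh_in] c_pos by simp
  also have "\<dots> \<le> 3 * norm r / (lam * B1)"
  \<comment> \<open>For \<open>B1 = 0\<close> the left side vanishes and so does the right one, as
    division by zero yields 0.\<close>
  proof (cases "B1 = 0")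
    case False
    then have B1: "0 < B1" using B1_nonneg by simp
    have "lam * (c * B1\<^sup>2) \<le> L"
    proof -
      have "c * B1\<^sup>2 \<le> Lt c p"
        unfolding auglag_lip_def distrib_left
        using M_pos Lg_pos c_pos B0_nonneg by (simp add: add_nonneg_nonneg)
      then have "lam * (c * B1\<^sup>2) \<le> lam * Lt c p" using lam_pos by simp
      then show ?thesis unfolding L_eq by simp
    qed
    then have "lam * (c * B1\<^sup>2) * norm (z - zh) \<le> L * norm (z - zh)" by (intro mult_right_mono) auto
    also have "\<dots> \<le> 3 * norm r" by (rule refinement_step_le[OF sol])
    finally show ?thesis using B1 lam_pos by (simp add: field_simps power2_eq_square)
  qed simp
  also have "\<dots> \<le> 3 * (diameter Z / (1 - \<theta>)) / (lam * B1)"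
    using resid_norm_le[OF sol] lam_pos B1_nonneg by (intro divide_right_mono mult_left_mono) auto
  finally have d: "norm (al_phat D s - al_p D s) \<le> 3 * (diameter Z / (1 - \<theta>)) / (lam * B1)" .
  have "norm (p - al_phat D s) \<le> norm p + norm (al_p D s) + norm (al_phat D s - al_p D s)"
    using norm_triangle_ineq4[of p "al_phat D s"] norm_triangle_sub[of "al_phat D s" "al_p D s"] by linarith
  also have "\<dots> \<le> 2 * P + 3 * (diameter Z / (1 - \<theta>)) / (lam * B1)" using d P by linarith
  finally have "norm (p - al_phat D s) / c \<le> (2 * P + 3 * (diameter Z / (1 - \<theta>)) / (lam * B1)) / c"
    using c_pos by (intro divide_right_mono) auto
  then show ?thesis unfolding al_qhat_def using c_pos by simp
qed

text \<open>These hold in every iteration; stopping adds only the two norm bounds. The multiplier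
  \<open>al_phat\<close> and \<open>c\<close> times \<open>g zh + al_qhat D s\<close> are the two
  parts of the Moreau decomposition of \<open>p + c *\<^sub>R g zh\<close>.\<close>

lemma output_conditions:
  shows "al_vhat D s \<in> (\<lambda>w. grad f zh + w + nabla g zh (al_phat D s)) ` subdiff h zh"
    and "(g zh + al_qhat D s) \<bullet> al_phat D s = 0"
    and "cone_le (al_K D) (g zh + al_qhat D s) 0"
    and "al_phat D s \<in> dual_cone (al_K D)"
proof -
  define w where "w = al_Lbar D s *\<^sub>R (z - zh) - grad (F c p) z"
  have "w \<in> subdiff h zh"
    unfolding subdiff_def
  proof (intro CollectI conjI allI)
    show "\<bar>h zh\<bar> \<noteq> \<infinity>" using h_in[OF zh_in] by (metis abs_ereal.simps(1) PInfty_neq_ereal(1))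
    fix u
    show "h zh + ereal (w \<bullet> (u - zh)) \<le> h u"
    proof (cases "u \<in> Z")
      case True
      have "ereal (H zh) + ereal (w \<bullet> (u - zh)) \<le> ereal (H u)"
        using zh_subgradient[OF True] unfolding w_def by simp
      then show ?thesis using h_in[OF True] h_in[OF zh_in] by metis
    qed (simp add: h_off)
  qed
  moreover have "al_vhat D s = grad f zh + w + nabla g zh (al_phat D s)"
    unfolding al_vhat_def w_def F_eq grad_auglag[OF c_pos zh_in] al_phat_def by (simp add: algebra_simps)
  ultimately show "al_vhat D s \<in> (\<lambda>w. grad f zh + w + nabla g zh (al_phat D s)) ` subdiff h zh" by blast
  define x where "x = p + c *\<^sub>R g zh"
  have ph: "al_phat D s = proj x" unfolding al_phat_def x_def ..
  have gq: "g zh + al_qhat D s = (1 / c) *\<^sub>R (x - proj x)"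
    unfolding al_qhat_def ph x_def using c_pos by (simp add: algebra_simps)
  show "(g zh + al_qhat D s) \<bullet> al_phat D s = 0" unfolding gq ph using proj_orthogonal by simp
  show "al_phat D s \<in> dual_cone (al_K D)" unfolding ph by (rule proj_in)
  have "(1 / c) *\<^sub>R (proj x - x) \<in> al_K D"
    using convex_cone_scaleR[OF cone _ proj_residual_in] c_pos by simp
  then show "cone_le (al_K D) (g zh + al_qhat D s) 0"
    unfolding cone_le_def gq by (simp add: algebra_simps)
qed

text \<open>Moving from \<open>z\<close> towards \<open>w\<close> by the fraction \<open>1/L\<close> balances the error \<open>\<epsilon>\<close>, which is of
  order \<open>1/L\<close>, against the curvature \<open>L\<close>; the bound is therefore uniform in the penalty.\<close>
lemma directional_bound:
  assumes w: "w \<in> Z"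
    and Gf: "\<And>z. z \<in> Z \<Longrightarrow> norm (grad f z) \<le> Gf" and Hb: "\<And>z. z \<in> Z \<Longrightarrow> \<bar>H z\<bar> \<le> Hb"
  defines "R \<equiv> diameter Z / (1 - \<theta>)"
  shows "- ((R * diameter Z + R\<^sup>2 / 2 + (diameter Z)\<^sup>2 / 2) / lam + Gf * diameter Z + 2 * Hb)
    \<le> nabla g z (al_p D s) \<bullet> (w - z)"
proof -
  obtain r \<epsilon> where sol: "approx_solution r \<epsilon>" using approx_solution_exists by blast
  define t where "t = 1 / L"
  have t: "0 < t" "t \<le> 1" "L * t = 1" unfolding t_def using L_ge by auto
  define d where "d = w - z"
  define u where "u = (1 - t) *\<^sub>R z + t *\<^sub>R w"
  define b where "b = grad (F c p) z"
  have u: "u \<in> Z" unfolding u_def using convexD_alt[OF convex_Z z_in w] t by simp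
  have uz: "u - z = t *\<^sub>R d" unfolding u_def d_def by (simp add: algebra_simps)
  have dn: "norm d \<le> diameter Z" unfolding d_def by (rule diam_bound[OF w z_in])
  have rn: "norm r \<le> R" unfolding R_def by (rule resid_norm_le[OF sol])
  have D0: "0 \<le> diameter Z" using dn norm_ge_zero order_trans by blast
  have "H u \<le> (1 - t) * H z + t * H w"
    unfolding u_def using convex_onD[OF convex_H, of t z w] t z_in w by simp
  moreover have "F c p u \<le> F c p z + t * (b \<bullet> d) + Lt c p / 2 * (t\<^sup>2 * (norm d)\<^sup>2)"
    using auglag_upper[OF c_pos u z_in, of p] unfolding linz_def b_def[symmetric] uz
    by (simp add: power_mult_distrib)
  ultimately have "F c p u + H u \<le> (F c p z + H z) + t * (b \<bullet> d + H w - H z) + Lt c p / 2 * (t\<^sup>2 * (norm d)\<^sup>2)"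
    by (simp add: algebra_simps)
  then have "lam * (F c p u + H u) \<le> lam * ((F c p z + H z) + t * (b \<bullet> d + H w - H z) + Lt c p / 2 * (t\<^sup>2 * (norm d)\<^sup>2))"
    using lam_pos by simp
  also have "\<dots> = lam * (F c p z + H z) + t * (lam * (b \<bullet> d + H w - H z)) + (L - 1) / 2 * (t\<^sup>2 * (norm d)\<^sup>2)"
    unfolding L_eq by (simp add: algebra_simps)
  finally have "t * (r \<bullet> d) - \<epsilon> \<le> t * (lam * (b \<bullet> d + H w - H z)) + L / 2 * (t\<^sup>2 * (norm d)\<^sup>2)"
    using approx_min[OF sol u] unfolding uz by (simp add: power_mult_distrib diff_divide_distrib left_diff_distrib)
  then have "L * (t * (r \<bullet> d) - \<epsilon>) \<le> L * (t * (lam * (b \<bullet> d + H w - H z)) + L / 2 * (t\<^sup>2 * (norm d)\<^sup>2))"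
    using L_ge by (intro mult_left_mono) auto
  moreover have "L * (t * (r \<bullet> d) - \<epsilon>) = (L * t) * (r \<bullet> d) - L * \<epsilon>" by (simp add: algebra_simps)
  moreover have "L * (t * (lam * (b \<bullet> d + H w - H z)) + L / 2 * (t\<^sup>2 * (norm d)\<^sup>2))
     = (L * t) * (lam * (b \<bullet> d + H w - H z)) + (L * t) * (L * t) * (norm d)\<^sup>2 / 2"
    by (simp add: algebra_simps power2_eq_square)
  ultimately have main: "r \<bullet> d - L * \<epsilon> \<le> lam * (b \<bullet> d + H w - H z) + (norm d)\<^sup>2 / 2"
    unfolding t(3) by simp
  have "- (r \<bullet> d) \<le> norm r * norm d" using norm_cauchy_schwarz[of "- r" d] by simp
  also have "\<dots> \<le> R * diameter Z" using rn dn order_trans[OF norm_ge_zero rn] by (intro mult_mono) auto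
  finally have e1: "- (R * diameter Z) \<le> r \<bullet> d" by simp
  have "\<theta>\<^sup>2 * (norm r)\<^sup>2 \<le> 1 * R\<^sup>2"
    using th_sq rn by (intro mult_mono power_mono) auto
  then have e2: "L * \<epsilon> \<le> R\<^sup>2 / 2" using eps_le[OF sol] by simp
  have e3: "(norm d)\<^sup>2 \<le> (diameter Z)\<^sup>2" using dn by (intro power_mono) auto
  define E where "E = R * diameter Z + R\<^sup>2 / 2 + (diameter Z)\<^sup>2 / 2"
  have "- E \<le> lam * (b \<bullet> d + H w - H z)" using main e1 e2 e3 unfolding E_def by linarith
  then have "- (E / lam) \<le> b \<bullet> d + H w - H z" using lam_pos by (simp add: field_simps)
  moreover have "b \<bullet> d = grad f z \<bullet> d + nabla g z (al_p D s) \<bullet> d"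
    unfolding b_def grad_auglag[OF c_pos z_in] al_p_def by (simp add: inner_add_left)
  moreover have "grad f z \<bullet> d \<le> Gf * diameter Z"
  proof -
    have "grad f z \<bullet> d \<le> norm (grad f z) * norm d" by (rule norm_cauchy_schwarz)
    also have "\<dots> \<le> Gf * diameter Z"
      using Gf[OF z_in] dn order_trans[OF norm_ge_zero Gf[OF z_in]] by (intro mult_mono) auto
    finally show ?thesis .
  qed
  moreover have "H w - H z \<le> 2 * Hb" using Hb[OF w] Hb[OF z_in] by linarith
  ultimately show ?thesis unfolding E_def[symmetric] d_def[symmetric] by linarith
qed

text \<open>The first-order inequality, tested near the Slater point, bounds
  \<open>\<delta> * norm n + a + g z \<bullet> q\<close>. The Slater condition converts the first
  two terms into a multiple of \<open>norm q\<close>; the third is nonnegative whenever the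
  multiplier has grown.\<close>

lemma multiplier_bound:
  assumes C: "\<And>w. w \<in> Z \<Longrightarrow> - C \<le> nabla g z (al_p D s) \<bullet> (w - z)"
    and \<delta>: "0 < \<delta>" "cball zbar \<delta> \<subseteq> Z"
  shows "norm (al_p D s) \<le> max (norm p) (C / (min 1 \<delta> * \<tau>))"
proof -
  define q where "q = al_p D s"
  define n where "n = nabla g z q"
  define a where "a = \<bar>g zbar \<bullet> q\<bar>"
  have q: "q = proj (p + c *\<^sub>R g z)" unfolding q_def al_p_def ..
  have qK: "q \<in> dual_cone (al_K D)" unfolding q by (rule proj_in)
  \<comment> \<open>The point of the ball that makes the pairing with \<open>n\<close> smallest. If
    \<open>n = 0\<close>, division by zero makes it \<open>zbar\<close>, which serves as
    well.\<close>
  define w where "w = zbar - (\<delta> / norm n) *\<^sub>R n"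
  have "norm ((\<delta> / norm n) *\<^sub>R n) \<le> \<delta>" using \<delta> by simp
  then have "w \<in> Z" using \<delta> unfolding w_def by (auto simp: subset_iff dist_norm)
  from C[OF this] have "- C \<le> n \<bullet> (zbar - z) - (\<delta> / norm n) * (n \<bullet> n)"
    unfolding w_def q_def[symmetric] n_def[symmetric] by (simp add: inner_diff_right)
  also have "(\<delta> / norm n) * (n \<bullet> n) = \<delta> * norm n"
    by (simp add: power2_eq_square flip: power2_norm_eq_inner)
  also have "n \<bullet> (zbar - z) \<le> (g zbar - g z) \<bullet> q"
    unfolding n_def by (rule cone_convex_gradient[OF qK])
  finally have 1: "\<delta> * norm n - g zbar \<bullet> q + g z \<bullet> q \<le> C" by (simp add: inner_diff_left)
  have "0 \<le> (0 - g zbar) \<bullet> q" using zbar_feas qK unfolding cone_le_def dual_cone_def by blast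
  then have 2: "- (g zbar \<bullet> q) = a" unfolding a_def by simp
  have 3: "min 1 \<delta> * \<tau> * norm q \<le> \<delta> * norm n + a"
  proof -
    have "\<tau> * norm q \<le> max (norm n) a" unfolding n_def a_def by (rule slater[OF z_in qK])
    then have "min 1 \<delta> * (\<tau> * norm q) \<le> min 1 \<delta> * max (norm n) a" using \<delta> by (intro mult_left_mono) auto
    also have "\<dots> \<le> \<delta> * norm n + a"
    proof (cases "norm n \<le> a")
      case True
      have "min 1 \<delta> * a \<le> 1 * a" unfolding a_def by (intro mult_right_mono) auto
      moreover have "0 \<le> \<delta> * norm n" using \<delta> by simp
      ultimately show ?thesis using True by (simp add: max_def)
    next
      case False
      have "min 1 \<delta> * norm n \<le> \<delta> * norm n" by (intro mult_right_mono) auto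
      moreover have "0 \<le> a" unfolding a_def by simp
      ultimately show ?thesis using False by (simp add: max_def)
    qed
    finally show ?thesis by (simp add: mult.assoc)
  qed
  have 4: "c * (g z \<bullet> q) = (norm q)\<^sup>2 - p \<bullet> q"
    using proj_inner[of "p + c *\<^sub>R g z", folded q] by (simp add: inner_add_left)
  \<comment> \<open>By \<open>4\<close>, growth of the norm forces
    \<open>g z \<bullet> q \<ge> 0\<close>; otherwise the old norm already bounds the new
    one.\<close>
  show ?thesis
  proof (cases "norm q \<le> norm p")
    case False
    have "p \<bullet> q \<le> norm p * norm q" by (rule norm_cauchy_schwarz)
    also have "\<dots> \<le> norm q * norm q" using False by (intro mult_right_mono) auto
    finally have "0 \<le> c * (g z \<bullet> q)" unfolding 4 by (simp add: power2_eq_square)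
    then have "0 \<le> g z \<bullet> q" using c_pos by (simp add: zero_le_mult_iff)
    then have "min 1 \<delta> * \<tau> * norm q \<le> C" using 1 2 3 by linarith
    moreover have "0 < min 1 \<delta> * \<tau>" using \<delta> tau_pos by simp
    ultimately have "norm q \<le> C / (min 1 \<delta> * \<tau>)" by (simp add: pos_le_divide_eq mult.commute)
    then show ?thesis unfolding q_def by simp
  qed (simp add: q_def)
qed

end

section \<open>The outer loop\<close>

context al_problem
begin

lemma objective_bounded: "\<exists>B. \<forall>z\<in>Z. \<bar>f z + H z\<bar> \<le> B"
proof -
  have "continuous_on Z f"
    using f_diff has_derivative_continuous unfolding gderiv_def
    by (blast intro: continuous_at_imp_continuous_on)
  then have "bounded ((\<lambda>z. f z + H z) ` Z)"
    by (intro compact_imp_bounded compact_continuous_image continuous_intros continuous_H compact_Z)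
  then show ?thesis unfolding bounded_iff by auto
qed

text \<open>Quantifying over all valid states lets \<open>P\<close> be chosen before the penalty and
  the tolerances. It is invariant because a step either does not raise the norm or lands below the
  Slater bound.\<close>

lemma multipliers_bounded:
  "\<exists>P. norm (al_p0 D) \<le> P \<and> (\<forall>s. valid_state s \<longrightarrow> norm (al_pcur s) \<le> P \<longrightarrow> norm (al_p D s) \<le> P)"
proof -
  have "bounded (grad f ` Z)"
    by (intro compact_imp_bounded compact_continuous_image grad_f_continuous compact_Z)
  then obtain Gf where Gf: "\<And>z. z \<in> Z \<Longrightarrow> norm (grad f z) \<le> Gf" unfolding bounded_iff by auto
  have "bounded (H ` Z)"
    by (intro compact_imp_bounded compact_continuous_image continuous_H compact_Z)
  then obtain Hb where Hb: "\<And>z. z \<in> Z \<Longrightarrow> \<bar>H z\<bar> \<le> Hb" unfolding bounded_iff by auto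
  obtain \<delta> where \<delta>: "0 < \<delta>" "cball zbar \<delta> \<subseteq> Z" using zbar_int unfolding mem_interior_cball by blast
  define R where "R = diameter Z / (1 - \<theta>)"
  define C where "C = (R * diameter Z + R\<^sup>2 / 2 + (diameter Z)\<^sup>2 / 2) / lam + Gf * diameter Z + 2 * Hb"
  define P where "P = max (norm (al_p0 D)) (C / (min 1 \<delta> * \<tau>))"
  have "norm (al_p D s) \<le> P" if s: "valid_state s" "norm (al_pcur s) \<le> P" for s
  proof -
    interpret al_iteration D Kh \<tau> zbar s by unfold_locales (rule s)
    have "- C \<le> nabla g z (al_p D s) \<bullet> (w - z)" if "w \<in> Z" for w
      unfolding C_def R_def by (rule directional_bound[OF that Gf Hb])
    from multiplier_bound[OF this \<delta>] show ?thesis using s(2) unfolding P_def by linarith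
  qed
  moreover have "norm (al_p0 D) \<le> P" unfolding P_def by simp
  ultimately show ?thesis by blast
qed

end

locale al_outer = al_problem +
  fixes P \<Phi> \<rho> \<eta> :: real
  assumes p0_le: "norm (al_p0 D) \<le> P"
    and P_step: "\<And>s. valid_state s \<Longrightarrow> norm (al_pcur s) \<le> P \<Longrightarrow> norm (al_p D s) \<le> P"
    and Phi: "\<And>z. z \<in> Z \<Longrightarrow> \<bar>f z + H z\<bar> \<le> \<Phi>"
    and rho_pos: "0 < \<rho>" and eta_pos: "0 < \<eta>"
    and extrapolation_ok: "al_extrapolation_ok D \<rho> \<eta>"
begin

definition "thr = lam * (1 - \<theta>) * \<rho>\<^sup>2 / 36"
definition "Q = 2 * P + 3 * (diameter Z / (1 - \<theta>)) / (lam * B1)"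
text \<open>For \<open>c \<ge> cstar\<close> the multiplier update raises the augmented Lagrangian by at most
  \<open>4 P\<^sup>2 / c \<le> thr / 16\<close>, while the descent step lowers it by at least \<open>9/8 thr\<close>.\<close>
definition "cstar = 64 * P\<^sup>2 / thr + Q / \<eta>"
definition "cmax = max c1 (2 * cstar)"
text \<open>Bounds the total decrease within a cycle: the upper bound at its first iterate minus the
  lower bound at any later one.\<close>

definition "R = 2 * \<Phi> + P * B0 + 5 * P\<^sup>2 / c1"
text \<open>Maximal number of iterations in a cycle; the 2 accounts for its first and its last
  iteration.\<close>

definition "N = 2 + R / thr"
text \<open>Chosen so that \<open>al_Lpsi\<close> is at most \<open>E * c n\<close>: the part that
  does not grow with the penalty is absorbed using \<open>c1 \<le> c n\<close>.\<close>

definition "E = (lam * (M + Lg * P) + 1) / c1 + lam * (B0 * Lg + B1\<^sup>2)"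

abbreviation "s \<equiv> al_run D \<rho>"
abbreviation "c n \<equiv> st_c (s n)"
abbreviation "kh n \<equiv> st_khat (s n)"
abbreviation "zc n \<equiv> al_zcur (s n)"
abbreviation "pc n \<equiv> al_pcur (s n)"
abbreviation "\<mu> \<equiv> al_mu D"

definition "start_val n = al_lagr D (c n) (st_z (s n) (kh n + 1)) (st_p (s n) (kh n + 1))"
definition "cur_val n = al_lagr D (c n) (zc n) (pc n)"

lemma P_nonneg: "0 \<le> P"
  using order_trans[OF norm_ge_zero p0_le] .

lemma thr_pos: "0 < thr"
  unfolding thr_def using lam_pos th_less rho_pos by simp

lemma Phi_nonneg: "0 \<le> \<Phi>"
  using Phi[OF zbar_in] by linarith

lemma diameter_nonneg: "0 \<le> diameter Z"
  using diam_bound[OF zbar_in zbar_in] by simp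

lemma Q_nonneg: "0 \<le> Q"
  unfolding Q_def using P_nonneg diameter_nonneg th_less lam_pos B1_nonneg
  by (intro add_nonneg_nonneg divide_nonneg_nonneg mult_nonneg_nonneg) auto

lemma R_nonneg: "0 \<le> R"
  unfolding R_def using Phi_nonneg P_nonneg B0_nonneg c1_pos by simp

lemma N_ge: "2 \<le> N"
  unfolding N_def using R_nonneg thr_pos by simp

lemma E_pos: "0 < E"
proof -
  have "0 < lam * (M + Lg * P) + 1"
    using lam_pos M_pos Lg_pos P_nonneg by (intro add_nonneg_pos mult_nonneg_nonneg add_nonneg_nonneg) auto
  moreover have "0 \<le> lam * (B0 * Lg + B1\<^sup>2)"
    using lam_pos Lg_pos B0_nonneg by (intro mult_nonneg_nonneg add_nonneg_nonneg) auto
  ultimately show ?thesis unfolding E_def using c1_pos by (simp add: add_pos_nonneg)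
qed

section \<open>The run and its cycles\<close>

lemma st_n_run [simp]: "st_n (s n) = n"
  by (induction n) (simp_all add: al_step_def Let_def)

lemma step_z: "st_z (s (Suc n)) = (st_z (s n))(Suc n := al_z D (s n))"
  and step_p: "st_p (s (Suc n)) = (st_p (s n))(Suc n := al_p D (s n))"
  by (simp_all add: al_step_def Let_def)

lemma zc_Suc: "zc (Suc n) = al_z D (s n)" and pc_Suc: "pc (Suc n) = al_p D (s n)"
  unfolding al_zcur_def al_pcur_def step_z step_p by (simp_all del: al_run.simps)

definition new_val :: "nat \<Rightarrow> real" where
  "new_val n = al_lagr D (c n) (al_z D (s n)) (al_p D (s n))"

text \<open>Read from the state after the step: if \<open>kh n = n\<close>, the entry at
  \<open>kh n + 1\<close> is the one that this step writes.\<close>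

definition next_start :: "nat \<Rightarrow> real" where
  "next_start n = al_lagr D (c n) (st_z (s (Suc n)) (kh n + 1)) (st_p (s (Suc n)) (kh n + 1))"

text \<open>The step from \<open>n\<close> is outer iteration \<open>n + 1\<close>, so the
  denominator \<open>k - kh - 1\<close> of the test becomes \<open>n - kh n\<close>.\<close>

definition doubling :: "nat \<Rightarrow> bool" where
  "doubling n \<longleftrightarrow> kh n < n \<and> (next_start n - new_val n) / (real n - real (kh n)) \<le> thr"

lemma step_c: "c (Suc n) = (if doubling n then 2 * c n else c n)"
  and step_kh: "kh (Suc n) = (if doubling n then Suc n else kh n)"
  unfolding doubling_def next_start_def new_val_def step_z step_p thr_def
  by (simp_all add: al_step_def Let_def)

lemma next_start_old: "kh n < n \<Longrightarrow> next_start n = start_val n"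
  unfolding next_start_def start_val_def step_z step_p by simp

lemma next_start_new: "kh n = n \<Longrightarrow> next_start n = new_val n"
  unfolding next_start_def new_val_def step_z step_p by simp

lemma reached_Suc: "al_reached D \<rho> \<eta> (Suc n) \<longleftrightarrow>
    al_reached D \<rho> \<eta> n \<and> (\<exists>j. al_acg_stop D (s n) j) \<and> \<not> al_stop D \<rho> \<eta> (s n)"
  unfolding al_reached_def by (auto simp: less_Suc_eq)

lemma valid_run: "al_reached D \<rho> \<eta> n \<Longrightarrow> 0 < c n \<Longrightarrow> zc n \<in> Z \<Longrightarrow> valid_state (s n)"
  using extrapolation_ok unfolding valid_state_def al_extrapolation_ok_def Let_def by blast

lemma new_val_le:
  assumes v: "valid_state (s n)" and P: "norm (pc n) \<le> P"
  shows "new_val n \<le> al_lagr D (c n) (al_z D (s n)) (pc n) + 4 * P\<^sup>2 / c n"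
proof -
  interpret it: al_iteration D Kh \<tau> zbar "s n" by unfold_locales (rule v)
  have Pn: "norm (al_p D (s n)) \<le> P" by (rule P_step[OF v P])
  have "norm (al_p D (s n) - pc n) \<le> 2 * P"
    using norm_triangle_ineq4[of "al_p D (s n)" "pc n"] Pn P by linarith
  then have "(norm (al_p D (s n) - pc n))\<^sup>2 \<le> (2 * P)\<^sup>2" by (intro power_mono) auto
  then have "(norm (al_p D (s n) - pc n))\<^sup>2 / c n \<le> 4 * P\<^sup>2 / c n"
    using it.c_pos by (intro divide_right_mono) (auto simp: power_mult_distrib)
  moreover have "F (c n) (al_p D (s n)) (al_z D (s n))
      \<le> F (c n) (pc n) (al_z D (s n)) + (norm (al_p D (s n) - pc n))\<^sup>2 / c n"
    using auglag_multiplier_update[OF it.c_pos, of "pc n" "al_z D (s n)"] unfolding al_p_def .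
  ultimately show ?thesis
    unfolding new_val_def al_lagr_eq[OF it.z_in] by linarith
qed

lemma new_val_upper:
  assumes v: "valid_state (s n)" and P: "norm (pc n) \<le> P" and c: "c1 \<le> c n"
  shows "new_val n \<le> \<Phi> + P * B0 + 4 * P\<^sup>2 / c1"
proof -
  interpret it: al_iteration D Kh \<tau> zbar "s n" by unfold_locales (rule v)
  let ?z = "al_z D (s n)"
  have Pn: "norm (al_p D (s n)) \<le> P" by (rule P_step[OF v P])
  have "F (c n) (pc n) ?z \<le> f ?z + al_p D (s n) \<bullet> g ?z"
    unfolding al_p_def by (rule auglag_le[OF it.c_pos])
  moreover have "al_p D (s n) \<bullet> g ?z \<le> P * B0"
  proof -
    have "al_p D (s n) \<bullet> g ?z \<le> norm (al_p D (s n)) * norm (g ?z)" by (rule norm_cauchy_schwarz)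
    also have "\<dots> \<le> P * B0" using Pn g_norm_le[OF it.z_in] P_nonneg by (intro mult_mono) auto
    finally show ?thesis .
  qed
  moreover have "f ?z + H ?z \<le> \<Phi>" using Phi[OF it.z_in] by linarith
  moreover have "4 * P\<^sup>2 / c n \<le> 4 * P\<^sup>2 / c1" using c c1_pos by (intro divide_left_mono) auto
  moreover have "new_val n \<le> al_lagr D (c n) ?z (pc n) + 4 * P\<^sup>2 / c n"
    by (rule new_val_le[OF v P])
  ultimately show ?thesis unfolding al_lagr_eq[OF it.z_in] by linarith
qed

lemma new_val_lower:
  assumes v: "valid_state (s n)" and P: "norm (pc n) \<le> P" and c: "c1 \<le> c n"
  shows "- \<Phi> - P\<^sup>2 / c1 \<le> new_val n"
proof -
  interpret it: al_iteration D Kh \<tau> zbar "s n" by unfold_locales (rule v)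
  let ?z = "al_z D (s n)" and ?p = "al_p D (s n)"
  have Pn: "norm ?p \<le> P" by (rule P_step[OF v P])
  have "f ?z - (norm ?p)\<^sup>2 / (2 * c n) \<le> F (c n) ?p ?z" by (rule auglag_ge[OF it.c_pos])
  moreover have "(norm ?p)\<^sup>2 / (2 * c n) \<le> P\<^sup>2 / c1"
    using Pn c c1_pos by (intro frac_le power_mono) auto
  moreover have "- \<Phi> \<le> f ?z + H ?z" using Phi[OF it.z_in] by linarith
  ultimately show ?thesis unfolding new_val_def al_lagr_eq[OF it.z_in] by linarith
qed

text \<open>Once \<open>c \<ge> cstar\<close>, an iteration that does not stop has a small \<open>q\<close>-residual, hence a large
  \<open>v\<close>-residual, and must decrease the augmented Lagrangian by more than the doubling threshold.\<close>
lemma descent_large_penalty: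
  assumes v: "valid_state (s n)" and P: "norm (pc n) \<le> P" and c: "cstar \<le> c n"
    and nostop: "\<not> al_stop D \<rho> \<eta> (s n)"
  shows "thr < cur_val n - new_val n"
proof -
  interpret it: al_iteration D Kh \<tau> zbar "s n" by unfold_locales (rule v)
  have Pn: "norm (al_p D (s n)) \<le> P" by (rule P_step[OF v P])
  have c0: "0 < c n" by (rule it.c_pos)
  have "norm (al_qhat D (s n)) \<le> Q / c n" unfolding Q_def by (rule it.qhat_bound[OF P Pn])
  also have "\<dots> \<le> \<eta>"
  proof -
    have "0 \<le> 64 * P\<^sup>2 / thr" using thr_pos by simp
    then have "Q / \<eta> \<le> c n" using c unfolding cstar_def by linarith
    then show ?thesis using eta_pos c0 by (simp add: field_simps)
  qed
  finally have rho: "\<rho> < norm (al_vhat D (s n))" using nostop unfolding al_stop_def by simp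
  obtain r \<epsilon> where sol: "it.approx_solution r \<epsilon>" using it.approx_solution_exists by blast
  have pos: "0 < 16 + 8 * \<theta>" using th_pos by simp
  have "(lam * \<rho>)\<^sup>2 \<le> (lam * norm (al_vhat D (s n)))\<^sup>2"
    using rho rho_pos lam_pos by (intro power_mono) auto
  also have "\<dots> \<le> (16 + 8 * \<theta>) * (norm r)\<^sup>2" by (rule it.vhat_bound[OF sol])
  finally have "(lam * \<rho>)\<^sup>2 / (16 + 8 * \<theta>) \<le> (norm r)\<^sup>2" using pos by (simp add: field_simps)
  then have "(1 - \<theta>\<^sup>2) / (2 * lam) * ((lam * \<rho>)\<^sup>2 / (16 + 8 * \<theta>)) \<le> (1 - \<theta>\<^sup>2) / (2 * lam) * (norm r)\<^sup>2"
    using th_sq lam_pos by (intro mult_left_mono) auto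
  also have "\<dots> \<le> cur_val n - al_lagr D (c n) (al_z D (s n)) (pc n)"
    using it.descent[OF sol] unfolding cur_val_def al_lagr_eq[OF it.z_in] al_lagr_eq[OF it.zc_in] .
  finally have 1: "(1 - \<theta>\<^sup>2) / (2 * lam) * ((lam * \<rho>)\<^sup>2 / (16 + 8 * \<theta>))
    \<le> cur_val n - al_lagr D (c n) (al_z D (s n)) (pc n)" .
  have "(1 - \<theta>\<^sup>2) / (2 * lam) * ((lam * \<rho>)\<^sup>2 / (16 + 8 * \<theta>))
      = (1 - \<theta>\<^sup>2) * lam * \<rho>\<^sup>2 / (2 * (16 + 8 * \<theta>))"
    using lam_pos by (simp add: power2_eq_square)
  \<comment> \<open>The factor \<open>1 - \<theta>\<close> of the threshold divides
    \<open>1 - \<theta>\<^sup>2\<close>. The remaining quotient tends to \<open>9 / 8\<close> as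
    \<open>\<theta>\<close> tends to 0 and increases with \<open>\<theta>\<close>.\<close>
  also have "(1 - \<theta>\<^sup>2) * lam * \<rho>\<^sup>2 = 36 * (1 + \<theta>) * thr"
    unfolding thr_def by (simp add: power2_eq_square algebra_simps)
  also have "36 * (1 + \<theta>) * thr / (2 * (16 + 8 * \<theta>)) = (18 * (1 + \<theta>)) / (16 + 8 * \<theta>) * thr"
    using pos by (simp add: field_simps)
  finally have 2: "(1 - \<theta>\<^sup>2) / (2 * lam) * ((lam * \<rho>)\<^sup>2 / (16 + 8 * \<theta>))
      = (18 * (1 + \<theta>)) / (16 + 8 * \<theta>) * thr" .
  have "9 / 8 \<le> (18 * (1 + \<theta>)) / (16 + 8 * \<theta>)" using th_pos by (simp add: field_simps)
  then have 3: "9 / 8 * thr \<le> (18 * (1 + \<theta>)) / (16 + 8 * \<theta>) * thr"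
    using thr_pos by (intro mult_right_mono) auto
  have "64 * P\<^sup>2 / thr \<le> c n"
    using c Q_nonneg eta_pos unfolding cstar_def by (smt (verit) divide_nonneg_pos)
  then have "4 * P\<^sup>2 / c n \<le> thr / 16" using c0 thr_pos by (simp add: field_simps)
  moreover have "new_val n \<le> al_lagr D (c n) (al_z D (s n)) (pc n) + 4 * P\<^sup>2 / c n"
    by (rule new_val_le[OF v P])
  ultimately show ?thesis using 1 2 3 thr_pos by linarith
qed

text \<open>The factor \<open>1 + sqrt 2 = 1 / (sqrt 2 - 1)\<close> pays for the completed cycles, whose costs grow
  geometrically with ratio \<open>sqrt 2\<close>.\<close>
definition outer_inv :: "nat \<Rightarrow> bool" where
  "outer_inv n \<longleftrightarrow> kh n \<le> n \<and> c1 \<le> c n \<and> c n \<le> cmax \<and> zc n \<in> Z \<and> norm (pc n) \<le> P \<and>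
     (kh n < n \<longrightarrow> start_val n \<le> \<Phi> + P * B0 + 4 * P\<^sup>2 / c1 \<and>
        (cstar \<le> c n \<longrightarrow> (real n - real (kh n) - 1) * thr \<le> start_val n - cur_val n)) \<and>
     real n \<le> real (kh n) + N - 1 \<and>
     (\<Sum>i<n. sqrt (c i)) \<le> (real n - real (kh n)) * sqrt (c n) + N * (1 + sqrt 2) * (sqrt (c n) - sqrt c1)"

lemma outer_inv_run: "al_reached D \<rho> \<eta> n \<Longrightarrow> outer_inv n"
proof (induction n)
  case 0
  show ?case
    unfolding outer_inv_def using N_ge z0_in p0_le by (simp add: al_zcur_def al_pcur_def cmax_def)
next
  case (Suc n)
  have reached: "al_reached D \<rho> \<eta> n" and nostop: "\<not> al_stop D \<rho> \<eta> (s n)"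
    using Suc.prems unfolding reached_Suc by auto
  from Suc.IH[OF reached] have inv: "kh n \<le> n" "c1 \<le> c n" "c n \<le> cmax" "zc n \<in> Z" "norm (pc n) \<le> P"
    "kh n < n \<Longrightarrow> start_val n \<le> \<Phi> + P * B0 + 4 * P\<^sup>2 / c1"
    "kh n < n \<Longrightarrow> cstar \<le> c n \<Longrightarrow> (real n - real (kh n) - 1) * thr \<le> start_val n - cur_val n"
    "real n \<le> real (kh n) + N - 1"
    "(\<Sum>i<n. sqrt (c i)) \<le> (real n - real (kh n)) * sqrt (c n) + N * (1 + sqrt 2) * (sqrt (c n) - sqrt c1)"
    unfolding outer_inv_def by auto
  have c0: "0 < c n" using inv(2) c1_pos by linarith
  have v: "valid_state (s n)" by (rule valid_run[OF reached c0 inv(4)])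
  interpret it: al_iteration D Kh \<tau> zbar "s n" by unfold_locales (rule v)
  have Pn: "norm (al_p D (s n)) \<le> P" by (rule P_step[OF v inv(5)])
  have next_upper: "next_start n \<le> \<Phi> + P * B0 + 4 * P\<^sup>2 / c1"
  proof (cases "kh n < n")
    case True
    then show ?thesis using inv(6) next_start_old by simp
  next
    case False
    then show ?thesis using inv(1) new_val_upper[OF v inv(5,2)] next_start_new by simp
  qed
  have diff_le: "next_start n - new_val n \<le> R"
    using next_upper new_val_lower[OF v inv(5,2)] unfolding R_def by (simp add: field_simps)
  show ?case
  proof (cases "doubling n")
    case True
    then have kn: "kh n < n" and \<Delta>: "(next_start n - new_val n) / (real n - real (kh n)) \<le> thr"
      unfolding doubling_def by auto
    \<comment> \<open>Above \<open>cstar\<close> every one of the \<open>n - kh n\<close> decreases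
      since the cycle start exceeds \<open>thr\<close>, so their average could not pass the test.
      Hence doubling never takes the penalty beyond \<open>cmax\<close>.\<close>
    have small: "c n < cstar"
    proof (rule ccontr)
      assume "\<not> c n < cstar"
      then have c: "cstar \<le> c n" by simp
      have "(real n - real (kh n) - 1) * thr + thr < start_val n - new_val n"
        using inv(7)[OF kn c] descent_large_penalty[OF v inv(5) c nostop] by linarith
      then have "(real n - real (kh n)) * thr < next_start n - new_val n"
        unfolding next_start_old[OF kn] by (simp add: algebra_simps)
      then have "thr < (next_start n - new_val n) / (real n - real (kh n))"
        using kn by (simp add: pos_less_divide_eq mult.commute)
      then show False using \<Delta> by simp
    qed
    have c': "c (Suc n) = 2 * c n" and kh': "kh (Suc n) = Suc n" using True step_c step_kh by auto
    have "(\<Sum>i<Suc n. sqrt (c i)) \<le> (real n - real (kh n) + 1) * sqrt (c n)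
        + N * (1 + sqrt 2) * (sqrt (c n) - sqrt c1)"
      using inv(9) by (simp add: algebra_simps)
    also have "(real n - real (kh n) + 1) * sqrt (c n) \<le> N * sqrt (c n)"
      using inv(8) c0 by (intro mult_right_mono) auto
    \<comment> \<open>The closed cycle is paid for by the growth of \<open>sqrt c\<close>, because
      \<open>(1 + sqrt 2) * (sqrt 2 - 1) = 1\<close>.\<close>
    also have "N * sqrt (c n) + N * (1 + sqrt 2) * (sqrt (c n) - sqrt c1)
        = N * (1 + sqrt 2) * (sqrt (c (Suc n)) - sqrt c1)"
    proof -
      have "(1 + sqrt 2) * (sqrt 2 * y - x) = y + (1 + sqrt 2) * (y - x)" for x y :: real
        by (simp add: algebra_simps flip: power2_eq_square mult.assoc)
      from arg_cong[OF this, of "(*) N" "sqrt (c n)" "sqrt c1"]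
      show ?thesis unfolding c' real_sqrt_mult by (simp add: algebra_simps)
    qed
    finally have "(\<Sum>i<Suc n. sqrt (c i)) \<le> N * (1 + sqrt 2) * (sqrt (c (Suc n)) - sqrt c1)" by simp
    moreover have "2 * c n \<le> cmax" using small unfolding cmax_def by linarith
    moreover have "c1 \<le> 2 * c n" using inv(2) c0 by linarith
    ultimately show ?thesis
      unfolding outer_inv_def zc_Suc pc_Suc kh'
      using c' N_ge it.z_in Pn by (simp del: al_run.simps sum.lessThan_Suc)
  next
    case False
    have c': "c (Suc n) = c n" and kh': "kh (Suc n) = kh n" using False step_c step_kh by auto
    have start: "start_val (Suc n) = next_start n"
      unfolding start_val_def next_start_def c' kh' ..
    have cur: "cur_val (Suc n) = new_val n"
      unfolding cur_val_def new_val_def zc_Suc pc_Suc c' ..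
    \<comment> \<open>A cycle that stays open has average decrease above \<open>thr\<close> and
      total decrease at most \<open>R\<close>. This limits its length at every size of the penalty,
      below \<open>cstar\<close> too.\<close>
    have len: "real (Suc n) \<le> real (kh n) + N - 1"
    proof (cases "kh n < n")
      case True
      have n0: "0 < real n - real (kh n)" using True by simp
      have "thr < (next_start n - new_val n) / (real n - real (kh n))"
        using False True unfolding doubling_def by simp
      then have "(real n - real (kh n)) * thr < next_start n - new_val n"
        using n0 by (simp add: pos_less_divide_eq mult.commute)
      then have "(real n - real (kh n)) * thr \<le> R" using diff_le by linarith
      then have "real n - real (kh n) \<le> R / thr" using thr_pos by (simp add: pos_le_divide_eq)
      then show ?thesis unfolding N_def by simp
    next
      case False
      then show ?thesis using inv(1) N_ge by simp
    qed
    \<comment> \<open>For \<open>kh n = n\<close> the new point is itself the start of the cycle,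
      and both sides vanish.\<close>
    have descent: "(real (Suc n) - real (kh n) - 1) * thr \<le> next_start n - new_val n" if c: "cstar \<le> c n"
    proof (cases "kh n < n")
      case True
      then show ?thesis
        using inv(7)[OF True c] descent_large_penalty[OF v inv(5) c nostop]
        unfolding next_start_old[OF True] by (simp add: algebra_simps)
    next
      case False
      then show ?thesis using inv(1) next_start_new by simp
    qed
    have "(\<Sum>i<Suc n. sqrt (c i)) \<le> (real (Suc n) - real (kh n)) * sqrt (c n)
        + N * (1 + sqrt 2) * (sqrt (c n) - sqrt c1)"
      using inv(9) by (simp add: algebra_simps)
    then show ?thesis
      unfolding outer_inv_def zc_Suc pc_Suc kh' c' start cur
      using inv(1-3) it.z_in Pn next_upper descent len
      by (simp del: al_run.simps sum.lessThan_Suc)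
  qed
qed

lemma outer_sum_bound:
  assumes "al_reached D \<rho> \<eta> n"
  shows "(\<Sum>i<n. sqrt (c i)) \<le> N * (2 + sqrt 2) * sqrt cmax"
proof -
  have inv: "c1 \<le> c n" "c n \<le> cmax" "real n \<le> real (kh n) + N - 1"
    "(\<Sum>i<n. sqrt (c i)) \<le> (real n - real (kh n)) * sqrt (c n) + N * (1 + sqrt 2) * (sqrt (c n) - sqrt c1)"
    using outer_inv_run[OF assms] unfolding outer_inv_def by auto
  have "sqrt (c n) \<le> sqrt cmax" using inv(2) by simp
  have "(real n - real (kh n)) * sqrt (c n) \<le> N * sqrt cmax"
    using inv(1-3) c1_pos N_ge by (intro mult_mono) auto
  moreover have "N * (1 + sqrt 2) * (sqrt (c n) - sqrt c1) \<le> N * (1 + sqrt 2) * sqrt cmax"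
  proof (rule mult_left_mono)
    have "0 \<le> sqrt c1" using c1_pos by simp
    then show "sqrt (c n) - sqrt c1 \<le> sqrt cmax" using \<open>sqrt (c n) \<le> sqrt cmax\<close> by linarith
  qed (use N_ge in simp)
  moreover have "N * (2 + sqrt 2) * sqrt cmax = N * sqrt cmax + N * (1 + sqrt 2) * sqrt cmax"
    by (simp add: algebra_simps)
  ultimately show ?thesis using inv(4) by linarith
qed

lemma reached_valid:
  assumes "al_reached D \<rho> \<eta> n"
  shows "valid_state (s n)"
  using outer_inv_run[OF assms] c1_pos valid_run[OF assms] unfolding outer_inv_def by linarith

text \<open>Each iteration contributes at least \<open>sqrt c1\<close> to the bounded weighted sum,
  so an endless run is impossible; the number of cycles need not be counted.\<close>

lemma halts_exists: "\<exists>n. al_halts D \<rho> \<eta> n"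
proof (rule ccontr)
  assume no: "\<nexists>n. al_halts D \<rho> \<eta> n"
  have reached: "al_reached D \<rho> \<eta> n" for n
  proof (induction n)
    case 0
    show ?case unfolding al_reached_def by simp
  next
    case (Suc n)
    interpret it: al_iteration D Kh \<tau> zbar "s n" by unfold_locales (rule reached_valid[OF Suc])
    show ?case using Suc it.inner_terminates(1) no unfolding reached_Suc al_halts_def by blast
  qed
  obtain n :: nat where n: "N * (2 + sqrt 2) * sqrt cmax / sqrt c1 < real n"
    using reals_Archimedean2 by blast
  have "real n * sqrt c1 = (\<Sum>i<n. sqrt c1)" by simp
  also have "\<dots> \<le> (\<Sum>i<n. sqrt (c i))"
    using outer_inv_run[OF reached] unfolding outer_inv_def by (intro sum_mono) simp
  also have "\<dots> \<le> N * (2 + sqrt 2) * sqrt cmax" by (rule outer_sum_bound[OF reached])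
  finally show False using n c1_pos by (simp add: pos_divide_less_eq)
qed

text \<open>Every call is charged to the weight \<open>sqrt (c n)\<close> of the outer sum. Even the
  additive 2 fits this form, since \<open>c1 \<le> c n\<close>.\<close>

lemma inner_bound:
  assumes "al_reached D \<rho> \<eta> n"
  shows "real (al_inner D (s n)) \<le> sqrt (c n) * (2 / sqrt c1 + 2 * sqrt (E / \<mu>) * ln (8 * (E * cmax)\<^sup>2 / \<theta>\<^sup>2))"
proof -
  interpret it: al_iteration D Kh \<tau> zbar "s n" by unfold_locales (rule reached_valid[OF assms])
  have inv: "c1 \<le> c n" "c n \<le> cmax" "norm (pc n) \<le> P"
    using outer_inv_run[OF assms] unfolding outer_inv_def by auto
  let ?L = "al_Lpsi D (s n)"
  have "?L \<le> E * c n"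
  proof -
    have "lam * (M + Lg * norm (pc n)) \<le> lam * (M + Lg * P)"
      using lam_pos Lg_pos inv(3) by simp
    then have "?L \<le> (lam * (M + Lg * P) + 1) + lam * (B0 * Lg + B1\<^sup>2) * c n"
      unfolding it.L_eq auglag_lip_def by (simp add: algebra_simps)
    also have "lam * (M + Lg * P) + 1 \<le> (lam * (M + Lg * P) + 1) / c1 * c n"
    proof -
      have "0 \<le> lam * (M + Lg * P) + 1" using lam_pos M_pos Lg_pos P_nonneg by simp
      then have "(lam * (M + Lg * P) + 1) * c1 \<le> (lam * (M + Lg * P) + 1) * c n"
        using inv(1) by (intro mult_left_mono) auto
      then show ?thesis using c1_pos by (simp add: pos_le_divide_eq)
    qed
    finally show ?thesis unfolding E_def by (simp add: algebra_simps)
  qed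
  moreover have "E * c n \<le> E * cmax" using inv(2) E_pos by simp
  ultimately have L: "?L \<le> E * c n" "?L \<le> E * cmax" by linarith+
  define l where "l = ln (8 * (E * cmax)\<^sup>2 / \<theta>\<^sup>2)"
  have L1: "1 \<le> ?L" by (rule it.L_ge)
  have sq: "1 \<le> 8 * ?L\<^sup>2 / \<theta>\<^sup>2"
  proof -
    have "1 \<le> ?L\<^sup>2" using L1 by (simp add: one_le_power)
    then have "\<theta>\<^sup>2 \<le> 8 * ?L\<^sup>2" using th_sq by linarith
    then show ?thesis using th_pos by (simp add: pos_le_divide_eq)
  qed
  have "8 * ?L\<^sup>2 / \<theta>\<^sup>2 \<le> 8 * (E * cmax)\<^sup>2 / \<theta>\<^sup>2"
    using L(2) L1 by (intro divide_right_mono mult_left_mono power_mono) auto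
  then have ll: "ln (8 * ?L\<^sup>2 / \<theta>\<^sup>2) \<le> l" unfolding l_def using sq by (subst ln_le_cancel_iff) auto
  have l0: "0 \<le> ln (8 * ?L\<^sup>2 / \<theta>\<^sup>2)" using sq by simp
  have "sqrt (?L / \<mu>) \<le> sqrt (E * c n / \<mu>)"
    using L(1) mu_bounds by (simp add: divide_right_mono)
  also have "\<dots> = sqrt (c n) * sqrt (E / \<mu>)"
    by (simp flip: real_sqrt_mult)
  finally have sq2: "sqrt (?L / \<mu>) \<le> sqrt (c n) * sqrt (E / \<mu>)" .
  have "sqrt (?L / \<mu>) * ln (8 * ?L\<^sup>2 / \<theta>\<^sup>2) \<le> (sqrt (c n) * sqrt (E / \<mu>)) * l"
    using sq2 ll l0 it.c_pos E_pos mu_bounds by (intro mult_mono) auto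
  moreover have "2 \<le> sqrt (c n) * (2 / sqrt c1)" using inv(1) c1_pos by (simp add: field_simps)
  moreover have "real (al_inner D (s n)) \<le> 2 + 2 * (sqrt (?L / \<mu>) * ln (8 * ?L\<^sup>2 / \<theta>\<^sup>2))"
    using it.inner_terminates(4) by (simp add: mult.assoc)
  ultimately have "real (al_inner D (s n)) \<le> sqrt (c n) * (2 / sqrt c1) + 2 * (sqrt (c n) * sqrt (E / \<mu>) * l)"
    by linarith
  then show ?thesis unfolding l_def[symmetric] by (simp add: algebra_simps)
qed

lemma total_inner_bound:
  assumes "al_reached D \<rho> \<eta> n"
  shows "real (al_total_inner D \<rho> n) \<le> N * (3 + sqrt 2) * sqrt cmax *
    (2 / sqrt c1 + 2 * sqrt (E / \<mu>) * ln (8 * (E * cmax)\<^sup>2 / \<theta>\<^sup>2))"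
proof -
  define K where "K = 2 / sqrt c1 + 2 * sqrt (E / \<mu>) * ln (8 * (E * cmax)\<^sup>2 / \<theta>\<^sup>2)"
  have reached: "al_reached D \<rho> \<eta> i" if "i \<le> n" for i
    using assms that unfolding al_reached_def by auto
  have inv: "c1 \<le> c n" "c n \<le> cmax" using outer_inv_run[OF assms] unfolding outer_inv_def by auto
  \<comment> \<open>The sign of \<open>K\<close> is read off from the fact that it dominates an
    iteration count, which avoids examining the logarithm.\<close>
  have "0 \<le> sqrt (c n) * K" using inner_bound[OF assms] unfolding K_def[symmetric]
    by (meson of_nat_0_le_iff order_trans)
  moreover have "0 < sqrt (c n)" using inv c1_pos by simp
  ultimately have K0: "0 \<le> K" by (simp add: zero_le_mult_iff)
  have "real (al_total_inner D \<rho> n) = (\<Sum>i\<le>n. real (al_inner D (s i)))"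
    unfolding al_total_inner_def by simp
  also have "\<dots> \<le> (\<Sum>i\<le>n. sqrt (c i) * K)"
    unfolding K_def by (intro sum_mono inner_bound reached) simp
  also have "\<dots> = ((\<Sum>i<n. sqrt (c i)) + sqrt (c n)) * K"
    by (simp add: sum_distrib_right distrib_right flip: lessThan_Suc_atMost)
  also have "\<dots> \<le> (N * (3 + sqrt 2) * sqrt cmax) * K"
  \<comment> \<open>The halting iteration itself lies outside the outer sum; its call raises
    \<open>2 + sqrt 2\<close> to \<open>3 + sqrt 2\<close>.\<close>
  proof (rule mult_right_mono[OF _ K0])
    have "sqrt (c n) \<le> 1 * sqrt cmax" using inv(2) by simp
    also have "\<dots> \<le> N * sqrt cmax" using N_ge inv c1_pos by (intro mult_right_mono) auto
    finally show "(\<Sum>i<n. sqrt (c i)) + sqrt (c n) \<le> N * (3 + sqrt 2) * sqrt cmax"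
      using outer_sum_bound[OF assms] by (simp add: algebra_simps)
  qed
  finally show ?thesis unfolding K_def by (simp add: mult.assoc)
qed

end

section \<open>Complexity\<close>

context al_problem
begin

lemma diameter_pos: "0 < diameter Z"
proof -
  obtain \<delta> where \<delta>: "0 < \<delta>" "cball zbar \<delta> \<subseteq> Z" using zbar_int unfolding mem_interior_cball by blast
  have "0 < diameter (cball zbar \<delta>)" using \<delta> by simp
  also have "\<dots> \<le> diameter Z" by (rule diameter_subset[OF \<delta>(2) compact_imp_bounded[OF compact_Z]])
  finally show ?thesis .
qed

lemma boundary_distance_pos: "0 < infdist zbar (frontier Z)"
proof (rule infdist_pos_not_in_closed)
  show "closed (frontier Z)" by (rule frontier_closed)
  have "Z \<noteq> UNIV" using compact_imp_bounded[OF compact_Z] not_bounded_UNIV by metis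
  then show "frontier Z \<noteq> {}" using Z_nonempty frontier_eq_empty by blast
  show "zbar \<notin> frontier Z" using zbar_int unfolding frontier_def by blast
qed

lemma bnd1_real_nonneg: "0 \<le> bnd1_real Z f"
proof -
  have "bdd_above ((\<lambda>z. norm (grad f z)) ` Z)"
    by (intro bounded_imp_bdd_above compact_imp_bounded compact_continuous_image continuous_intros
        grad_f_continuous compact_Z)
  from cSUP_upper[OF zbar_in this] show ?thesis
    unfolding bnd1_real_def using norm_ge_zero order_trans by blast
qed

text \<open>\<open>real_of_ereal\<close> sends infinities to 0, so comparing the infima requires
  both to be finite: boundedness on \<open>Z\<close> gives the lower side and a feasible point of
  \<open>Z\<close> the upper one.\<close>

lemma optimal_value_gap_nonneg:
  assumes X: "X \<inter> Z \<noteq> {}"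
  shows "real_of_ereal (INF z. ereal (f z) + h z) \<le> real_of_ereal (INF z\<in>X. ereal (f z) + h z)"
proof -
  let ?\<phi> = "\<lambda>z. ereal (f z) + h z"
  obtain B where B: "\<And>z. z \<in> Z \<Longrightarrow> \<bar>f z + H z\<bar> \<le> B" using objective_bounded by blast
  have phi: "?\<phi> z = ereal (f z + H z)" if "z \<in> Z" for z
    using h_in[OF that] by (metis plus_ereal.simps(1))
  have "ereal (- B) \<le> ?\<phi> z" for z
  proof (cases "z \<in> Z")
    case True
    then show ?thesis unfolding phi[OF True] using B[OF True] by simp
  qed (simp add: h_off)
  then have low: "ereal (- B) \<le> (INF z. ?\<phi> z)" by (intro INF_greatest)
  have mono: "(INF z. ?\<phi> z) \<le> (INF z\<in>X. ?\<phi> z)" by (rule INF_superset_mono) auto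
  obtain x where x: "x \<in> X" "x \<in> Z" using X by blast
  have up: "(INF z\<in>X. ?\<phi> z) \<le> ereal (f x + H x)"
    using INF_lower[OF x(1), of ?\<phi>] phi[OF x(2)] by simp
  define I J where "I = (INF z. ?\<phi> z)" and "J = (INF z\<in>X. ?\<phi> z)"
  have "real_of_ereal I \<le> real_of_ereal J"
    using low mono up unfolding I_def[symmetric] J_def[symmetric] by (cases I; cases J) auto
  then show ?thesis unfolding I_def J_def .
qed

text \<open>\<open>A\<close> and \<open>B\<close> precede the tolerances in the quantifier order.
  For \<open>\<rho> \<le> 1\<close> all additive constants, such as \<open>c1\<close> in
  \<open>cmax\<close> and 2 in \<open>N\<close>, are absorbed into multiples of
  \<open>1 / \<rho>\<^sup>2\<close>.\<close>

lemma al_complexity: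
  "\<exists>A>0. \<exists>B>0. \<forall>\<rho>>0. \<forall>\<eta>>0. al_extrapolation_ok D \<rho> \<eta> \<longrightarrow>
    (\<exists>n. al_halts D \<rho> \<eta> n \<and> valid_state (al_run D \<rho> n) \<and>
      (\<rho> \<le> 1 \<longrightarrow> real (al_total_inner D \<rho> n)
        \<le> A / \<rho>\<^sup>2 * sqrt (1 / \<rho>\<^sup>2 + 1 / \<eta>) * max 1 (ln (B * (1 / \<rho>\<^sup>2 + 1 / \<eta>)))))"
proof -
  obtain P where P: "norm (al_p0 D) \<le> P"
    "\<And>s. valid_state s \<Longrightarrow> norm (al_pcur s) \<le> P \<Longrightarrow> norm (al_p D s) \<le> P"
    using multipliers_bounded by blast
  obtain \<Phi> where \<Phi>: "\<And>z. z \<in> Z \<Longrightarrow> \<bar>f z + H z\<bar> \<le> \<Phi>" using objective_bounded by blast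
  define a where "a = lam * (1 - \<theta>) / 36"
  define Q where "Q = 2 * P + 3 * (diameter Z / (1 - \<theta>)) / (lam * B1)"
  define R where "R = 2 * \<Phi> + P * B0 + 5 * P\<^sup>2 / c1"
  define E where "E = (lam * (M + Lg * P) + 1) / c1 + lam * (B0 * Lg + B1\<^sup>2)"
  define A1 where "A1 = 64 * P\<^sup>2 / a + \<bar>Q\<bar>"
  define A2 where "A2 = c1 + 2 * A1"
  \<comment> \<open>The 4 is the factor 2 of \<open>inner_bound\<close> times the 2 released by the
    logarithm of a square. The 3 in \<open>B\<close> comes from enlarging 8 to the square 9.\<close>
  define K where "K = 2 / sqrt c1 + 4 * sqrt (E / al_mu D)"
  define A where "A = (2 + \<bar>R\<bar> / a) * (3 + sqrt 2) * sqrt A2 * K"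
  define B where "B = 3 * \<bar>E\<bar> * A2 / \<theta>"
  have a: "0 < a" unfolding a_def using lam_pos th_less by simp
  have A1: "0 \<le> A1" unfolding A1_def using a by simp
  have A2: "0 < A2" unfolding A2_def using A1 c1_pos by simp
  have E: "0 < E"
  proof -
    have "0 \<le> P" using order_trans[OF norm_ge_zero P(1)] .
    then have "0 < lam * (M + Lg * P) + 1"
      using lam_pos M_pos Lg_pos by (intro add_nonneg_pos mult_nonneg_nonneg add_nonneg_nonneg) auto
    moreover have "0 \<le> lam * (B0 * Lg + B1\<^sup>2)"
      using lam_pos Lg_pos B0_nonneg by (intro mult_nonneg_nonneg add_nonneg_nonneg) auto
    ultimately show ?thesis unfolding E_def using c1_pos by (simp add: add_pos_nonneg)
  qed
  have K: "0 < K" unfolding K_def using c1_pos E mu_bounds by (intro add_pos_nonneg) auto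
  have A: "0 < A" unfolding A_def using a A2 K
    by (intro mult_pos_pos add_pos_nonneg) auto
  have B: "0 < B" unfolding B_def using E A2 th_pos by simp
  have main: "\<exists>n. al_halts D \<rho> \<eta> n \<and> valid_state (al_run D \<rho> n) \<and>
      (\<rho> \<le> 1 \<longrightarrow> real (al_total_inner D \<rho> n)
        \<le> A / \<rho>\<^sup>2 * sqrt (1 / \<rho>\<^sup>2 + 1 / \<eta>) * max 1 (ln (B * (1 / \<rho>\<^sup>2 + 1 / \<eta>))))"
    if \<rho>: "0 < \<rho>" and \<eta>: "0 < \<eta>" and ok: "al_extrapolation_ok D \<rho> \<eta>" for \<rho> \<eta>
  proof -
    interpret o: al_outer D Kh \<tau> zbar P \<Phi> \<rho> \<eta>
      by unfold_locales (fact P \<Phi> \<rho> \<eta> ok)+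
    have QRE: "o.Q = Q" "o.R = R" "o.E = E"
      unfolding o.Q_def Q_def o.R_def R_def o.E_def E_def by (rule refl)+
    obtain n where n: "al_halts D \<rho> \<eta> n" using o.halts_exists by blast
    then have reached: "al_reached D \<rho> \<eta> n" unfolding al_halts_def by blast
    define X where "X = 1 / \<rho>\<^sup>2 + 1 / \<eta>"
    have "real (al_total_inner D \<rho> n) \<le> A / \<rho>\<^sup>2 * sqrt X * max 1 (ln (B * X))" if r1: "\<rho> \<le> 1"
    proof -
      have "\<rho>\<^sup>2 \<le> 1" using r1 \<rho> by (simp add: power_le_one)
      then have r2: "1 \<le> 1 / \<rho>\<^sup>2" using \<rho> by simp
      have X1: "1 \<le> X" "1 / \<rho>\<^sup>2 \<le> X" "1 / \<eta> \<le> X" unfolding X_def using r2 \<rho> \<eta> by (auto simp: add_increasing2)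
      have thr: "o.thr = a * \<rho>\<^sup>2" unfolding o.thr_def a_def by simp
      have "o.cstar = 64 * P\<^sup>2 / a * (1 / \<rho>\<^sup>2) + Q * (1 / \<eta>)" unfolding o.cstar_def thr QRE by simp
      also have "\<dots> \<le> 64 * P\<^sup>2 / a * X + \<bar>Q\<bar> * X"
      proof (rule add_mono)
        show "64 * P\<^sup>2 / a * (1 / \<rho>\<^sup>2) \<le> 64 * P\<^sup>2 / a * X" using X1 a by (intro mult_left_mono) auto
        show "Q * (1 / \<eta>) \<le> \<bar>Q\<bar> * X" using X1 \<eta> by (intro mult_mono) auto
      qed
      also have "\<dots> = A1 * X" unfolding A1_def by (simp add: distrib_right)
      finally have cs: "o.cstar \<le> A1 * X" .
      have cmax: "o.cmax \<le> A2 * X"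
      proof -
        have "c1 \<le> c1 * X" using c1_pos X1 by simp
        moreover have "0 \<le> A1 * X" using A1 X1 by simp
        ultimately show ?thesis
          using cs c1_pos unfolding o.cmax_def A2_def distrib_right mult.assoc by linarith
      qed
      have cmax0: "0 < o.cmax" unfolding o.cmax_def using c1_pos by simp
      have N: "o.N \<le> (2 + \<bar>R\<bar> / a) / \<rho>\<^sup>2"
      proof -
        have "R / (a * \<rho>\<^sup>2) \<le> \<bar>R\<bar> / (a * \<rho>\<^sup>2)" using a \<rho> by (intro divide_right_mono) auto
        then have "o.N \<le> 2 * (1 / \<rho>\<^sup>2) + \<bar>R\<bar> / a * (1 / \<rho>\<^sup>2)"
          using r2 unfolding o.N_def thr QRE by simp
        then show ?thesis by (simp add: add_divide_distrib)
      qed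
      have BX: "8 * (E * o.cmax)\<^sup>2 / \<theta>\<^sup>2 \<le> (B * X)\<^sup>2"
      proof -
        have "E * o.cmax \<le> E * (A2 * X)" using cmax E by simp
        then have "(E * o.cmax)\<^sup>2 \<le> (E * (A2 * X))\<^sup>2"
          using E cmax0 by (intro power_mono) auto
        then have "8 * (E * o.cmax)\<^sup>2 / \<theta>\<^sup>2 \<le> 9 * (E * (A2 * X))\<^sup>2 / \<theta>\<^sup>2"
          by (intro divide_right_mono mult_mono) auto
        also have "\<dots> = (B * X)\<^sup>2"
          unfolding B_def using E by (simp add: power_mult_distrib power_divide)
        finally show ?thesis .
      qed
      have BX0: "0 < B * X" using B X1 by simp
      have "ln (8 * (E * o.cmax)\<^sup>2 / \<theta>\<^sup>2) \<le> ln ((B * X)\<^sup>2)"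
        using BX E cmax0 th_pos BX0 by (subst ln_le_cancel_iff) auto
      also have "\<dots> = 2 * ln (B * X)" using BX0 by (simp add: ln_realpow)
      finally have ln: "ln (8 * (E * o.cmax)\<^sup>2 / \<theta>\<^sup>2) \<le> 2 * max 1 (ln (B * X))" by linarith
      define l where "l = max 1 (ln (B * X))"
      have l1: "1 \<le> l" unfolding l_def by simp
      define k where "k = 2 / sqrt c1 + 2 * sqrt (E / al_mu D) * ln (8 * (E * o.cmax)\<^sup>2 / \<theta>\<^sup>2)"
      have kK: "k \<le> K * l"
      proof -
        have "2 / sqrt c1 * 1 \<le> 2 / sqrt c1 * l" using l1 c1_pos by (intro mult_left_mono) auto
        moreover have "2 * sqrt (E / al_mu D) * ln (8 * (E * o.cmax)\<^sup>2 / \<theta>\<^sup>2) \<le> 2 * sqrt (E / al_mu D) * (2 * l)"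
          using ln E mu_bounds unfolding l_def by (intro mult_left_mono) auto
        ultimately show ?thesis unfolding k_def K_def by (simp add: algebra_simps)
      qed
      have "real (al_total_inner D \<rho> n) \<le> o.N * (3 + sqrt 2) * sqrt o.cmax * k"
        using o.total_inner_bound[OF reached] unfolding QRE k_def .
      also have "\<dots> \<le> o.N * (3 + sqrt 2) * sqrt o.cmax * (K * l)"
        using kK o.N_ge cmax0 by (intro mult_left_mono) auto
      also have "\<dots> \<le> (2 + \<bar>R\<bar> / a) / \<rho>\<^sup>2 * (3 + sqrt 2) * sqrt (A2 * X) * (K * l)"
        using N cmax o.N_ge cmax0 a K l1 by (intro mult_right_mono mult_mono) auto
      also have "\<dots> = A / \<rho>\<^sup>2 * sqrt X * l"
        unfolding A_def real_sqrt_mult by simp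
      finally show ?thesis unfolding l_def .
    qed
    then show ?thesis using n o.reached_valid[OF reached] unfolding X_def by blast
  qed
  show ?thesis using A B main by blast
qed

end

theorem theorem4p2p4:
  fixes f :: "'a::euclidean_space \<Rightarrow> real"
    and h :: "'a \<Rightarrow> ereal"
    and g :: "'a \<Rightarrow> real ^ 'l"
    and K :: "(real ^ 'l) set"
    and Z :: "'a set"
    and Kh m M Lg \<tau> lam \<theta> c1 :: real
    and zbar z0 :: 'a
    and p0 :: "real ^ 'l"
  assumes K: "closed K" "convex_cone K"
    and h: "closed_conv Z h" "convex Z" "compact Z"
      "0 < Kh" "Kh-lipschitz_on Z (\<lambda>z. real_of_ereal (h z))"
    and f: "0 < m" "m \<le> M" "curvature_class m M Z f"
    and g: "cont_diff g" "cone_convex K g" "0 < Lg"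
      "\<And>u z. onorm (\<lambda>p. nabla g u p - nabla g z p) \<le> Lg * norm (u - z)"
    and slater: "zbar \<in> interior Z" "0 < \<tau>" "\<tau> \<le> 1" "cone_le K (g zbar) 0"
      "\<And>z p. z \<in> Z \<Longrightarrow> p \<in> dual_cone K \<Longrightarrow>
         \<tau> * norm p \<le> max (norm (nabla g z p)) \<bar>g zbar \<bullet> p\<bar>"
    and feasible: "\<exists>z\<in>Z. cone_le K (g z) 0"
    and inputs: "0 < lam" "lam < 1 / m" "0 < \<theta>" "\<theta> \<le> 1 / sqrt 2" "0 < c1" "z0 \<in> Z"
  defines "D \<equiv> \<lparr>al_f = f, al_h = h, al_g = g, al_K = K, al_Z = Z, al_m = m, al_M = M,
      al_Lg = Lg, al_lam = lam, al_th = \<theta>, al_c1 = c1, al_z0 = z0, al_p0 = p0\<rparr>"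
    and "Dz \<equiv> diameter Z"
    and "dbar \<equiv> infdist zbar (frontier Z)"
    and "\<phi> \<equiv> (\<lambda>z. ereal (f z) + h z)"
  defines "R\<phi> \<equiv> real_of_ereal (INF z\<in>{z. cone_le K (g z) 0}. \<phi> z) - real_of_ereal (INF z. \<phi> z)
      + 1 / lam * Dz\<^sup>2"
    and "\<kappa>0 \<equiv> 2 * (Kh + bnd1_real Z f) * Dz
      + (\<theta>\<^sup>2 / (2 * (1 - \<theta>)\<^sup>2) + 2 * ((1 + \<theta>) / (1 - \<theta>))) * (Dz\<^sup>2 / lam)"
  defines "\<kappa>1 \<equiv> M + \<kappa>0 * Lg / (min 1 dbar * \<tau>)"
    and "\<kappa>2 \<equiv> bnd0 Z g * Lg + (bnd1 Z g)\<^sup>2"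
    and "\<kappa>3 \<equiv> 16 * (1 + 2 * \<theta>)\<^sup>2 * (max (norm p0) \<kappa>0)\<^sup>2
      / (lam * (1 - \<theta>\<^sup>2) * min 1 (dbar\<^sup>2) * \<tau>\<^sup>2)"
    and "\<kappa>4 \<equiv> \<theta> * Dz / (lam * (1 - \<theta>) * bnd1 Z g)
      + 2 * (max (norm p0) \<kappa>0)\<^sup>2 / (min 1 dbar * \<tau>)"
  defines "cbar \<equiv> (\<lambda>\<rho> \<eta>. \<kappa>3 / \<rho>\<^sup>2 + \<kappa>4 / \<eta>)"
  defines "T \<equiv> (\<lambda>\<rho> \<eta>. (lam * (\<kappa>1 + c1 * \<kappa>2) + 1) * (max c1 (2 * cbar \<rho> \<eta>) / c1))"
  shows "\<exists>C>0. \<exists>\<delta>>0. \<forall>\<rho>>0. \<forall>\<eta>>0. al_extrapolation_ok D \<rho> \<eta> \<longrightarrow>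
    (\<exists>n. al_halts D \<rho> \<eta> n \<and>
      (let s = al_run D \<rho> n; zh = al_zhat D s; ph = al_phat D s; vh = al_vhat D s; qh = al_qhat D s
       in zh \<in> Z \<and>
          vh \<in> (\<lambda>w. grad f zh + w + nabla g zh ph) ` subdiff h zh \<and>
          (g zh + qh) \<bullet> ph = 0 \<and>
          cone_le K (g zh + qh) 0 \<and>
          ph \<in> dual_cone K \<and>
          norm vh \<le> \<rho> \<and> norm qh \<le> \<eta>) \<and>
      (\<rho> \<le> \<delta> \<longrightarrow> \<eta> \<le> \<delta> \<longrightarrow>
         real (al_total_inner D \<rho> n)
           \<le> C * (R\<phi> / (lam * \<rho>\<^sup>2) * sqrt (T \<rho> \<eta> / (1 - lam * m)) * log1_plus (T \<rho> \<eta> / \<theta>))))"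
proof -
  interpret P: al_problem D Kh \<tau> zbar
    by unfold_locales (use K h f g slater inputs in \<open>simp_all add: D_def\<close>)
  have D: "al_f D = f" "al_h D = h" "al_g D = g" "al_K D = K" "al_Z D = Z" "al_m D = m"
    "al_M D = M" "al_Lg D = Lg" "al_lam D = lam" "al_th D = \<theta>" "al_c1 D = c1"
    unfolding D_def by simp_all
  have Dz: "0 < Dz" using P.diameter_pos unfolding D Dz_def .
  have dbar: "0 < dbar" using P.boundary_distance_pos unfolding D dbar_def .
  have th: "0 < \<theta>" "\<theta> < 1" "\<theta>\<^sup>2 < 1" using inputs(3) P.th_less P.th_sq unfolding D by auto
  have M: "0 < M" using f by linarith
  have B0: "0 \<le> bnd0 Z g" and B1: "0 \<le> bnd1 Z g" and Bf: "0 \<le> bnd1_real Z f"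
    using P.B0_nonneg P.B1_nonneg P.bnd1_real_nonneg unfolding D .
  have mu: "0 < 1 - lam * m" using P.mu_bounds(1) unfolding al_mu_def D .
  then have \<kappa>0: "0 < \<kappa>0"
    unfolding \<kappa>0_def using Dz th inputs(1) h(4) Bf
    by (intro add_pos_nonneg mult_pos_pos mult_nonneg_nonneg add_nonneg_nonneg divide_nonneg_nonneg) auto
  have \<kappa>1: "0 \<le> \<kappa>1" unfolding \<kappa>1_def using M \<kappa>0 g(3) dbar slater(2) by simp
  have \<kappa>2: "0 \<le> \<kappa>2" unfolding \<kappa>2_def using B0 g(3) by simp
  have max0: "0 < max (norm p0) \<kappa>0" using \<kappa>0 by simp
  have \<kappa>3: "0 < \<kappa>3"
    unfolding \<kappa>3_def using max0 inputs(1) th dbar slater(2)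
    by (intro divide_pos_pos mult_pos_pos zero_less_power) auto
  \<comment> \<open>Positivity rests on the second summand; the first is merely nonnegative and
    equals 0 if \<open>bnd1 Z g = 0\<close>.\<close>
  have \<kappa>4: "0 < \<kappa>4"
    unfolding \<kappa>4_def using max0 inputs(1) th dbar slater(2) Dz B1
    by (intro add_nonneg_pos divide_nonneg_nonneg divide_pos_pos mult_pos_pos mult_nonneg_nonneg
        zero_less_power) auto
  \<comment> \<open>Strict positivity, supplied by the diameter term, allows \<open>C\<close> to
    divide by \<open>R\<phi>\<close>.\<close>
  have R\<phi>: "0 < R\<phi>"
  proof -
    have "{z. cone_le K (g z) 0} \<inter> Z \<noteq> {}" using feasible by blast
    from P.optimal_value_gap_nonneg[unfolded D, OF this]
    have "0 \<le> real_of_ereal (INF z\<in>{z. cone_le K (g z) 0}. \<phi> z) - real_of_ereal (INF z. \<phi> z)"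
      unfolding \<phi>_def by simp
    moreover have "0 < 1 / lam * Dz\<^sup>2" using Dz inputs(1) by simp
    ultimately show ?thesis unfolding R\<phi>_def by linarith
  qed
  obtain A B where A: "0 < A" and B: "0 < B" and
    main: "\<And>\<rho> \<eta>. 0 < \<rho> \<Longrightarrow> 0 < \<eta> \<Longrightarrow> al_extrapolation_ok D \<rho> \<eta> \<Longrightarrow>
    \<exists>n. al_halts D \<rho> \<eta> n \<and> P.valid_state (al_run D \<rho> n) \<and>
      (\<rho> \<le> 1 \<longrightarrow> real (al_total_inner D \<rho> n)
        \<le> A / \<rho>\<^sup>2 * sqrt (1 / \<rho>\<^sup>2 + 1 / \<eta>) * max 1 (ln (B * (1 / \<rho>\<^sup>2 + 1 / \<eta>))))"
    using P.al_complexity by blast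
  \<comment> \<open>The smaller of \<open>\<kappa>3\<close> and \<open>\<kappa>4\<close> bounds
    \<open>cbar\<close> from below by a multiple of \<open>1 / \<rho>\<^sup>2 + 1 / \<eta>\<close>;
    the other factor of \<open>T\<close> is at least 1.\<close>
  define t where "t = 2 * min \<kappa>3 \<kappa>4 / c1"
  have t: "0 < t" unfolding t_def using \<kappa>3 \<kappa>4 inputs(5) by simp
  \<comment> \<open>Passing from \<open>B * X\<close> to \<open>T \<rho> \<eta> / \<theta>\<close>
    inside the logarithm costs an additive constant. Because \<open>log1_plus\<close> is at least 1,
    that constant becomes the factor \<open>W\<close>.\<close>
  define W where "W = 1 + \<bar>ln (B * \<theta> / t)\<bar>"
  \<comment> \<open>Undoes the factors \<open>R\<phi>\<close>, \<open>lam\<close> and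
    \<open>sqrt (1 - lam * m)\<close> of the displayed bound, none of which depends on the
    tolerances.\<close>
  define C where "C = A * W * lam * sqrt (1 - lam * m) / (R\<phi> * sqrt t)"
  have C: "0 < C"
    unfolding C_def W_def using A inputs(1) mu R\<phi> t by (intro divide_pos_pos mult_pos_pos) auto
  have T_ge: "t * (1 / \<rho>\<^sup>2 + 1 / \<eta>) \<le> T \<rho> \<eta>" if \<rho>: "0 < \<rho>" and \<eta>: "0 < \<eta>" for \<rho> \<eta>
  proof -
    let ?k = "min \<kappa>3 \<kappa>4"
    have "?k * (1 / \<rho>\<^sup>2) \<le> \<kappa>3 * (1 / \<rho>\<^sup>2)" "?k * (1 / \<eta>) \<le> \<kappa>4 * (1 / \<eta>)"
      using \<rho> \<eta> by (intro mult_right_mono; simp)+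
    then have "?k * (1 / \<rho>\<^sup>2 + 1 / \<eta>) \<le> cbar \<rho> \<eta>"
      unfolding cbar_def distrib_left by simp
    then have "2 * (?k * (1 / \<rho>\<^sup>2 + 1 / \<eta>)) \<le> max c1 (2 * cbar \<rho> \<eta>)" by linarith
    then have "2 * (?k * (1 / \<rho>\<^sup>2 + 1 / \<eta>)) / c1 \<le> max c1 (2 * cbar \<rho> \<eta>) / c1"
      using inputs(5) by (intro divide_right_mono) auto
    then have "t * (1 / \<rho>\<^sup>2 + 1 / \<eta>) \<le> 1 * (max c1 (2 * cbar \<rho> \<eta>) / c1)"
      unfolding t_def by (simp add: mult.assoc)
    also have "\<dots> \<le> T \<rho> \<eta>"
      unfolding T_def
    proof (rule mult_right_mono)
      have "0 \<le> lam * (\<kappa>1 + c1 * \<kappa>2)" using inputs(1,5) \<kappa>1 \<kappa>2 by simp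
      then show "1 \<le> lam * (\<kappa>1 + c1 * \<kappa>2) + 1" by linarith
      show "0 \<le> max c1 (2 * cbar \<rho> \<eta>) / c1" using inputs(5) by (simp add: le_max_iff_disj)
    qed
    finally show ?thesis .
  qed
  have bound: "A / \<rho>\<^sup>2 * sqrt (1 / \<rho>\<^sup>2 + 1 / \<eta>) * max 1 (ln (B * (1 / \<rho>\<^sup>2 + 1 / \<eta>)))
      \<le> C * (R\<phi> / (lam * \<rho>\<^sup>2) * sqrt (T \<rho> \<eta> / (1 - lam * m)) * log1_plus (T \<rho> \<eta> / \<theta>))"
    if \<rho>: "0 < \<rho>" and \<eta>: "0 < \<eta>" for \<rho> \<eta>
  proof -
    define X where "X = 1 / \<rho>\<^sup>2 + 1 / \<eta>"
    define l where "l = log1_plus (T \<rho> \<eta> / \<theta>)"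
    have X: "0 < X" unfolding X_def using \<rho> \<eta> by (simp add: add_pos_pos)
    have XT: "X \<le> T \<rho> \<eta> / t" using T_ge[OF \<rho> \<eta>] t unfolding X_def by (simp add: pos_le_divide_eq mult.commute)
    have "0 < T \<rho> \<eta> / t" using X XT by linarith
    then have T0: "0 < T \<rho> \<eta>" using t by (simp add: zero_less_divide_iff)
    have l: "1 \<le> l" "ln (T \<rho> \<eta> / \<theta>) \<le> l" unfolding l_def log1_plus_def by auto
    have "B * X \<le> (B * \<theta> / t) * (T \<rho> \<eta> / \<theta>)"
      using mult_left_mono[OF XT, of B] B th by simp
    then have "ln (B * X) \<le> ln ((B * \<theta> / t) * (T \<rho> \<eta> / \<theta>))"
      using B X t th T0 by (subst ln_le_cancel_iff) auto
    also have "\<dots> = ln (B * \<theta> / t) + ln (T \<rho> \<eta> / \<theta>)"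
      using B t th T0 by (intro ln_mult_pos) auto
    also have "\<dots> \<le> \<bar>ln (B * \<theta> / t)\<bar> * l + l"
    proof (rule add_mono[OF _ l(2)])
      have "\<bar>ln (B * \<theta> / t)\<bar> * 1 \<le> \<bar>ln (B * \<theta> / t)\<bar> * l" using l(1) by (intro mult_left_mono) auto
      then show "ln (B * \<theta> / t) \<le> \<bar>ln (B * \<theta> / t)\<bar> * l" by linarith
    qed
    also have "\<dots> = W * l" unfolding W_def by (simp add: algebra_simps)
    finally have lnW: "ln (B * X) \<le> W * l" .
    have "1 * 1 \<le> W * l" using l(1) unfolding W_def by (intro mult_mono) auto
    then have W: "max 1 (ln (B * X)) \<le> W * l" using lnW by simp
    have "sqrt X \<le> sqrt (T \<rho> \<eta>) / sqrt t" using XT by (simp flip: real_sqrt_divide)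
    then have "A / \<rho>\<^sup>2 * sqrt X * max 1 (ln (B * X)) \<le> A / \<rho>\<^sup>2 * (sqrt (T \<rho> \<eta>) / sqrt t) * (W * l)"
      using W A X T0 t by (intro mult_mono mult_nonneg_nonneg) auto
    also have "\<dots> = C * (R\<phi> / (lam * \<rho>\<^sup>2) * sqrt (T \<rho> \<eta> / (1 - lam * m)) * l)"
    proof -
      have "lam \<noteq> 0" "R\<phi> \<noteq> 0" "sqrt (1 - lam * m) \<noteq> 0" using inputs(1) R\<phi> mu by auto
      then show ?thesis unfolding C_def real_sqrt_divide by (simp add: mult_ac)
    qed
    finally show ?thesis unfolding X_def l_def .
  qed
  show ?thesis
  \<comment> \<open>The smallness threshold 1 is inherited from \<open>al_complexity\<close>, whose
    count is stated for \<open>\<rho> \<le> 1\<close>.\<close>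
  proof (rule exI[of _ C], rule conjI[OF C], rule exI[of _ "1::real"], intro conjI allI impI)
    fix \<rho> \<eta> :: real
    assume \<rho>: "0 < \<rho>" and \<eta>: "0 < \<eta>" and ok: "al_extrapolation_ok D \<rho> \<eta>"
    obtain n where n: "al_halts D \<rho> \<eta> n" "P.valid_state (al_run D \<rho> n)" and
      total: "\<rho> \<le> 1 \<Longrightarrow> real (al_total_inner D \<rho> n)
        \<le> A / \<rho>\<^sup>2 * sqrt (1 / \<rho>\<^sup>2 + 1 / \<eta>) * max 1 (ln (B * (1 / \<rho>\<^sup>2 + 1 / \<eta>)))"
      using main[OF \<rho> \<eta> ok] by blast
    interpret it: al_iteration D Kh \<tau> zbar "al_run D \<rho> n" by unfold_locales (rule n)
    have stop: "norm (al_vhat D (al_run D \<rho> n)) \<le> \<rho>" "norm (al_qhat D (al_run D \<rho> n)) \<le> \<eta>"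
      using n(1) unfolding al_halts_def al_stop_def by auto
    show "\<exists>n. al_halts D \<rho> \<eta> n \<and>
      (let s = al_run D \<rho> n; zh = al_zhat D s; ph = al_phat D s; vh = al_vhat D s; qh = al_qhat D s
       in zh \<in> Z \<and>
          vh \<in> (\<lambda>w. grad f zh + w + nabla g zh ph) ` subdiff h zh \<and>
          (g zh + qh) \<bullet> ph = 0 \<and>
          cone_le K (g zh + qh) 0 \<and>
          ph \<in> dual_cone K \<and>
          norm vh \<le> \<rho> \<and> norm qh \<le> \<eta>) \<and>
      (\<rho> \<le> 1 \<longrightarrow> \<eta> \<le> 1 \<longrightarrow>
         real (al_total_inner D \<rho> n)
           \<le> C * (R\<phi> / (lam * \<rho>\<^sup>2) * sqrt (T \<rho> \<eta> / (1 - lam * m)) * log1_plus (T \<rho> \<eta> / \<theta>)))"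
      unfolding Let_def
      using n(1) it.zh_in[unfolded D] it.output_conditions[unfolded D] stop
        order_trans[OF total bound[OF \<rho> \<eta>]]
      by blast
  qed simp
qed

end
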